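(* Let $K$ be a noetherian commutative ring with unity and $c\ge1$ an integer. Let $\mathbf{B}$ be a subalgebra of the $\mathrm{OI}$-algebra $\mathbf{P}\cong(\mathbf{X}^{\mathrm{OI},1})^{\otimes c}$ that is generated by monomials over $K$. Assume that for any monomials $\mu,\nu\in\mathbf{B}$, say $\nu\in\mathbf{B}_m$ and $\mu\in\mathbf{B}_n$, whenever $\mu=\varepsilon^*(\nu)\cdot\kappa$ in $\mathbf{P}_n$ for some $\varepsilon\in\mathrm{Hom}_{\mathrm{OI}}([m],[n])$ and $\kappa \in \mathbf{P}_n$, one has $\kappa\in\mathbf{B}$ (i.e. $\kappa\in\mathbf{B}_n$). Then, for every integer $d\ge0$, every $\mathrm{OI}$-submodule of the free $\mathrm{OI}$-module $\mathbf{F}^{\mathrm{OI},d}$ over $\mathbf{B}$ has a finite Gröbner basis with respect to any monomial order on $\mathbf{F}^{\mathrm{OI},d}$. In particular, every finitely generated $\mathrm{OI}$-module over $\mathbf{B}$ is noetherian.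
   Context: $[n]=\{1,\dots,n\}$, $[0]=\emptyset$. $\mathrm{OI}$ is the category of totally ordered finite sets and order-preserving injective maps. An $\mathrm{OI}$-algebra over $K$ is a covariant functor $\mathbf{A}$ from $\mathrm{OI}$ to commutative associative unital $K$-algebras with $\mathbf{A}(\emptyset)=K$; $\mathbf{A}_S=\mathbf{A}(S)$, $\mathbf{A}_n=\mathbf{A}([n])$, $\varepsilon^*=\mathbf{A}(\varepsilon)$. A subalgebra is a family of $K$-subalgebras $\mathbf{B}_S\subseteq\mathbf{A}_S$ with $\varepsilon^*(\mathbf{B}_S)\subseteq\mathbf{B}_T$ for all $\varepsilon\colon S\to T$; it is generated by a subset $G\subseteq\coprod_n\mathbf{B}_n$ if $G$ is contained in no proper subalgebra of $\mathbf{B}$. $\mathbf{P}_S=K[x_{i,j} : i\in[c],\ j\in S]$ with $\varepsilon^*(x_{i,j})=x_{i,\varepsilon(j)}$; a monomial of $\mathbf{B}$ is a monomial in the variables $x_{i,j}$ of some $\mathbf{P}_n$ lying in $\mathbf{B}_n$. An $\mathrm{OI}$-module over $\mathbf{B}$ is a covariant functor $\mathbf{M}$ from $\mathrm{OI}$ to $K$-modules such that each $\mathbf{M}_S=\mathbf{M}(S)$ is also a $\mathbf{B}_S$-module and $\mathbf{M}(\varepsilon)(\mathbf{B}(\tilde\varepsilon)(a)\cdot q)=\mathbf{B}(\varepsilon\circ\tilde\varepsilon)(a)\cdot\mathbf{M}(\varepsilon)(q)$ for all morphisms $\tilde\varepsilon\colon\tilde S\to S$, $\varepsilon\colon S\to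 T$, $a\in\mathbf{B}_{\tilde S}$, $q\in\mathbf{M}_S$. Submodules are families of $\mathbf{B}_S$-submodules stable under all $\mathbf{M}(\varepsilon)$. $\mathbf{M}$ is finitely generated if some finite subset of $\coprod_{n\ge0}\mathbf{M}_n$ lies in no proper submodule; noetherian if all its submodules are finitely generated. The free module $\mathbf{F}=\mathbf{F}^{\mathrm{OI},d}$ over $\mathbf{B}$: $\mathbf{F}_S=\bigoplus_{\pi\in\mathrm{Hom}_{\mathrm{OI}}([d],S)}\mathbf{B}_S e_\pi$, $\mathbf{F}(\varepsilon)(a e_\pi)=\varepsilon^*(a)e_{\varepsilon\circ\pi}$. A monomial of $\mathbf{F}$ is an element $u e_\pi\in\mathbf{F}_m$ with $u$ a monomial in $\mathbf{B}_m$. Let $\iota_{m,n}\colon[m]\to[n]$, $j\mapsto j$. A monomial order on $\mathbf{F}$ is a total order $>$ on its monomials such that if $\mu,\nu$ are monomials in $\mathbf{F}_m$, then $\mu>\nu$ implies: (1) $u\mu>u\nu>\nu$ for every monomial $u\neq1$ in $\mathbf{B}_m$; (2) $\mathbf{F}(\varepsilon)(\mu)>\mathbf{F}(\varepsilon)(\nu)$ for every $\varepsilon\in\mathrm{Hom}_{\mathrm{OI}}([m],[n])$; (3) $\mathbf{F}(\iota_{m,n})(\mu)>\mu$ whenever $n>m$. For $0\ne q=\sum c_\mu\mu\in\mathbf{F}_m$ ($c_\mu\in K$), $\mathrm{lm}(q)$ is the largest monomial $\mu$ with $c_\mu\ne0$, and $\mathrm{lt}(q)=c_{\mathrm{lm}(q)}\,\mathrm{lm}(q)$.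 For a submodule $\mathbf{M}$ of $\mathbf{F}$, a subset $B$ of $\coprod_m\mathbf{M}_m$ is a Gröbner basis of $\mathbf{M}$ if the $\mathrm{OI}$-submodule of $\mathbf{F}$ generated by $\{\mathrm{lt}(b) : 0\ne b\in B\}$ equals the one generated by $\{\mathrm{lt}(q) : 0\neq q\in\coprod_m\mathbf{M}_m\}$. *)

theory Defs
  imports
    "HOL-Algebra.Algebraic_Closure_Type"
    "HOL-Algebra.Module"
    "HOL-Algebra.Ring_Divisibility"
    "HOL-Library.Poly_Mapping"
    "HOL-Library.FSet"
begin

section \<open>The category OI\<close>

text \<open>
  Objects are the finite sets of natural numbers with the induced order, i.e. the elements of
  \<^typ>\<open>nat fset\<close>.  This full subcategory contains every $[n]$ and
  representatives of every isomorphism class of totally ordered finite sets, so functors on it,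
  their subobjects and their generators are the same as for all totally ordered finite sets.
  Morphisms are extensional functions, so that equal morphisms are equal functions.
\<close>

definition oi_interval :: "nat \<Rightarrow> nat fset" where
  "oi_interval n = Abs_fset {1..n}"

lemma fset_oi_interval [simp]: "fset (oi_interval n) = {1..n}"
  by (simp add: oi_interval_def Abs_fset_inverse)

definition oi_hom :: "nat fset \<Rightarrow> nat fset \<Rightarrow> (nat \<Rightarrow> nat) set" where
  "oi_hom S T = {\<epsilon> \<in> fset S \<rightarrow>\<^sub>E fset T. strict_mono_on (fset S) \<epsilon>}"

definition oi_id :: "nat fset \<Rightarrow> nat \<Rightarrow> nat" where
  "oi_id S = (\<lambda>j\<in>fset S. j)"

definition oi_incl :: "nat \<Rightarrow> nat \<Rightarrow> nat" where
  "oi_incl m = (\<lambda>j\<in>{1..m}. j)"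

text \<open>
  The coproduct of the sets \<open>Y\<^sub>n = Y [n]\<close> over all \<open>n\<close>; a member is tagged with its width \<open>n\<close>.
\<close>

definition oi_coprod :: "(nat fset \<Rightarrow> 'a set) \<Rightarrow> (nat \<times> 'a) set" where
  "oi_coprod Y = (SIGMA n:UNIV. Y (oi_interval n))"


section \<open>The OI-algebra P, its subalgebras and their monomials\<close>

text \<open>
  Polynomials over \<open>'k\<close> in variables \<open>x\<^bsub>i,j\<^esub>\<close> indexed by pairs \<open>(i, j)\<close> of natural numbers:
  finitely supported functions from exponent vectors to coefficients, with the (convolution)
  product of \<^theory>\<open>HOL-Library.Poly_Mapping\<close>.
\<close>

type_synonym expo = "(nat \<times> nat) \<Rightarrow>\<^sub>0 nat"
type_synonym 'k pol = "expo \<Rightarrow>\<^sub>0 'k"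

definition pol_const :: "'k::comm_ring_1 \<Rightarrow> 'k pol" where
  "pol_const k = Poly_Mapping.single 0 k"

definition oi_P :: "nat \<Rightarrow> nat fset \<Rightarrow> 'k::comm_ring_1 pol set" where
  "oi_P c S = {p. \<forall>a\<in>Poly_Mapping.keys p. Poly_Mapping.keys a \<subseteq> {1..c} \<times> fset S}"

text \<open>
  The action of \<open>\<epsilon>\<close> on polynomials, i.e. the \<open>K\<close>-algebra homomorphism sending
  \<open>x\<^bsub>i,j\<^esub>\<close> to \<open>x\<^bsub>i,\<epsilon>(j)\<^esub>\<close>.
\<close>

definition expo_map :: "(nat \<Rightarrow> nat) \<Rightarrow> expo \<Rightarrow> expo" where
  "expo_map \<epsilon> a =
     (\<Sum>(i, j)\<in>Poly_Mapping.keys a. Poly_Mapping.single (i, \<epsilon> j) (Poly_Mapping.lookup a (i, j)))"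

definition pol_map :: "(nat \<Rightarrow> nat) \<Rightarrow> 'k::comm_ring_1 pol \<Rightarrow> 'k pol" where
  "pol_map \<epsilon> p =
     (\<Sum>a\<in>Poly_Mapping.keys p. Poly_Mapping.single (expo_map \<epsilon> a) (Poly_Mapping.lookup p a))"

definition oi_subalgebra ::
    "(nat fset \<Rightarrow> 'k::comm_ring_1 pol set) \<Rightarrow> (nat fset \<Rightarrow> 'k pol set) \<Rightarrow> bool" where
  "oi_subalgebra A B \<longleftrightarrow>
     (\<forall>S. B S \<subseteq> A S \<and> subring (B S) ring_of_type_algebra \<and> range pol_const \<subseteq> B S) \<and>
     (\<forall>S T. \<forall>\<epsilon>\<in>oi_hom S T. pol_map \<epsilon> ` B S \<subseteq> B T)"

definition oi_alg_generated_by ::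
    "(nat fset \<Rightarrow> 'k::comm_ring_1 pol set) \<Rightarrow> (nat \<times> 'k pol) set \<Rightarrow> bool" where
  "oi_alg_generated_by B G \<longleftrightarrow>
     G \<subseteq> oi_coprod B \<and> (\<forall>B'. oi_subalgebra B B' \<and> G \<subseteq> oi_coprod B' \<longrightarrow> B' = B)"

definition pol_monomials :: "(nat fset \<Rightarrow> 'k::comm_ring_1 pol set) \<Rightarrow> nat \<Rightarrow> 'k pol set" where
  "pol_monomials B n = {u \<in> B (oi_interval n). \<exists>a. u = Poly_Mapping.single a 1}"

definition oi_alg_monomially_generated :: "(nat fset \<Rightarrow> 'k::comm_ring_1 pol set) \<Rightarrow> bool" where
  "oi_alg_monomially_generated B \<longleftrightarrow>
     (\<exists>G \<subseteq> (SIGMA n:UNIV. pol_monomials B n). oi_alg_generated_by B G)"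


section \<open>OI-modules\<close>

definition alg_ring :: "'k::comm_ring_1 pol set \<Rightarrow> 'k pol ring" where
  "alg_ring R = ring_of_type_algebra\<lparr>carrier := R\<rparr>"

text \<open>
  \<open>M S\<close> is the module attached to the object \<open>S\<close>, and \<open>\<Phi> S T \<epsilon>\<close> the map attached to
  \<open>\<epsilon> : S \<rightarrow> T\<close>.  The \<open>K\<close>-module structure of \<open>M S\<close> is obtained from the \<open>B S\<close>-module
  structure by restriction of scalars along \<open>K \<rightarrow> B S\<close>.
\<close>

locale oi_module =
  fixes B :: "nat fset \<Rightarrow> 'k::comm_ring_1 pol set"
    and M :: "nat fset \<Rightarrow> ('k pol, 'm) module"
    and \<Phi> :: "nat fset \<Rightarrow> nat fset \<Rightarrow> (nat \<Rightarrow> nat) \<Rightarrow> 'm \<Rightarrow> 'm"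
  assumes module_obj: "module (alg_ring (B S)) (M S)"
    and map_closed: "\<epsilon> \<in> oi_hom S T \<Longrightarrow> \<Phi> S T \<epsilon> \<in> carrier (M S) \<rightarrow> carrier (M T)"
    and map_add: "\<lbrakk>\<epsilon> \<in> oi_hom S T; p \<in> carrier (M S); q \<in> carrier (M S)\<rbrakk> \<Longrightarrow>
      \<Phi> S T \<epsilon> (p \<oplus>\<^bsub>M S\<^esub> q) = \<Phi> S T \<epsilon> p \<oplus>\<^bsub>M T\<^esub> \<Phi> S T \<epsilon> q"
    and map_scalar: "\<lbrakk>\<epsilon> \<in> oi_hom S T; q \<in> carrier (M S)\<rbrakk> \<Longrightarrow>
      \<Phi> S T \<epsilon> (pol_const k \<odot>\<^bsub>M S\<^esub> q) = pol_const k \<odot>\<^bsub>M T\<^esub> \<Phi> S T \<epsilon> q"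
    and map_id: "q \<in> carrier (M S) \<Longrightarrow> \<Phi> S S (oi_id S) q = q"
    and map_comp: "\<lbrakk>\<delta> \<in> oi_hom R S; \<epsilon> \<in> oi_hom S T; q \<in> carrier (M R)\<rbrakk> \<Longrightarrow>
      \<Phi> R T (compose (fset R) \<epsilon> \<delta>) q = \<Phi> S T \<epsilon> (\<Phi> R S \<delta> q)"
    and map_smult: "\<lbrakk>\<delta> \<in> oi_hom R S; \<epsilon> \<in> oi_hom S T; a \<in> B R; q \<in> carrier (M S)\<rbrakk> \<Longrightarrow>
      \<Phi> S T \<epsilon> (pol_map \<delta> a \<odot>\<^bsub>M S\<^esub> q) =
        pol_map (compose (fset R) \<epsilon> \<delta>) a \<odot>\<^bsub>M T\<^esub> \<Phi> S T \<epsilon> q"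

definition oi_submodule ::
    "(nat fset \<Rightarrow> 'k::comm_ring_1 pol set) \<Rightarrow> (nat fset \<Rightarrow> ('k pol, 'm) module) \<Rightarrow>
     (nat fset \<Rightarrow> nat fset \<Rightarrow> (nat \<Rightarrow> nat) \<Rightarrow> 'm \<Rightarrow> 'm) \<Rightarrow> (nat fset \<Rightarrow> 'm set) \<Rightarrow> bool" where
  "oi_submodule B M \<Phi> N \<longleftrightarrow>
     (\<forall>S. submodule (N S) (alg_ring (B S)) (M S)) \<and>
     (\<forall>S T. \<forall>\<epsilon>\<in>oi_hom S T. \<Phi> S T \<epsilon> ` N S \<subseteq> N T)"

definition oi_span ::
    "(nat fset \<Rightarrow> 'k::comm_ring_1 pol set) \<Rightarrow> (nat fset \<Rightarrow> ('k pol, 'm) module) \<Rightarrow>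
     (nat fset \<Rightarrow> nat fset \<Rightarrow> (nat \<Rightarrow> nat) \<Rightarrow> 'm \<Rightarrow> 'm) \<Rightarrow> (nat \<times> 'm) set \<Rightarrow> nat fset \<Rightarrow> 'm set" where
  "oi_span B M \<Phi> Y = (\<lambda>S. \<Inter>{N S | N. oi_submodule B M \<Phi> N \<and> Y \<subseteq> oi_coprod N})"

definition oi_finitely_generated ::
    "(nat fset \<Rightarrow> 'k::comm_ring_1 pol set) \<Rightarrow> (nat fset \<Rightarrow> ('k pol, 'm) module) \<Rightarrow>
     (nat fset \<Rightarrow> nat fset \<Rightarrow> (nat \<Rightarrow> nat) \<Rightarrow> 'm \<Rightarrow> 'm) \<Rightarrow> bool" where
  "oi_finitely_generated B M \<Phi> \<longleftrightarrow>
     (\<exists>G. finite G \<and> G \<subseteq> oi_coprod (\<lambda>S. carrier (M S)) \<and>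
       (\<forall>N. oi_submodule B M \<Phi> N \<and> G \<subseteq> oi_coprod N \<longrightarrow> N = (\<lambda>S. carrier (M S))))"

definition oi_noetherian ::
    "(nat fset \<Rightarrow> 'k::comm_ring_1 pol set) \<Rightarrow> (nat fset \<Rightarrow> ('k pol, 'm) module) \<Rightarrow>
     (nat fset \<Rightarrow> nat fset \<Rightarrow> (nat \<Rightarrow> nat) \<Rightarrow> 'm \<Rightarrow> 'm) \<Rightarrow> bool" where
  "oi_noetherian B M \<Phi> \<longleftrightarrow>
     (\<forall>N. oi_submodule B M \<Phi> N \<longrightarrow> oi_finitely_generated B (\<lambda>S. (M S)\<lparr>carrier := N S\<rparr>) \<Phi>)"


section \<open>Free OI-modules and their monomials\<close>

text \<open>
  The element $\sum_\pi a_\pi e_\pi$ is the finitely supported function mapping \<open>\<pi>\<close> to \<open>a\<^sub>\<pi>\<close>;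
  in particular \<open>a e\<^sub>\<pi>\<close> is \<open>Poly_Mapping.single \<pi> a\<close>.
\<close>

type_synonym 'k fvec = "(nat \<Rightarrow> nat) \<Rightarrow>\<^sub>0 'k pol"

definition free_smult :: "'k::comm_ring_1 pol \<Rightarrow> 'k fvec \<Rightarrow> 'k fvec" where
  "free_smult b q = Poly_Mapping.map ((*) b) q"

text \<open>
  The record type of modules extends that of rings; \<open>mult\<close> and \<open>one\<close> play no role for modules.
\<close>

definition free_module ::
    "(nat fset \<Rightarrow> 'k::comm_ring_1 pol set) \<Rightarrow> nat \<Rightarrow> nat fset \<Rightarrow> ('k pol, 'k fvec) module" where
  "free_module B d S =
     \<lparr>carrier = {q. Poly_Mapping.keys q \<subseteq> oi_hom (oi_interval d) S \<and>
                    (\<forall>\<pi>. Poly_Mapping.lookup q \<pi> \<in> B S)},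
      monoid.mult = undefined, one = undefined,
      zero = 0, add = (+), module.smult = free_smult\<rparr>"

definition free_map ::
    "nat \<Rightarrow> nat fset \<Rightarrow> nat fset \<Rightarrow> (nat \<Rightarrow> nat) \<Rightarrow> 'k::comm_ring_1 fvec \<Rightarrow> 'k fvec" where
  "free_map d S T \<epsilon> q =
     (\<Sum>\<pi>\<in>Poly_Mapping.keys q.
        Poly_Mapping.single (compose {1..d} \<epsilon> \<pi>) (pol_map \<epsilon> (Poly_Mapping.lookup q \<pi>)))"

definition free_monomials ::
    "(nat fset \<Rightarrow> 'k::comm_ring_1 pol set) \<Rightarrow> nat \<Rightarrow> nat \<Rightarrow> 'k fvec set" where
  "free_monomials B d m =
     {Poly_Mapping.single \<pi> u | \<pi> u. \<pi> \<in> oi_hom (oi_interval d) (oi_interval m) \<and> u \<in> pol_monomials B m}"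

text \<open>
  A monomial order is given by its strict relation: \<open>((m, \<mu>), (n, \<nu>)) \<in> gt\<close> means that the
  monomial \<open>\<mu>\<close> of width \<open>m\<close> is greater than the monomial \<open>\<nu>\<close> of width \<open>n\<close>.
\<close>

definition monomial_order ::
    "(nat fset \<Rightarrow> 'k::comm_ring_1 pol set) \<Rightarrow> nat \<Rightarrow> (nat \<times> 'k fvec) rel \<Rightarrow> bool" where
  "monomial_order B d gt \<longleftrightarrow>
     gt \<subseteq> (SIGMA m:UNIV. free_monomials B d m) \<times> (SIGMA m:UNIV. free_monomials B d m) \<and>
     strict_linear_order_on (SIGMA m:UNIV. free_monomials B d m) gt \<and>
     (\<forall>m. \<forall>\<mu>\<in>free_monomials B d m. \<forall>\<nu>\<in>free_monomials B d m. ((m, \<mu>), (m, \<nu>)) \<in> gt \<longrightarrow>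
        (\<forall>u\<in>pol_monomials B m. u \<noteq> 1 \<longrightarrow>
           ((m, free_smult u \<mu>), (m, free_smult u \<nu>)) \<in> gt \<and>
           ((m, free_smult u \<nu>), (m, \<nu>)) \<in> gt) \<and>
        (\<forall>n. \<forall>\<epsilon>\<in>oi_hom (oi_interval m) (oi_interval n).
           ((n, free_map d (oi_interval m) (oi_interval n) \<epsilon> \<mu>),
            (n, free_map d (oi_interval m) (oi_interval n) \<epsilon> \<nu>)) \<in> gt) \<and>
        (\<forall>n>m. ((n, free_map d (oi_interval m) (oi_interval n) (oi_incl m) \<mu>), (m, \<mu>)) \<in> gt))"

text \<open>The coefficient \<open>c\<^sub>\<mu>\<close> of the monomial \<open>\<mu>\<close> in \<open>q\<close>.\<close>

definition free_coeff :: "'k::comm_ring_1 fvec \<Rightarrow> 'k fvec \<Rightarrow> 'k" where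
  "free_coeff q \<mu> =
     (THE k. \<exists>\<pi> a. \<mu> = Poly_Mapping.single \<pi> (Poly_Mapping.single a 1) \<and>
        k = Poly_Mapping.lookup (Poly_Mapping.lookup q \<pi>) a)"

lemma free_coeff_monomial:
  "free_coeff q (Poly_Mapping.single \<pi> (Poly_Mapping.single a (1 :: 'k::comm_ring_1))) =
     Poly_Mapping.lookup (Poly_Mapping.lookup q \<pi>) a"
proof -
  have "\<pi> = \<pi>' \<and> a = a'"
    if "Poly_Mapping.single \<pi> (Poly_Mapping.single a (1 :: 'k)) =
        Poly_Mapping.single \<pi>' (Poly_Mapping.single a' 1)" for \<pi>' a'
  proof -
    have ne: "Poly_Mapping.single b (1 :: 'k) \<noteq> 0" for b :: expo
      by (metis lookup_single_eq lookup_zero zero_neq_one)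
    have "\<pi> = \<pi>'" by (metis that ne lookup_single_eq lookup_single_not_eq)
    moreover have "a = a'"
      by (metis that \<open>\<pi> = \<pi>'\<close> lookup_single_eq lookup_single_not_eq zero_neq_one)
    ultimately show ?thesis by simp
  qed
  then show ?thesis unfolding free_coeff_def by (intro the_equality) auto
qed

text \<open>
  The leading monomial and the leading term are only meaningful for \<open>0 \<noteq> q \<in> F\<^sub>m\<close>.
\<close>

definition lead_mon ::
    "(nat fset \<Rightarrow> 'k::comm_ring_1 pol set) \<Rightarrow> nat \<Rightarrow> (nat \<times> 'k fvec) rel \<Rightarrow> nat \<Rightarrow> 'k fvec \<Rightarrow> 'k fvec"
  where
  "lead_mon B d gt m q =
     (THE \<mu>. \<mu> \<in> free_monomials B d m \<and> free_coeff q \<mu> \<noteq> 0 \<and>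
        (\<forall>\<nu>\<in>free_monomials B d m. free_coeff q \<nu> \<noteq> 0 \<and> \<nu> \<noteq> \<mu> \<longrightarrow> ((m, \<mu>), (m, \<nu>)) \<in> gt))"

definition lead_term ::
    "(nat fset \<Rightarrow> 'k::comm_ring_1 pol set) \<Rightarrow> nat \<Rightarrow> (nat \<times> 'k fvec) rel \<Rightarrow> nat \<Rightarrow> 'k fvec \<Rightarrow> 'k fvec"
  where
  "lead_term B d gt m q =
     free_smult (pol_const (free_coeff q (lead_mon B d gt m q))) (lead_mon B d gt m q)"

definition lead_terms ::
    "(nat fset \<Rightarrow> 'k::comm_ring_1 pol set) \<Rightarrow> nat \<Rightarrow> (nat \<times> 'k fvec) rel \<Rightarrow>
     (nat \<times> 'k fvec) set \<Rightarrow> (nat \<times> 'k fvec) set" where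
  "lead_terms B d gt Y = {(m, lead_term B d gt m q) | m q. (m, q) \<in> Y \<and> q \<noteq> 0}"

definition groebner_basis ::
    "(nat fset \<Rightarrow> 'k::comm_ring_1 pol set) \<Rightarrow> nat \<Rightarrow> (nat \<times> 'k fvec) rel \<Rightarrow>
     (nat fset \<Rightarrow> 'k fvec set) \<Rightarrow> (nat \<times> 'k fvec) set \<Rightarrow> bool" where
  "groebner_basis B d gt N G \<longleftrightarrow>
     G \<subseteq> oi_coprod N \<and>
     oi_span B (free_module B d) (free_map d) (lead_terms B d gt G) =
     oi_span B (free_module B d) (free_map d) (lead_terms B d gt (oi_coprod N))"

end

theory Submission
  imports Defs "HOL-Library.Ramsey" "HOL-Library.Sublist" "HOL-Library.Product_Lexorder"
begin

text \<open>
  A monomial \<open>u e\<^sub>\<pi>\<close> of width \<open>m\<close> is a list of \<open>m\<close> columns of exponents together with the marked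
  positions \<open>\<pi>(1) < \<dots> < \<pi>(d)\<close>. Marking is the same as multiplying \<open>u\<close> by new variables
  \<open>x\<^bsub>0,\<pi>(1)\<^esub> \<cdots> x\<^bsub>0,\<pi>(d)\<^esub>\<close>, so monomials of \<open>F\<close> become words over vectors of natural numbers,
  and Higman's lemma over Dickson's lemma (\<open>wqo_list_emb\<close>, \<open>wqo_pointwise\<close>) finds in every sequence
  of monomials an increasing subsequence for the relation ``some \<open>\<epsilon>\<close> maps \<open>\<nu>\<close> to a divisor
  of \<open>\<mu>\<close>''. The number of marks is the same on both sides, so \<open>\<epsilon>\<close> respects them exactly. A priori
  the cofactor is only a monomial of \<open>P\<close>; the saturation hypothesis puts it into \<open>B\<close>, which makes
  the relation divisibility inside the module over \<open>B\<close> (\<open>mono_dvd_wqo\<close>).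

  Coefficients in \<open>K\<close> are controlled by families of ideals \<open>I\<^sub>\<mu> \<subseteq> K\<close>, one for each monomial, that grow along
  divisibility (\<open>coeff_system\<close>). If infinitely many pairs \<open>(\<mu>\<^sub>n, k\<^sub>n)\<close> were each not enforced by the earlier
  ones, then along an increasing subsequence of the \<open>\<mu>\<^sub>n\<close> all earlier \<open>k\<^sub>i\<close> would move into \<open>I\<close> at \<open>\<mu>\<^sub>n\<close>,
  and these \<open>k\<^sub>n\<close> would generate an ideal of \<open>K\<close> that is not finitely generated. Hence every set of conditions
  \<open>k \<in> I\<^sub>\<mu>\<close> follows from finitely many of them (\<open>coeff_system_finite\<close>).

  A submodule \<open>N\<close> of \<open>F\<close> gives two such families: the leading coefficients of its elements with
  leading monomial \<open>\<mu>\<close>, and the \<open>k\<close> with \<open>k \<mu> \<in> N\<close>. Finitely many conditions that enforce the first family of \<open>N\<close>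
  come from finitely many elements of \<open>N\<close>. These are a Groebner basis, because a submodule containing their
  leading terms satisfies the conditions in its second family; and for a term order that is
  well-founded in each width they generate \<open>N\<close>, because a submodule containing them satisfies the
  conditions in its first family.

  For a module \<open>M\<close> generated by finitely many elements, one generator \<open>g\<close> of width \<open>d\<close> is split off at a
  time: \<open>g\<close> defines a map from the free module on one generator of width \<open>d\<close> to \<open>M\<close> (\<open>eval_at\<close>), and the usual
  extension argument deduces finite generation of a submodule from that of its preimage in the free
  module and of its intersection with the span of the other generators (\<open>fg_submodule_step\<close>).
\<close>

section \<open>Well-quasi-orders and Higman's lemma\<close>

text \<open>
  Formulated with increasing subsequences instead of good pairs: this form passes to products by
  extracting twice, and hands all comparisons at once to the noetherian argument.
\<close>

definition wqo :: "('a \<Rightarrow> 'a \<Rightarrow> bool) \<Rightarrow> bool" where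
  "wqo P \<longleftrightarrow>
     (\<forall>f :: nat \<Rightarrow> 'a. \<exists>\<phi> :: nat \<Rightarrow> nat. strict_mono \<phi> \<and> (\<forall>i j. i < j \<longrightarrow> P (f (\<phi> i)) (f (\<phi> j))))"

lemma wqoE:
  assumes "wqo P"
  obtains \<phi> :: "nat \<Rightarrow> nat" where "strict_mono \<phi>" "\<And>i j. i < j \<Longrightarrow> P (f (\<phi> i)) (f (\<phi> j))"
  using assms unfolding wqo_def by blast

text \<open>
  Ramsey's theorem: colour a pair of positions by whether its entries are related. An infinite
  homogeneous set cannot have the negative colour, as it would carry a sequence without good pair.
\<close>

lemma wqoI_good_pairs:
  assumes good: "\<And>f :: nat \<Rightarrow> 'a. \<exists>i j. i < j \<and> P (f i) (f j)"
  shows "wqo P"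
  unfolding wqo_def
proof
  fix f :: "nat \<Rightarrow> 'a"
  define col :: "nat set \<Rightarrow> nat"
    where "col e = (if P (f (Min e)) (f (Max e)) then 1 else 0)" for e
  have "\<exists>Y t. Y \<subseteq> UNIV \<and> infinite Y \<and> t < 2 \<and> (\<forall>x\<in>Y. \<forall>y\<in>Y. x \<noteq> y \<longrightarrow> col {x, y} = t)"
    by (rule Ramsey2) (auto simp: col_def)
  then obtain Y t where Y: "infinite Y" and hom: "\<And>x y. x \<in> Y \<Longrightarrow> y \<in> Y \<Longrightarrow> x \<noteq> y \<Longrightarrow> col {x, y} = t"
    by auto
  define \<phi> where "\<phi> = enumerate Y"
  have mono: "strict_mono \<phi>" using Y by (simp add: \<phi>_def strict_mono_enumerate)
  have mem: "\<phi> i \<in> Y" for i using Y by (simp add: \<phi>_def enumerate_in_set)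
  have col: "P (f (\<phi> i)) (f (\<phi> j)) \<longleftrightarrow> t = 1" if "i < j" for i j
  proof -
    have lt: "\<phi> i < \<phi> j" using mono that by (simp add: strict_mono_less)
    have "col {\<phi> i, \<phi> j} = t" using hom[OF mem mem, of i j] lt by simp
    moreover have "col {\<phi> i, \<phi> j} = (if P (f (\<phi> i)) (f (\<phi> j)) then 1 else 0)"
      using lt by (simp add: col_def min_absorb1 max_absorb2)
    ultimately show ?thesis by (auto split: if_splits)
  qed
  obtain i j where "i < j" "P (f (\<phi> i)) (f (\<phi> j))" using good[of "f \<circ> \<phi>"] by auto
  then have "t = 1" using col by simp
  have "\<forall>i j. i < j \<longrightarrow> P (f (\<phi> i)) (f (\<phi> j))" using col \<open>t = 1\<close> by (intro allI impI) simp
  show "\<exists>\<phi> :: nat \<Rightarrow> nat. strict_mono \<phi> \<and> (\<forall>i j. i < j \<longrightarrow> P (f (\<phi> i)) (f (\<phi> j)))"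
    by (rule exI[of _ \<phi>], rule conjI) fact+
qed

lemma wqo_nat_le: "wqo ((\<le>) :: nat \<Rightarrow> nat \<Rightarrow> bool)"
proof (rule wqoI_good_pairs)
  fix f :: "nat \<Rightarrow> nat"
  obtain i where "\<forall>j. f i \<le> f j"
    using ex_has_least_nat[of "\<lambda>_. True" 0 f] by auto
  then show "\<exists>i j. i < j \<and> f i \<le> f j" by (meson lessI)
qed

text \<open>
  Dickson's lemma, by extracting a subsequence for one coordinate after the other.
\<close>

lemma wqo_pointwise:
  assumes "finite R"
  shows "wqo (\<lambda>u v :: 'b \<Rightarrow> nat. \<forall>i\<in>R. u i \<le> v i)"
  using assms
proof induction
  case empty
  show ?case unfolding wqo_def by (auto intro: exI[of _ id] simp: strict_mono_def)
next
  case (insert r R)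
  show ?case unfolding wqo_def
  proof
    fix f :: "nat \<Rightarrow> 'b \<Rightarrow> nat"
    obtain \<phi> :: "nat \<Rightarrow> nat" where \<phi>: "strict_mono \<phi>" "\<And>i j. i < j \<Longrightarrow> \<forall>x\<in>R. f (\<phi> i) x \<le> f (\<phi> j) x"
      by (rule wqoE[OF insert.IH, of f]) blast
    obtain \<psi> :: "nat \<Rightarrow> nat" where \<psi>: "strict_mono \<psi>" "\<And>i j. i < j \<Longrightarrow> f (\<phi> (\<psi> i)) r \<le> f (\<phi> (\<psi> j)) r"
      by (rule wqoE[OF wqo_nat_le, of "\<lambda>i. f (\<phi> i) r"]) blast
    have "strict_mono (\<phi> \<circ> \<psi>)" using \<phi>(1) \<psi>(1) by (rule strict_mono_o)
    moreover have "\<forall>x\<in>insert r R. f ((\<phi> \<circ> \<psi>) i) x \<le> f ((\<phi> \<circ> \<psi>) j) x" if "i < j" for i j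
      using \<phi>(2)[of "\<psi> i" "\<psi> j"] \<psi> that by (auto simp: strict_mono_less)
    ultimately show "\<exists>\<phi> :: nat \<Rightarrow> nat. strict_mono \<phi> \<and> (\<forall>i j. i < j \<longrightarrow> (\<forall>x\<in>insert r R. f (\<phi> i) x \<le> f (\<phi> j) x))"
      by blast
  qed
qed

definition bad_seq :: "('a \<Rightarrow> 'a \<Rightarrow> bool) \<Rightarrow> (nat \<Rightarrow> 'a) \<Rightarrow> bool" where
  "bad_seq Q f \<longleftrightarrow> (\<forall>i j. i < j \<longrightarrow> \<not> Q (f i) (f j))"

text \<open>
  Nash-Williams' minimal bad sequence: each entry is chosen of least size among the entries at
  that place of bad sequences that continue the choices already made.
\<close>

lemma minimal_bad_sequence:
  fixes f :: "nat \<Rightarrow> 'a" and s :: "'a \<Rightarrow> nat"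
  assumes "bad_seq Q f"
  obtains g where "bad_seq Q g"
    and "\<And>n h. bad_seq Q h \<Longrightarrow> (\<forall>i<n. h i = g i) \<Longrightarrow> s (g n) \<le> s (h n)"
proof -
  \<comment> \<open>\<open>pick xs\<close> extends the list \<open>xs\<close> of choices; \<open>pre n\<close> lists the first \<open>n\<close> choices.\<close>
  define pick where
    "pick xs = (ARG_MIN s x. \<exists>h. bad_seq Q h \<and> (\<forall>i<length xs. h i = xs ! i) \<and> h (length xs) = x)" for xs
  define pre where "pre = rec_nat [] (\<lambda>_ xs. xs @ [pick xs])"
  have pre_Suc: "pre (Suc n) = pre n @ [pick (pre n)]" and pre_0: "pre 0 = []" for n
    by (simp_all add: pre_def)
  have len: "length (pre n) = n" for n by (induction n) (simp_all add: pre_0 pre_Suc)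
  define g where "g n = pick (pre n)" for n
  have nth: "pre n ! i = g i" if "i < n" for n i
    using that by (induction n) (auto simp: pre_Suc nth_append len g_def less_Suc_eq)
  let ?E = "\<lambda>n x. \<exists>h. bad_seq Q h \<and> (\<forall>i<n. h i = g i) \<and> h n = x"
  have g_eq: "g n = (ARG_MIN s x. ?E n x)" for n
    unfolding g_def[of n] pick_def by (simp add: len nth cong: conj_cong)
  have step: "?E n (g n)" if "\<exists>x. ?E n x" for n
    unfolding g_eq[of n] using arg_min_natI[of "?E n"] that by blast
  have ex: "\<exists>x. ?E n x" for n
  proof (induction n)
    case 0
    show ?case using assms by auto
  next
    case (Suc n)
    from step[OF this] obtain h where "bad_seq Q h" "\<forall>i<n. h i = g i" "h n = g n" by blast
    then show ?case by (auto simp: less_Suc_eq)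
  qed
  show thesis
  proof
    show "bad_seq Q g"
      unfolding bad_seq_def
    proof (intro allI impI)
      fix i j :: nat assume "i < j"
      obtain h where "bad_seq Q h" "\<forall>i<j. h i = g i" "h j = g j" using step[OF ex] by blast
      with \<open>i < j\<close> show "\<not> Q (g i) (g j)" unfolding bad_seq_def by metis
    qed
    show "s (g n) \<le> s (h n)" if "bad_seq Q h" "\<forall>i<n. h i = g i" for n h
      unfolding g_eq[of n] by (rule arg_min_nat_le) (use that in blast)
  qed
qed

text \<open>
  Higman's lemma. In a minimal bad sequence \<open>g\<close> of lists, take a subsequence \<open>\<phi>\<close> along which the heads
  increase and replace \<open>g\<close> from place \<open>\<phi> 0\<close> on by the tails along \<open>\<phi>\<close>. A good pair among
  the new entries would give one in \<open>g\<close>, so the new sequence is again bad, yet shorter at place \<open>\<phi> 0\<close>.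
\<close>

lemma wqo_list_emb:
  assumes "wqo P"
  shows "wqo (list_emb P)"
proof (rule wqoI_good_pairs, rule ccontr)
  fix f :: "nat \<Rightarrow> 'a list" assume "\<not> (\<exists>i j. i < j \<and> list_emb P (f i) (f j))"
  then have "bad_seq (list_emb P) f" by (auto simp: bad_seq_def)
  then obtain g where bad_seq_g: "bad_seq (list_emb P) g"
    and min: "\<And>n h. bad_seq (list_emb P) h \<Longrightarrow> (\<forall>i<n. h i = g i) \<Longrightarrow> length (g n) \<le> length (h n)"
    by (rule minimal_bad_sequence[where s = length]) blast
  have ne: "g i \<noteq> []" for i
    using bad_seq_g unfolding bad_seq_def by (metis lessI list_emb_Nil)
  obtain \<phi> :: "nat \<Rightarrow> nat" where \<phi>: "strict_mono \<phi>" "\<And>i j. i < j \<Longrightarrow> P (hd (g (\<phi> i))) (hd (g (\<phi> j)))"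
    by (rule wqoE[OF assms, of "\<lambda>i. hd (g i)"]) blast
  define h where "h i = (if i < \<phi> 0 then g i else tl (g (\<phi> (i - \<phi> 0))))" for i
  \<comment> \<open>The two ways in which an embedding between entries of \<open>h\<close> yields one between entries of \<open>g\<close>.\<close>
  have dec: "list_emb P xs (g k)" if "list_emb P xs (tl (g k))" for xs k
    using that ne[of k] by (metis list.collapse list_emb_Cons)
  have both: "list_emb P (g (\<phi> i)) (g (\<phi> j))"
    if "i < j" "list_emb P (tl (g (\<phi> i))) (tl (g (\<phi> j)))" for i j
    using list_emb_Cons2[OF \<phi>(2)[OF that(1)] that(2)] ne by simp
  have "bad_seq (list_emb P) h"
    unfolding bad_seq_def
  proof (intro allI impI notI)
    fix i j :: nat assume ij: "i < j" and emb: "list_emb P (h i) (h j)"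
    consider "j < \<phi> 0" | "i < \<phi> 0" "\<phi> 0 \<le> j" | "\<phi> 0 \<le> i" by linarith
    then show False
    proof cases
      case 1
      then show False using ij emb bad_seq_g by (auto simp: h_def bad_seq_def)
    next
      case 2
      then have "list_emb P (g i) (g (\<phi> (j - \<phi> 0)))" using emb dec by (auto simp: h_def)
      moreover have "i < \<phi> (j - \<phi> 0)"
        using 2(1) \<phi>(1) by (meson less_le_trans strict_mono_less_eq zero_le)
      ultimately show False using bad_seq_g by (auto simp: bad_seq_def)
    next
      case 3
      then have "list_emb P (g (\<phi> (i - \<phi> 0))) (g (\<phi> (j - \<phi> 0)))"
        using emb ij by (intro both) (auto simp: h_def)
      moreover have "\<phi> (i - \<phi> 0) < \<phi> (j - \<phi> 0)" using 3 ij \<phi>(1) by (simp add: strict_mono_less)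
      ultimately show False using bad_seq_g by (auto simp: bad_seq_def)
    qed
  qed
  moreover have "\<forall>i<\<phi> 0. h i = g i" by (simp add: h_def)
  ultimately have "length (g (\<phi> 0)) \<le> length (h (\<phi> 0))" by (rule min)
  then show False using ne[of "\<phi> 0"] by (cases "g (\<phi> 0)") (simp_all add: h_def)
qed

lemma list_emb_imp_strict_mono:
  assumes "list_emb P xs ys"
  shows "\<exists>\<epsilon>. strict_mono_on {..<length xs} \<epsilon> \<and> (\<forall>i<length xs. \<epsilon> i < length ys \<and> P (xs ! i) (ys ! \<epsilon> i))"
  using assms
proof induction
  case (list_emb_Nil ys)
  show ?case by (auto intro: strict_mono_onI)
next
  case (list_emb_Cons xs ys y)
  then obtain \<epsilon> where "strict_mono_on {..<length xs} \<epsilon>"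
    "\<forall>i<length xs. \<epsilon> i < length ys \<and> P (xs ! i) (ys ! \<epsilon> i)" by blast
  then show ?case
    by (intro exI[of _ "\<lambda>i. Suc (\<epsilon> i)"]) (auto simp: strict_mono_on_def)
next
  case (list_emb_Cons2 x y xs ys)
  then obtain \<epsilon> where "strict_mono_on {..<length xs} \<epsilon>"
    "\<forall>i<length xs. \<epsilon> i < length ys \<and> P (xs ! i) (ys ! \<epsilon> i)" by blast
  then show ?case using \<open>P x y\<close>
    by (intro exI[of _ "\<lambda>i. case i of 0 \<Rightarrow> 0 | Suc k \<Rightarrow> Suc (\<epsilon> k)"])
       (auto simp: strict_mono_on_def split: nat.splits)
qed

section \<open>Exponents and the morphisms of OI\<close>

lemma oi_homD:
  assumes "\<epsilon> \<in> oi_hom S T"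
  shows oi_hom_mem: "\<And>j. j \<in> fset S \<Longrightarrow> \<epsilon> j \<in> fset T"
    and oi_hom_less: "\<And>i j. i \<in> fset S \<Longrightarrow> j \<in> fset S \<Longrightarrow> i < j \<Longrightarrow> \<epsilon> i < \<epsilon> j"
    and oi_hom_inj: "inj_on \<epsilon> (fset S)"
    and oi_hom_ext: "\<epsilon> \<in> extensional (fset S)"
proof -
  have \<epsilon>: "\<epsilon> \<in> fset S \<rightarrow>\<^sub>E fset T" "strict_mono_on (fset S) \<epsilon>" using assms by (auto simp: oi_hom_def)
  show "\<And>j. j \<in> fset S \<Longrightarrow> \<epsilon> j \<in> fset T" using \<epsilon>(1) by (rule PiE_mem)
  show "\<And>i j. i \<in> fset S \<Longrightarrow> j \<in> fset S \<Longrightarrow> i < j \<Longrightarrow> \<epsilon> i < \<epsilon> j" using \<epsilon>(2) by (rule strict_mono_onD)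
  show "inj_on \<epsilon> (fset S)" using \<epsilon>(2) by (rule strict_mono_on_imp_inj_on)
  show "\<epsilon> \<in> extensional (fset S)" using \<epsilon>(1) by (simp add: PiE_def)
qed

lemma oi_hom_less_iff:
  assumes "\<epsilon> \<in> oi_hom S T" "i \<in> fset S" "j \<in> fset S"
  shows "\<epsilon> i < \<epsilon> j \<longleftrightarrow> i < j"
  using oi_hom_less[OF assms(1)] assms(2,3) by (metis linorder_neqE_nat order_less_asym)

lemma oi_id_hom [simp]: "oi_id S \<in> oi_hom S S"
  by (auto simp: oi_id_def oi_hom_def strict_mono_on_def)

lemma compose_oi_hom:
  assumes "\<delta> \<in> oi_hom R S" "\<epsilon> \<in> oi_hom S T"
  shows "compose (fset R) \<epsilon> \<delta> \<in> oi_hom R T"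
  using oi_homD[OF assms(1)] oi_homD[OF assms(2)]
  by (auto simp: oi_hom_def compose_def strict_mono_on_def)

text \<open>
  A strictly increasing map is determined by its image, and equal cardinalities turn the
  inclusion of images into an equality.
\<close>

lemma oi_hom_eqI_image:
  assumes \<pi>: "\<pi> \<in> oi_hom S T" and \<rho>: "\<rho> \<in> oi_hom S T" and sub: "\<rho> ` fset S \<subseteq> \<pi> ` fset S"
  shows "\<rho> = \<pi>"
proof -
  let ?l = "sorted_list_of_set (fset S)"
  have sorted: "sorted (map \<sigma> ?l) \<and> distinct (map \<sigma> ?l)" if "\<sigma> \<in> oi_hom S T" for \<sigma>
    using oi_homD[OF that]
    by (auto simp: distinct_map sorted_map intro!: sorted_wrt_mono_rel[OF _ sorted_sorted_list_of_set]
        dest!: le_imp_less_or_eq intro: less_imp_le)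
  have "card (\<rho> ` fset S) = card (\<pi> ` fset S)"
    using oi_hom_inj[OF \<pi>] oi_hom_inj[OF \<rho>] by (simp add: card_image)
  with sub have "\<rho> ` fset S = \<pi> ` fset S" by (intro card_subset_eq) auto
  then have "map \<rho> ?l = map \<pi> ?l"
    using sorted[OF \<pi>] sorted[OF \<rho>] by (intro sorted_distinct_set_unique) auto
  then have "\<rho> j = \<pi> j" if "j \<in> fset S" for j using that by auto
  then show ?thesis using oi_hom_ext[OF \<pi>] oi_hom_ext[OF \<rho>] by (auto intro: extensionalityI)
qed

lemma oi_endo_eq_id:
  assumes "\<epsilon> \<in> oi_hom S S"
  shows "\<epsilon> = oi_id S"
proof (rule oi_hom_eqI_image)
  show "\<epsilon> ` fset S \<subseteq> oi_id S ` fset S" using oi_hom_mem[OF assms] by (auto simp: oi_id_def)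
qed (use assms in auto)


lemma expo_map_superset:
  assumes "finite A" "Poly_Mapping.keys a \<subseteq> A"
  shows "expo_map \<epsilon> a = (\<Sum>(i, j)\<in>A. Poly_Mapping.single (i, \<epsilon> j) (Poly_Mapping.lookup a (i, j)))"
  unfolding expo_map_def
  by (rule sum.mono_neutral_left) (use assms in \<open>auto simp: in_keys_iff\<close>)

lemma expo_map_zero [simp]: "expo_map \<epsilon> 0 = 0"
  by (simp add: expo_map_def)

lemma expo_map_single: "expo_map \<epsilon> (Poly_Mapping.single (i, j) k) = Poly_Mapping.single (i, \<epsilon> j) k"
  by (simp add: expo_map_def)

lemma expo_map_add: "expo_map \<epsilon> (a + b) = expo_map \<epsilon> a + expo_map \<epsilon> b"
proof -
  let ?A = "Poly_Mapping.keys a \<union> Poly_Mapping.keys b"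
  have "Poly_Mapping.keys (a + b) \<subseteq> ?A" by (rule keys_add)
  then show ?thesis
    by (simp add: expo_map_superset[of ?A] lookup_add single_add sum.distrib[symmetric] split_def)
qed

lemma expo_map_sum: "expo_map \<epsilon> (\<Sum>i\<in>I. f i) = (\<Sum>i\<in>I. expo_map \<epsilon> (f i))"
  by (induction I rule: infinite_finite_induct) (simp_all add: expo_map_add)

lemma keys_expo_map: "Poly_Mapping.keys (expo_map \<epsilon> a) \<subseteq> (\<lambda>(i, j). (i, \<epsilon> j)) ` Poly_Mapping.keys a"
proof
  fix x assume "x \<in> Poly_Mapping.keys (expo_map \<epsilon> a)"
  then have "(\<Sum>y\<in>Poly_Mapping.keys a.
      Poly_Mapping.lookup (case y of (i, j) \<Rightarrow> Poly_Mapping.single (i, \<epsilon> j) (Poly_Mapping.lookup a (i, j))) x) \<noteq> 0"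
    by (simp add: in_keys_iff expo_map_def lookup_sum)
  then obtain y where "y \<in> Poly_Mapping.keys a"
    "Poly_Mapping.lookup (case y of (i, j) \<Rightarrow> Poly_Mapping.single (i, \<epsilon> j) (Poly_Mapping.lookup a (i, j))) x \<noteq> 0"
    by (meson sum.not_neutral_contains_not_neutral)
  then show "x \<in> (\<lambda>(i, j). (i, \<epsilon> j)) ` Poly_Mapping.keys a"
    by (force simp: lookup_single when_def split: prod.splits if_splits)
qed

text \<open>
  For injective \<open>\<epsilon>\<close> the exponents are moved from column \<open>j\<close> to column \<open>\<epsilon> j\<close> without being added up.
\<close>

lemma lookup_expo_map:
  assumes inj: "inj_on \<epsilon> J" and keys: "Poly_Mapping.keys a \<subseteq> UNIV \<times> J" and j: "j \<in> J"
  shows "Poly_Mapping.lookup (expo_map \<epsilon> a) (i, \<epsilon> j) = Poly_Mapping.lookup a (i, j)"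
proof -
  let ?A = "insert (i, j) (Poly_Mapping.keys a)"
  have "Poly_Mapping.lookup (expo_map \<epsilon> a) (i, \<epsilon> j) =
      (\<Sum>(i', j')\<in>?A. Poly_Mapping.lookup (Poly_Mapping.single (i', \<epsilon> j') (Poly_Mapping.lookup a (i', j'))) (i, \<epsilon> j))"
    by (subst expo_map_superset[of ?A]) (auto simp only: lookup_sum split_def finite_insert finite_keys)
  also have "\<dots> = (\<Sum>x\<in>?A. if x = (i, j) then Poly_Mapping.lookup a (i, j) else 0)"
    by (rule sum.cong) (use keys j inj in
        \<open>auto simp: lookup_single when_def inj_on_def split: if_splits prod.splits\<close>)
  also have "\<dots> = Poly_Mapping.lookup a (i, j)"
    by (subst sum.delta) auto
  finally show ?thesis .
qed

lemma expo_map_inj: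
  assumes "\<epsilon> \<in> oi_hom S T"
  shows "inj_on (expo_map \<epsilon>) {a. Poly_Mapping.keys a \<subseteq> UNIV \<times> fset S}"
proof (rule inj_onI)
  fix a b :: expo
  assume ab: "a \<in> {a. Poly_Mapping.keys a \<subseteq> UNIV \<times> fset S}" "b \<in> {a. Poly_Mapping.keys a \<subseteq> UNIV \<times> fset S}"
    and eq: "expo_map \<epsilon> a = expo_map \<epsilon> b"
  show "a = b"
  proof (rule poly_mapping_eqI)
    fix x :: "nat \<times> nat"
    obtain i j where x: "x = (i, j)" by (cases x)
    show "Poly_Mapping.lookup a x = Poly_Mapping.lookup b x"
    proof (cases "j \<in> fset S")
      case True
      then show ?thesis
        using lookup_expo_map[OF oi_hom_inj[OF assms], of a j i]
          lookup_expo_map[OF oi_hom_inj[OF assms], of b j i] ab eq x by simp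
    next
      case False
      then have "x \<notin> Poly_Mapping.keys a" "x \<notin> Poly_Mapping.keys b" using ab x by auto
      then show ?thesis by (simp add: in_keys_iff)
    qed
  qed
qed

lemma expo_map_id_on:
  assumes "\<And>j. j \<in> J \<Longrightarrow> \<epsilon> j = j" "Poly_Mapping.keys a \<subseteq> UNIV \<times> J"
  shows "expo_map \<epsilon> a = a"
proof (rule poly_mapping_eqI)
  fix x :: "nat \<times> nat"
  obtain i j where x: "x = (i, j)" by (cases x)
  show "Poly_Mapping.lookup (expo_map \<epsilon> a) x = Poly_Mapping.lookup a x"
  proof (cases "j \<in> J")
    case True
    then show ?thesis
      using lookup_expo_map[of \<epsilon> J a j i] assms x by (auto simp: inj_on_def)
  next
    case False
    then have "x \<notin> Poly_Mapping.keys a" "x \<notin> Poly_Mapping.keys (expo_map \<epsilon> a)"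
      using assms x keys_expo_map[of \<epsilon> a] by (auto 0 4)
    then show ?thesis by (simp add: in_keys_iff)
  qed
qed

text \<open>
  An exponent of width \<open>m\<close> is a word of length \<open>m\<close> whose letters are its columns. An embedding of
  words is a morphism \<open>\<epsilon>\<close> of OI under which \<open>e\<close> is mapped to a divisor of the larger monomial.
\<close>

lemma exponent_sequence_embedding:
  fixes e :: "nat \<Rightarrow> expo" and m :: "nat \<Rightarrow> nat"
  assumes "finite R" and keys: "\<And>n. Poly_Mapping.keys (e n) \<subseteq> R \<times> {1..m n}"
  obtains \<phi> :: "nat \<Rightarrow> nat" where "strict_mono \<phi>"
    and "\<And>i j. i < j \<Longrightarrow> \<exists>\<epsilon>\<in>oi_hom (oi_interval (m (\<phi> i))) (oi_interval (m (\<phi> j))).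
            \<exists>\<kappa>. e (\<phi> j) = \<kappa> + expo_map \<epsilon> (e (\<phi> i))"
proof -
  define word where "word n = map (\<lambda>j i. Poly_Mapping.lookup (e n) (i, j)) [1..<Suc (m n)]" for n
  let ?P = "\<lambda>u v :: nat \<Rightarrow> nat. \<forall>i\<in>R. u i \<le> v i"
  obtain \<phi> :: "nat \<Rightarrow> nat" where \<phi>: "strict_mono \<phi>"
    "\<And>i j. i < j \<Longrightarrow> list_emb ?P (word (\<phi> i)) (word (\<phi> j))"
    by (rule wqoE[OF wqo_list_emb[OF wqo_pointwise[OF assms(1)]], of word]) blast
  have emb: "\<exists>\<epsilon>\<in>oi_hom (oi_interval (m k)) (oi_interval (m l)). \<exists>\<kappa>. e l = \<kappa> + expo_map \<epsilon> (e k)"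
    if emb: "list_emb ?P (word k) (word l)" for k l
  proof -
    obtain \<delta> where \<delta>: "strict_mono_on {..<length (word k)} \<delta>"
      "\<forall>i<length (word k). \<delta> i < length (word l) \<and> ?P (word k ! i) (word l ! \<delta> i)"
      using list_emb_imp_strict_mono[OF emb] by blast
    have len: "length (word n) = m n" for n by (simp add: word_def)
    have nth: "word n ! i = (\<lambda>r. Poly_Mapping.lookup (e n) (r, Suc i))" if "i < m n" for n i
      using that by (simp add: word_def del: upt_Suc)
    \<comment> \<open>Positions of a list start at \<open>0\<close>, columns at \<open>1\<close>.\<close>
    define \<epsilon> where "\<epsilon> = (\<lambda>j\<in>{1..m k}. Suc (\<delta> (j - 1)))"
    have mono: "\<delta> i < \<delta> j" if "i < j" "j < m k" for i j
      using \<delta>(1) that by (simp add: strict_mono_on_def len)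
    have \<epsilon>: "\<epsilon> \<in> oi_hom (oi_interval (m k)) (oi_interval (m l))"
      using \<delta>(2) by (auto simp: oi_hom_def \<epsilon>_def len strict_mono_on_def Suc_le_eq intro!: mono)
    have le: "Poly_Mapping.lookup (e k) (i, j) \<le> Poly_Mapping.lookup (e l) (i, \<epsilon> j)"
      if "i \<in> R" "j \<in> {1..m k}" for i j
    proof -
      have "j - 1 < m k" "Suc (j - 1) = j" using that(2) by auto
      then show ?thesis
        using \<delta>(2)[rule_format, of "j - 1"] that nth[of "j - 1" k] nth[of "\<delta> (j - 1)" l]
        by (auto simp: \<epsilon>_def len)
    qed
    have "Poly_Mapping.lookup (expo_map \<epsilon> (e k)) x \<le> Poly_Mapping.lookup (e l) x" for x
    proof (cases "x \<in> Poly_Mapping.keys (expo_map \<epsilon> (e k))")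
      case True
      then obtain i j where x: "x = (i, \<epsilon> j)" and "(i, j) \<in> Poly_Mapping.keys (e k)"
        using keys_expo_map by fastforce
      then have "i \<in> R" "j \<in> {1..m k}" using keys[of k] by auto
      moreover have "Poly_Mapping.keys (e k) \<subseteq> UNIV \<times> fset (oi_interval (m k))" using keys[of k] by auto
      ultimately show ?thesis
        using le lookup_expo_map[OF oi_hom_inj[OF \<epsilon>], of "e k" j i] x by simp
    qed (simp add: in_keys_iff)
    then have "e l = (e l - expo_map \<epsilon> (e k)) + expo_map \<epsilon> (e k)"
      by (intro poly_mapping_eqI) (simp add: lookup_add lookup_minus)
    then show ?thesis using \<epsilon> by blast
  qed
  show thesis using that[OF \<phi>(1)] emb \<phi>(2) by blast
qed


section \<open>Term orders\<close>

text \<open>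
  Variables are ordered lexicographically, first by row and then by column, and exponents by
  their first difference; a strictly increasing \<open>\<epsilon>\<close> preserves the order of the variables.
\<close>

lemma expo_map_strict_mono:
  assumes \<epsilon>: "\<epsilon> \<in> oi_hom S T" and keys: "Poly_Mapping.keys a \<subseteq> UNIV \<times> fset S" "Poly_Mapping.keys b \<subseteq> UNIV \<times> fset S"
    and less: "a < b"
  shows "expo_map \<epsilon> a < expo_map \<epsilon> b"
proof -
  from less obtain i j where *: "Poly_Mapping.lookup a (i, j) < Poly_Mapping.lookup b (i, j)"
    "\<And>x. x < (i, j) \<Longrightarrow> Poly_Mapping.lookup a x = Poly_Mapping.lookup b x"
    unfolding less_poly_mapping.rep_eq less_fun_def by force
  have j: "j \<in> fset S" using * keys(2) by (metis gr_implies_not0 in_keys_iff mem_Sigma_iff subsetD)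
  note look = lookup_expo_map[OF oi_hom_inj[OF \<epsilon>]]
  have "Poly_Mapping.lookup (expo_map \<epsilon> a) x = Poly_Mapping.lookup (expo_map \<epsilon> b) x"
    if x: "x < (i, \<epsilon> j)" for x
  proof (cases "snd x \<in> \<epsilon> ` fset S")
    case True
    then obtain j' where j': "j' \<in> fset S" "x = (fst x, \<epsilon> j')" by (metis imageE prod.collapse)
    then have "(fst x, j') < (i, j)"
      using x j oi_hom_less_iff[OF \<epsilon>, of j' j] by (metis less_prod_simp)
    then show ?thesis using look[OF keys(1) j'(1)] look[OF keys(2) j'(1)] * j'(2) by metis
  next
    case False
    then have "x \<notin> Poly_Mapping.keys (expo_map \<epsilon> a)" "x \<notin> Poly_Mapping.keys (expo_map \<epsilon> b)"
      using keys_expo_map[of \<epsilon> a] keys_expo_map[of \<epsilon> b] keys by (auto 0 4)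
    then show ?thesis by (simp add: in_keys_iff)
  qed
  then show ?thesis unfolding less_poly_mapping.rep_eq less_fun_def
    using *(1) look[OF keys(1) j] look[OF keys(2) j] by (metis (no_types, lifting))
qed

lemma zero_le_expo: "(0 :: expo) \<le> a"
proof (rule ccontr)
  assume "\<not> 0 \<le> a"
  then have "a < 0" by simp
  then show False by (auto simp: less_poly_mapping.rep_eq less_fun_def)
qed

text \<open>
  In a descending chain of fixed width, \<open>exponent_sequence_embedding\<close> finds an earlier member whose
  image under an endomorphism of \<open>[n]\<close> divides a later one. That endomorphism is the identity, so the later
  member is not smaller.
\<close>

lemma wf_expo_less:
  assumes "finite R"
  shows "wf {(a, b :: expo). a < b \<and> Poly_Mapping.keys a \<subseteq> R \<times> {1..n} \<and> Poly_Mapping.keys b \<subseteq> R \<times> {1..n}}"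
    (is "wf ?r")
proof (rule ccontr)
  assume "\<not> wf ?r"
  then obtain f where f: "\<And>i. (f (Suc i), f i) \<in> ?r"
    by (auto simp: wf_iff_no_infinite_down_chain)
  have keys: "Poly_Mapping.keys (f i) \<subseteq> R \<times> {1..n}" for i using f[of i] by auto
  obtain \<phi> :: "nat \<Rightarrow> nat" where \<phi>: "strict_mono \<phi>"
    "\<And>i j. i < j \<Longrightarrow> \<exists>\<epsilon>\<in>oi_hom (oi_interval n) (oi_interval n). \<exists>\<kappa>. f (\<phi> j) = \<kappa> + expo_map \<epsilon> (f (\<phi> i))"
    using exponent_sequence_embedding[OF assms, of f "\<lambda>_. n"] keys by blast
  obtain \<epsilon> \<kappa> where \<epsilon>: "\<epsilon> \<in> oi_hom (oi_interval n) (oi_interval n)" "f (\<phi> 1) = \<kappa> + expo_map \<epsilon> (f (\<phi> 0))"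
    using \<phi>(2)[of 0 1] by auto
  have "\<epsilon> j = j" if "j \<in> {1..n}" for j using oi_endo_eq_id[OF \<epsilon>(1)] that by (simp add: oi_id_def)
  then have "expo_map \<epsilon> (f (\<phi> 0)) = f (\<phi> 0)"
    using keys by (intro expo_map_id_on[of "{1..n}"]) auto
  then have "0 + f (\<phi> 0) \<le> f (\<phi> 1)" unfolding \<epsilon>(2) by (metis add_right_mono zero_le_expo)
  moreover have "f j < f i" if "i < j" for i j
    using that by (rule less_Suc_induct[where P = "\<lambda>i j. f j < f i"]) (use f in auto)
  then have "f (\<phi> 1) < f (\<phi> 0)" using \<phi>(1) by (simp add: strict_mono_less)
  ultimately show False by simp
qed

lemma strict_linear_order_max:
  assumes "strict_linear_order_on A r" "finite F" "F \<noteq> {}" "F \<subseteq> A"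
  shows "\<exists>x\<in>F. \<forall>y\<in>F. y \<noteq> x \<longrightarrow> (x, y) \<in> r"
  using assms(2-4)
proof (induction rule: finite_ne_induct)
  case (insert z F)
  then obtain x where x: "x \<in> F" "\<And>y. y \<in> F \<Longrightarrow> y \<noteq> x \<Longrightarrow> (x, y) \<in> r" by auto
  have "trans r" "total_on A r" using assms(1) by (auto simp: strict_linear_order_on_def)
  consider "(x, z) \<in> r" | "(z, x) \<in> r" | "x = z"
    using \<open>total_on A r\<close> insert.prems x(1) by (auto simp: total_on_def)
  then show ?case
  proof cases
    case 2
    then have "\<forall>y\<in>insert z F. y \<noteq> z \<longrightarrow> (z, y) \<in> r" using x \<open>trans r\<close> by (metis insertE transD)
    then show ?thesis by blast
  qed (use x in auto)
qed simp


section \<open>Marked exponents\<close>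

text \<open>
  The exponent of \<open>x\<^bsub>0,\<pi>(1)\<^esub> \<cdots> x\<^bsub>0,\<pi>(d)\<^esub>\<close>. Monomials of \<open>P\<close> only involve the rows \<open>1, \<dots>, c\<close>, so
  row \<open>0\<close> is free to record the basis element \<open>e\<^sub>\<pi>\<close>.
\<close>

definition mark :: "nat \<Rightarrow> (nat \<Rightarrow> nat) \<Rightarrow> expo" where
  "mark d \<pi> = (\<Sum>i\<in>{1..d}. Poly_Mapping.single (0, \<pi> i) 1)"

lemma lookup_mark_pos: "Poly_Mapping.lookup (mark d \<pi>) (i, j) > 0 \<longleftrightarrow> i = 0 \<and> j \<in> \<pi> ` {1..d}"
  by (auto simp: mark_def lookup_sum lookup_single when_def sum_eq_0_iff simp flip: neq0_conv)

lemma keys_mark: "Poly_Mapping.keys (mark d \<pi>) = {0} \<times> \<pi> ` {1..d}"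
  using lookup_mark_pos[of d \<pi>] by (auto simp: in_keys_iff simp flip: neq0_conv)

lemma expo_map_mark: "expo_map \<epsilon> (mark d \<pi>) = mark d (compose {1..d} \<epsilon> \<pi>)"
  by (simp add: mark_def expo_map_sum expo_map_single compose_def)

definition marked :: "nat \<Rightarrow> (nat \<Rightarrow> nat) \<times> expo \<Rightarrow> expo" where
  "marked d x = snd x + mark d (fst x)"

text \<open>
  Row \<open>0\<close> of the equation says that every position marked by \<open>\<rho>\<close> is marked by \<open>\<pi>\<close>; both mark \<open>d\<close> positions.
\<close>

lemma marks_agree_if_multiple:
  assumes \<pi>: "\<pi> \<in> oi_hom (oi_interval d) S" and \<rho>: "\<rho> \<in> oi_hom (oi_interval d) S"
    and rows: "Poly_Mapping.keys a \<subseteq> {1..c} \<times> UNIV"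
    and eq: "a + mark d \<pi> = \<kappa> + mark d \<rho>"
  shows "\<rho> = \<pi>"
proof (rule oi_hom_eqI_image[OF \<pi> \<rho>], rule subsetI)
  fix j assume "j \<in> \<rho> ` fset (oi_interval d)"
  then have "Poly_Mapping.lookup (\<kappa> + mark d \<rho>) (0, j) > 0"
    using lookup_mark_pos[of d \<rho> 0 j] by (simp add: lookup_add)
  moreover have "Poly_Mapping.lookup a (0, j) = 0" using rows by (auto simp flip: not_in_keys_iff_lookup_eq_zero)
  ultimately have "Poly_Mapping.lookup (mark d \<pi>) (0, j) > 0" by (simp flip: eq add: lookup_add)
  then show "j \<in> \<pi> ` fset (oi_interval d)" by (simp add: lookup_mark_pos)
qed


section \<open>Coefficients\<close>

abbreviation coef :: "'k::comm_ring_1 fvec \<Rightarrow> (nat \<Rightarrow> nat) \<Rightarrow> expo \<Rightarrow> 'k" where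
  "coef q \<pi> a \<equiv> Poly_Mapping.lookup (Poly_Mapping.lookup q \<pi>) a"

lemma lookup_single_mult:
  fixes p :: "'k::comm_ring_1 pol"
  shows "Poly_Mapping.lookup (Poly_Mapping.single \<kappa> r * p) (\<kappa> + a) = r * Poly_Mapping.lookup p a"
proof -
  have "Poly_Mapping.lookup (Poly_Mapping.single \<kappa> r * p) (\<kappa> + a) =
      (\<Sum>l. (r * (\<Sum>q. Poly_Mapping.lookup p q when q = a)) when l = \<kappa>)"
    unfolding lookup_mult by (rule arg_cong[of _ _ Sum_any]) (auto simp: lookup_single when_def intro!: ext arg_cong[of _ _ Sum_any])
  then show ?thesis by simp
qed

lemma lookup_const_mult:
  fixes p :: "'k::comm_ring_1 pol"
  shows "Poly_Mapping.lookup (pol_const r * p) a = r * Poly_Mapping.lookup p a"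
  using lookup_single_mult[of 0 r p a] by (simp add: pol_const_def)

lemma keys_single_mult:
  fixes p :: "'k::comm_ring_1 pol"
  shows "Poly_Mapping.keys (Poly_Mapping.single \<kappa> r * p) \<subseteq> (+) \<kappa> ` Poly_Mapping.keys p"
  using keys_mult[of "Poly_Mapping.single \<kappa> r" p] by (auto split: if_splits)

lemma lookup_pol_map:
  fixes p :: "'k::comm_ring_1 pol"
  assumes "inj_on (expo_map \<epsilon>) (insert a (Poly_Mapping.keys p))"
  shows "Poly_Mapping.lookup (pol_map \<epsilon> p) (expo_map \<epsilon> a) = Poly_Mapping.lookup p a"
proof -
  have "Poly_Mapping.lookup (pol_map \<epsilon> p) (expo_map \<epsilon> a) =
      (\<Sum>b\<in>Poly_Mapping.keys p. if b = a then Poly_Mapping.lookup p a else 0)"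
    unfolding pol_map_def lookup_sum
    by (rule sum.cong) (use assms in \<open>auto simp: lookup_single when_def inj_on_def\<close>)
  also have "\<dots> = Poly_Mapping.lookup p a" by (subst sum.delta) (auto simp: in_keys_iff)
  finally show ?thesis .
qed

lemma keys_pol_map: "Poly_Mapping.keys (pol_map \<epsilon> p) \<subseteq> expo_map \<epsilon> ` Poly_Mapping.keys p"
  unfolding pol_map_def by (rule order_trans[OF keys_sum]) (auto split: if_splits)

lemma pol_map_zero [simp]: "pol_map \<epsilon> 0 = 0"
  by (simp add: pol_map_def)

lemma pol_map_single [simp]: "pol_map \<epsilon> (Poly_Mapping.single a r) = Poly_Mapping.single (expo_map \<epsilon> a) r"
  by (simp add: pol_map_def)

lemma pol_map_id:
  assumes "p \<in> oi_P c S"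
  shows "pol_map (oi_id S) p = p"
proof -
  have "expo_map (oi_id S) a = a" if "a \<in> Poly_Mapping.keys p" for a
    using assms that by (intro expo_map_id_on[of "fset S"]) (auto simp: oi_id_def oi_P_def)
  then have "pol_map (oi_id S) p =
      (\<Sum>a\<in>Poly_Mapping.keys p. Poly_Mapping.single a (Poly_Mapping.lookup p a))"
    unfolding pol_map_def by (intro sum.cong) auto
  also have "\<dots> = p"
    by (rule poly_mapping_eqI) (auto simp: lookup_sum lookup_single when_def sum.delta' in_keys_iff)
  finally show ?thesis .
qed

lemma lookup_free_smult [simp]: "Poly_Mapping.lookup (free_smult b q) \<pi> = b * Poly_Mapping.lookup q \<pi>"
  unfolding free_smult_def by transfer (simp add: when_def)

lemma keys_free_smult: "Poly_Mapping.keys (free_smult b q) \<subseteq> Poly_Mapping.keys q"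
  by (auto simp: in_keys_iff)

lemma free_smult_single [simp]: "free_smult b (Poly_Mapping.single \<pi> p) = Poly_Mapping.single \<pi> (b * p)"
  by (rule poly_mapping_eqI) (simp add: lookup_single when_def)

lemma compose_inj_on_hom:
  assumes "\<epsilon> \<in> oi_hom S T"
  shows "inj_on (compose (fset R) \<epsilon>) (oi_hom R S)"
proof (rule inj_onI)
  fix \<pi> \<rho> assume *: "\<pi> \<in> oi_hom R S" "\<rho> \<in> oi_hom R S" "compose (fset R) \<epsilon> \<pi> = compose (fset R) \<epsilon> \<rho>"
  have "\<pi> j = \<rho> j" if "j \<in> fset R" for j
    using fun_cong[OF *(3), of j] that oi_hom_mem[OF *(1) that] oi_hom_mem[OF *(2) that] oi_hom_inj[OF assms]
    by (simp add: compose_def inj_on_def)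
  then show "\<pi> = \<rho>" using oi_hom_ext[OF *(1)] oi_hom_ext[OF *(2)] by (auto intro: extensionalityI)
qed

lemma lookup_free_map:
  assumes \<epsilon>: "\<epsilon> \<in> oi_hom S T" and keys: "Poly_Mapping.keys q \<subseteq> oi_hom (oi_interval d) S"
    and \<pi>: "\<pi> \<in> oi_hom (oi_interval d) S"
  shows "Poly_Mapping.lookup (free_map d S T \<epsilon> q) (compose {1..d} \<epsilon> \<pi>) = pol_map \<epsilon> (Poly_Mapping.lookup q \<pi>)"
proof -
  have inj: "compose {1..d} \<epsilon> \<rho> = compose {1..d} \<epsilon> \<pi> \<longleftrightarrow> \<rho> = \<pi>" if "\<rho> \<in> Poly_Mapping.keys q" for \<rho>
    using compose_inj_on_hom[OF \<epsilon>, of "oi_interval d"] that keys \<pi> by (auto simp: inj_on_def)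
  have "Poly_Mapping.lookup (free_map d S T \<epsilon> q) (compose {1..d} \<epsilon> \<pi>) =
      (\<Sum>\<rho>\<in>Poly_Mapping.keys q. if \<rho> = \<pi> then pol_map \<epsilon> (Poly_Mapping.lookup q \<pi>) else 0)"
    unfolding free_map_def lookup_sum
    by (rule sum.cong) (auto simp: lookup_single when_def inj simp del: One_nat_def)
  also have "\<dots> = pol_map \<epsilon> (Poly_Mapping.lookup q \<pi>)" by (subst sum.delta) (auto simp: in_keys_iff)
  finally show ?thesis .
qed

lemma keys_free_map: "Poly_Mapping.keys (free_map d S T \<epsilon> q) \<subseteq> compose {1..d} \<epsilon> ` Poly_Mapping.keys q"
  unfolding free_map_def by (rule order_trans[OF keys_sum]) (auto split: if_splits)

lemma free_map_single [simp]:
  "free_map d S T \<epsilon> (Poly_Mapping.single \<pi> p) = Poly_Mapping.single (compose {1..d} \<epsilon> \<pi>) (pol_map \<epsilon> p)"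
  by (simp add: free_map_def)

section \<open>Ideals of a type and submodules\<close>

lemma carrier_type_ring [simp]: "carrier (ring_of_type_algebra :: 'a::comm_ring_1 ring) = UNIV"
  and mult_type_ring [simp]: "x \<otimes>\<^bsub>ring_of_type_algebra\<^esub> y = (x :: 'a) * y"
  and one_type_ring [simp]: "\<one>\<^bsub>ring_of_type_algebra\<^esub> = (1 :: 'a)"
  and zero_type_ring [simp]: "\<zero>\<^bsub>ring_of_type_algebra\<^esub> = (0 :: 'a)"
  and add_type_ring [simp]: "x \<oplus>\<^bsub>ring_of_type_algebra\<^esub> y = (x :: 'a) + y"
  by (simp_all add: ring_of_type_algebra_def)

lemma a_inv_type_ring [simp]: "\<ominus>\<^bsub>ring_of_type_algebra\<^esub> x = - (x :: 'a::comm_ring_1)"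
proof -
  interpret cring "ring_of_type_algebra :: 'a ring" by (rule cring_from_type_algebra)
  show ?thesis by (rule minus_equality) simp_all
qed

lemma ideal_type_ring_iff:
  fixes I :: "'a::comm_ring_1 set"
  shows "ideal I ring_of_type_algebra \<longleftrightarrow> 0 \<in> I \<and> (\<forall>x\<in>I. \<forall>y\<in>I. x + y \<in> I) \<and> (\<forall>r. \<forall>x\<in>I. r * x \<in> I)"
    (is "?L \<longleftrightarrow> ?R")
proof
  assume ?L
  then interpret ideal I "ring_of_type_algebra" .
  have "0 \<in> I" using additive_subgroup.zero_closed[OF is_additive_subgroup] by simp
  moreover have "x + y \<in> I" if "x \<in> I" "y \<in> I" for x y
    using additive_subgroup.a_closed[OF is_additive_subgroup that] by simp
  moreover have "r * x \<in> I" if "x \<in> I" for r x using I_l_closed[OF that, of r] by simp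
  ultimately show ?R by blast
next
  assume R: ?R
  interpret cring "ring_of_type_algebra :: 'a ring" by (rule cring_from_type_algebra)
  have "- x \<in> I" if "x \<in> I" for x
    using R that by (metis mult_minus1)
  with R have "subgroup I (add_monoid ring_of_type_algebra)"
    by (intro add.subgroupI) (auto simp flip: a_inv_def)
  moreover have "r * x \<in> I" "x * r \<in> I" if "x \<in> I" for r x
    using R that by (auto simp: mult.commute[of x])
  ultimately show ?L by (intro idealI ring_axioms) simp_all
qed

lemma submodule_iff:
  assumes "module R M"
  shows "submodule H R M \<longleftrightarrow> H \<subseteq> carrier M \<and> \<zero>\<^bsub>M\<^esub> \<in> H \<and> (\<forall>x\<in>H. \<forall>y\<in>H. x \<oplus>\<^bsub>M\<^esub> y \<in> H) \<and>
    (\<forall>a\<in>carrier R. \<forall>x\<in>H. a \<odot>\<^bsub>M\<^esub> x \<in> H)" (is "?L \<longleftrightarrow> ?R")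
proof -
  interpret module R M by fact
  show ?thesis
  proof
    assume L: ?L
    have "\<zero>\<^bsub>M\<^esub> \<in> H" using subgroup.one_closed[OF submodule.axioms(1)[OF L]] by simp
    then show ?R using submoduleE[OF L] by blast
  next
    assume R: ?R
    show ?L
    proof (rule submoduleI)
      fix x assume "x \<in> H"
      then have "(\<ominus>\<^bsub>R\<^esub> \<one>\<^bsub>R\<^esub>) \<odot>\<^bsub>M\<^esub> x \<in> H" "x \<in> carrier M" using R by auto
      then show "\<ominus>\<^bsub>M\<^esub> x \<in> H" by (simp add: smult_l_minus)
    qed (use R in auto)
  qed
qed

text \<open>
  The ascending chain condition for the ideals generated by the initial segments of the sequence,
  phrased without mentioning generated ideals.
\<close>

lemma noetherian_sequence:
  fixes k :: "nat \<Rightarrow> 'k::comm_ring_1"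
  assumes "noetherian_ring (ring_of_type_algebra :: 'k ring)"
  obtains n where "\<And>I. ideal I ring_of_type_algebra \<Longrightarrow> (\<And>i. i < n \<Longrightarrow> k i \<in> I) \<Longrightarrow> k n \<in> I"
proof -
  interpret noetherian_ring "ring_of_type_algebra :: 'k ring" by fact
  define gen where "gen n = genideal ring_of_type_algebra (k ` {..<n})" for n
  have ideal: "ideal (gen n) ring_of_type_algebra" for n
    unfolding gen_def by (rule genideal_ideal) simp
  have mem: "k i \<in> gen n" if "i < n" for i n
    using genideal_self[of "k ` {..<n}"] that by (auto simp: gen_def)
  have least: "gen n \<subseteq> I" if "ideal I ring_of_type_algebra" "\<And>i. i < n \<Longrightarrow> k i \<in> I" for n I
    unfolding gen_def by (rule genideal_minimal) (use that in auto)
  have mono: "gen m \<subseteq> gen n" if "m \<le> n" for m n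
    using that mem by (intro least ideal) auto
  have "gen m \<subseteq> gen n \<or> gen n \<subseteq> gen m" for m n using mono[of m n] mono[of n m] by linarith
  then have "subset.chain {I. ideal I ring_of_type_algebra} (range gen)"
    unfolding pred_on.chain_def psubset_eq using ideal by blast
  then have "\<Union> (range gen) \<in> range gen" by (intro ideal_chain_is_trivial) auto
  then obtain n where "\<Union> (range gen) = gen n" by auto
  then have "k n \<in> gen n" using mem[of n "Suc n"] by auto
  then show thesis using least that by blast
qed


section \<open>Saturated algebras generated by monomials\<close>

locale saturated_monomial_algebra =
  fixes B :: "nat fset \<Rightarrow> 'k::comm_ring_1 pol set" and c :: nat
  assumes noetherian: "noetherian_ring (ring_of_type_algebra :: 'k ring)"
    and subalgebra: "oi_subalgebra (oi_P c) B"
    and monomially_generated: "oi_alg_monomially_generated B"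
    and saturated: "\<And>m n \<nu> \<mu> \<epsilon> \<kappa>.
      \<lbrakk>\<nu> \<in> pol_monomials B m; \<mu> \<in> pol_monomials B n;
       \<epsilon> \<in> oi_hom (oi_interval m) (oi_interval n); \<kappa> \<in> oi_P c (oi_interval n);
       \<mu> = pol_map \<epsilon> \<nu> * \<kappa>\<rbrakk> \<Longrightarrow> \<kappa> \<in> B (oi_interval n)"
begin

lemma subring_B: "subring (B S) ring_of_type_algebra"
  using subalgebra by (simp add: oi_subalgebra_def)

lemma B_sub_P: "p \<in> B S \<Longrightarrow> p \<in> oi_P c S"
  using subalgebra by (auto simp: oi_subalgebra_def)

lemma B_const [simp]: "pol_const r \<in> B S"
  using subalgebra by (auto simp: oi_subalgebra_def)

lemma B_zero [simp]: "0 \<in> B S" and B_one [simp]: "1 \<in> B S"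
  using subringE(2,3)[OF subring_B, of S] by simp_all

lemma B_add: "p \<in> B S \<Longrightarrow> q \<in> B S \<Longrightarrow> p + q \<in> B S"
  and B_mult: "p \<in> B S \<Longrightarrow> q \<in> B S \<Longrightarrow> p * q \<in> B S"
  and B_uminus: "p \<in> B S \<Longrightarrow> - p \<in> B S"
  using subringE(5-7)[OF subring_B, of _ S] by simp_all

lemma B_pol_map: "\<epsilon> \<in> oi_hom S T \<Longrightarrow> p \<in> B S \<Longrightarrow> pol_map \<epsilon> p \<in> B T"
  using subalgebra unfolding oi_subalgebra_def by blast

lemma B_keys: "p \<in> B S \<Longrightarrow> a \<in> Poly_Mapping.keys p \<Longrightarrow> Poly_Mapping.keys a \<subseteq> {1..c} \<times> fset S"
  using B_sub_P by (auto simp: oi_P_def)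

lemma B_single_keys: "Poly_Mapping.single a (1::'k) \<in> B S \<Longrightarrow> Poly_Mapping.keys a \<subseteq> {1..c} \<times> fset S"
  by (rule B_keys) auto

text \<open>
  The elements of \<open>B\<close> all of whose monomials lie in \<open>B\<close> form a subalgebra, which contains the
  generators because these are monomials. So it is all of \<open>B\<close>.
\<close>

lemma B_monomials:
  assumes "p \<in> B S" "a \<in> Poly_Mapping.keys p"
  shows "Poly_Mapping.single a 1 \<in> B S"
proof -
  define B' where "B' S = {p \<in> B S. \<forall>a\<in>Poly_Mapping.keys p. Poly_Mapping.single a 1 \<in> B S}" for S
  obtain G where G: "G \<subseteq> (SIGMA n:UNIV. pol_monomials B n)" "oi_alg_generated_by B G"
    using monomially_generated by (auto simp: oi_alg_monomially_generated_def)
  have "subring (B' S) ring_of_type_algebra" for S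
  proof (rule ring.subringI)
    show "ring (ring_of_type_algebra :: 'k pol ring)" by (rule ring_from_type_algebra)
    fix p q assume pq: "p \<in> B' S" "q \<in> B' S"
    show "\<ominus>\<^bsub>ring_of_type_algebra\<^esub> p \<in> B' S" using pq by (auto simp: B'_def B_uminus in_keys_iff)
    show "p \<oplus>\<^bsub>ring_of_type_algebra\<^esub> q \<in> B' S" using pq keys_add[of p q] by (auto simp: B'_def B_add)
    have "Poly_Mapping.single (a + b) (1::'k) \<in> B S"
      if "a \<in> Poly_Mapping.keys p" "b \<in> Poly_Mapping.keys q" for a b
    proof -
      have "Poly_Mapping.single a 1 * Poly_Mapping.single b 1 \<in> B S"
        using that pq by (intro B_mult) (auto simp: B'_def)
      then show ?thesis by (simp add: mult_single)
    qed
    then show "p \<otimes>\<^bsub>ring_of_type_algebra\<^esub> q \<in> B' S"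
      using pq keys_mult[of p q] by (auto simp: B'_def B_mult)
  qed (auto simp: B'_def)
  moreover have "pol_map \<epsilon> p \<in> B' T" if \<epsilon>: "\<epsilon> \<in> oi_hom S T" and p: "p \<in> B' S" for S T \<epsilon> p
  proof -
    have "Poly_Mapping.single (expo_map \<epsilon> a) 1 \<in> B T" if "a \<in> Poly_Mapping.keys p" for a
      using B_pol_map[OF \<epsilon>, of "Poly_Mapping.single a 1"] p that by (auto simp: B'_def)
    then show ?thesis using p keys_pol_map[of \<epsilon> p] B_pol_map[OF \<epsilon>] by (auto simp: B'_def)
  qed
  moreover have "pol_const r \<in> B' S" for r S
    by (auto simp: B'_def pol_const_def[of r] B_const[unfolded pol_const_def] split: if_splits)
  ultimately have "oi_subalgebra B B'"
    unfolding oi_subalgebra_def by (auto simp: B'_def)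
  moreover have "G \<subseteq> oi_coprod B'"
    using G(1) by (fastforce simp: oi_coprod_def B'_def pol_monomials_def)
  ultimately have "B' = B" using G(2) by (auto simp: oi_alg_generated_by_def)
  then show ?thesis using assms by (auto simp: B'_def fun_eq_iff)
qed


text \<open>
  The monomial \<open>x\<^sup>a e\<^sub>\<pi>\<close> of width \<open>m\<close> is represented by the triple \<open>(m, \<pi>, a)\<close>.
\<close>

definition idx :: "nat \<Rightarrow> (nat \<times> (nat \<Rightarrow> nat) \<times> expo) set" where
  "idx d = {(m, \<pi>, a). \<pi> \<in> oi_hom (oi_interval d) (oi_interval m) \<and>
     Poly_Mapping.single a (1::'k) \<in> B (oi_interval m)}"

definition mono_dvd ::
    "nat \<Rightarrow> nat \<times> (nat \<Rightarrow> nat) \<times> expo \<Rightarrow> nat \<times> (nat \<Rightarrow> nat) \<times> expo \<Rightarrow> bool" where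
  "mono_dvd d = (\<lambda>(m, \<pi>, a) (n, \<rho>, b). \<exists>\<epsilon>\<in>oi_hom (oi_interval m) (oi_interval n). \<exists>\<kappa>.
     Poly_Mapping.single \<kappa> (1::'k) \<in> B (oi_interval n) \<and>
     \<rho> = compose {1..d} \<epsilon> \<pi> \<and> b = \<kappa> + expo_map \<epsilon> a)"

lemma keys_marked:
  assumes "(m, x) \<in> idx d"
  shows "Poly_Mapping.keys (marked d x) \<subseteq> {0..c} \<times> {1..m}"
proof -
  obtain \<pi> a where x: "x = (\<pi>, a)" by (cases x)
  with assms have \<pi>: "\<pi> \<in> oi_hom (oi_interval d) (oi_interval m)"
    and a: "Poly_Mapping.single a (1::'k) \<in> B (oi_interval m)" by (auto simp: idx_def)
  have "Poly_Mapping.keys a \<subseteq> {0..c} \<times> {1..m}" using B_single_keys[OF a] by auto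
  moreover have "Poly_Mapping.keys (mark d \<pi>) \<subseteq> {0..c} \<times> {1..m}"
    using oi_hom_mem[OF \<pi>] by (force simp: keys_mark)
  ultimately show ?thesis using keys_add[of a "mark d \<pi>"] x by (auto simp: marked_def)
qed

text \<open>
  The marks in the equation show that \<open>\<epsilon>\<close> carries \<open>\<pi>\<close> to \<open>\<rho>\<close>, and saturation moves the cofactor \<open>\<kappa>\<close> from \<open>P\<close> into \<open>B\<close>.
\<close>

lemma marked_eq_imp_mono_dvd:
  assumes x: "(m, \<pi>, a) \<in> idx d" and y: "(n, \<rho>, b) \<in> idx d"
    and \<epsilon>: "\<epsilon> \<in> oi_hom (oi_interval m) (oi_interval n)"
    and eq: "marked d (\<rho>, b) = \<kappa> + expo_map \<epsilon> (marked d (\<pi>, a))"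
  shows "mono_dvd d (m, \<pi>, a) (n, \<rho>, b)"
proof -
  have hom: "\<pi> \<in> oi_hom (oi_interval d) (oi_interval m)" "\<rho> \<in> oi_hom (oi_interval d) (oi_interval n)"
    and mem: "Poly_Mapping.single a (1::'k) \<in> B (oi_interval m)" "Poly_Mapping.single b (1::'k) \<in> B (oi_interval n)"
    using x y by (auto simp: idx_def)
  have eq': "b + mark d \<rho> = (\<kappa> + expo_map \<epsilon> a) + mark d (compose {1..d} \<epsilon> \<pi>)"
    using eq by (simp add: marked_def expo_map_add expo_map_mark add.assoc)
  have \<rho>: "compose {1..d} \<epsilon> \<pi> = \<rho>"
    using marks_agree_if_multiple[OF hom(2) _ _ eq', of c] compose_oi_hom[OF hom(1) \<epsilon>] B_single_keys[OF mem(2)]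
    by auto
  with eq' have b: "b = \<kappa> + expo_map \<epsilon> a" by simp
  then have "Poly_Mapping.keys \<kappa> \<subseteq> Poly_Mapping.keys b" by (auto simp: in_keys_iff lookup_add)
  then have "Poly_Mapping.single \<kappa> (1::'k) \<in> oi_P c (oi_interval n)"
    using B_single_keys[OF mem(2)] by (auto simp: oi_P_def)
  moreover have "Poly_Mapping.single b (1::'k) = pol_map \<epsilon> (Poly_Mapping.single a 1) * Poly_Mapping.single \<kappa> 1"
    by (simp add: b mult_single add.commute)
  moreover have "Poly_Mapping.single a 1 \<in> pol_monomials B m" "Poly_Mapping.single b 1 \<in> pol_monomials B n"
    using mem by (auto simp: pol_monomials_def)
  ultimately have "Poly_Mapping.single \<kappa> (1::'k) \<in> B (oi_interval n)"
    using saturated[OF _ _ \<epsilon>] by blast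
  then show ?thesis using \<epsilon> \<rho> b by (auto simp: mono_dvd_def)
qed

lemma mono_dvd_wqo:
  assumes "\<And>n :: nat. x n \<in> idx d"
  obtains \<phi> :: "nat \<Rightarrow> nat" where "strict_mono \<phi>" "\<And>i j. i < j \<Longrightarrow> mono_dvd d (x (\<phi> i)) (x (\<phi> j))"
proof -
  define m where "m n = fst (x n)" for n
  define e where "e n = marked d (snd (x n))" for n
  have keys: "Poly_Mapping.keys (e n) \<subseteq> {0..c} \<times> {1..m n}" for n
    using keys_marked[of "m n" "snd (x n)" d] assms by (simp add: m_def e_def)
  obtain \<phi> :: "nat \<Rightarrow> nat" where \<phi>: "strict_mono \<phi>"
    "\<And>i j. i < j \<Longrightarrow> \<exists>\<epsilon>\<in>oi_hom (oi_interval (m (\<phi> i))) (oi_interval (m (\<phi> j))).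
            \<exists>\<kappa>. e (\<phi> j) = \<kappa> + expo_map \<epsilon> (e (\<phi> i))"
    by (rule exponent_sequence_embedding[of "{0..c}" e m]) (use keys in blast)+
  have "mono_dvd d (x (\<phi> i)) (x (\<phi> j))" if ij: "i < j" for i j
  proof -
    obtain \<epsilon> \<kappa> where \<epsilon>: "\<epsilon> \<in> oi_hom (oi_interval (m (\<phi> i))) (oi_interval (m (\<phi> j)))"
      "e (\<phi> j) = \<kappa> + expo_map \<epsilon> (e (\<phi> i))" using \<phi>(2)[OF ij] by blast
    then show ?thesis
      using marked_eq_imp_mono_dvd[of "m (\<phi> i)" "fst (snd (x (\<phi> i)))" "snd (snd (x (\<phi> i)))" d
          "m (\<phi> j)" "fst (snd (x (\<phi> j)))" "snd (snd (x (\<phi> j)))" \<epsilon> \<kappa>] assms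
      by (simp add: m_def e_def)
  qed
  then show thesis using that \<phi>(1) by blast
qed


section \<open>Coefficient systems\<close>

text \<open>
  What the coefficient ideals of a submodule satisfy. Working with all such families at once
  separates the finiteness argument from leading terms and from generators.
\<close>

definition coeff_system :: "nat \<Rightarrow> (nat \<times> (nat \<Rightarrow> nat) \<times> expo \<Rightarrow> 'k set) \<Rightarrow> bool" where
  "coeff_system d I \<longleftrightarrow>
     (\<forall>x\<in>idx d. ideal (I x) ring_of_type_algebra) \<and>
     (\<forall>x\<in>idx d. \<forall>y\<in>idx d. mono_dvd d x y \<longrightarrow> I x \<subseteq> I y)"

text \<open>
  Otherwise one could choose pairs \<open>(x\<^sub>n, k\<^sub>n)\<close> in \<open>Y\<close> and systems \<open>I\<^sub>n\<close> containing the earlier pairs but not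
  \<open>(x\<^sub>n, k\<^sub>n)\<close>. Along a subsequence the \<open>x\<^sub>n\<close> form a divisibility chain, so \<open>I\<^sub>n\<close> at \<open>x\<^sub>n\<close> contains all earlier \<open>k\<^sub>i\<close> of the
  subsequence, and \<open>noetherian_sequence\<close> forces it to contain \<open>k\<^sub>n\<close> for some \<open>n\<close>.
\<close>

lemma coeff_system_finite:
  assumes Y: "Y \<subseteq> idx d \<times> UNIV"
  obtains E where "finite E" "E \<subseteq> Y"
    and "\<And>I. coeff_system d I \<Longrightarrow> (\<And>x k. (x, k) \<in> E \<Longrightarrow> k \<in> I x) \<Longrightarrow> (\<And>x k. (x, k) \<in> Y \<Longrightarrow> k \<in> I x)"
proof (rule ccontr)
  assume no: "\<not> thesis"
  \<comment> \<open>\<open>Q f n y\<close>: the pair \<open>y\<close> is not enforced by the pairs \<open>f 0, \<dots>, f (n - 1)\<close>.\<close>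
  define Q where "Q f n y \<longleftrightarrow> y \<in> Y \<and> (\<exists>I. coeff_system d I \<and> (\<forall>i<n. snd (f i) \<in> I (fst (f i))) \<and> snd y \<notin> I (fst y))"
    for f :: "nat \<Rightarrow> (nat \<times> (nat \<Rightarrow> nat) \<times> expo) \<times> 'k" and n y
  have "\<exists>f. \<forall>n. Q f n (f n)"
  proof (rule dependent_wellorder_choice)
    fix r n and f g :: "nat \<Rightarrow> (nat \<times> (nat \<Rightarrow> nat) \<times> expo) \<times> 'k"
    assume "\<And>i. i < n \<Longrightarrow> f i = g i"
    then show "Q f n r = Q g n r" unfolding Q_def by (simp cong: conj_cong)
  next
    fix n and f :: "nat \<Rightarrow> (nat \<times> (nat \<Rightarrow> nat) \<times> expo) \<times> 'k"
    assume "\<And>i. i < n \<Longrightarrow> Q f i (f i)"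
    then have sub: "f ` {..<n} \<subseteq> Y" by (auto simp: Q_def)
    show "\<exists>y. Q f n y"
    proof (rule ccontr)
      assume none: "\<nexists>y. Q f n y"
      have "k \<in> I x" if "coeff_system d I" "\<And>x k. (x, k) \<in> f ` {..<n} \<Longrightarrow> k \<in> I x" "(x, k) \<in> Y" for I x k
      proof (rule ccontr)
        assume "k \<notin> I x"
        moreover have "snd (f i) \<in> I (fst (f i))" if "i < n" for i
          using \<open>\<And>x k. (x, k) \<in> f ` {..<n} \<Longrightarrow> k \<in> I x\<close>[of "fst (f i)" "snd (f i)"] that by auto
        ultimately have "Q f n (x, k)" using that(1,3) unfolding Q_def by auto
        with none show False by blast
      qed
      with sub no \<open>\<not> thesis\<close> show False using that[of "f ` {..<n}"] by blast
    qed
  qed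
  then obtain f where f: "\<And>n. Q f n (f n)" by blast
  have mem: "fst (f n) \<in> idx d" for n using f[of n] Y by (auto simp: Q_def)
  obtain \<phi> :: "nat \<Rightarrow> nat" where \<phi>: "strict_mono \<phi>" "\<And>i j. i < j \<Longrightarrow> mono_dvd d (fst (f (\<phi> i))) (fst (f (\<phi> j)))"
    by (rule mono_dvd_wqo[of "\<lambda>n. fst (f n)" d]) (use mem in blast)+
  obtain n where n: "\<And>I. ideal I ring_of_type_algebra \<Longrightarrow> (\<And>i. i < n \<Longrightarrow> snd (f (\<phi> i)) \<in> I) \<Longrightarrow> snd (f (\<phi> n)) \<in> I"
    by (rule noetherian_sequence[OF noetherian, of "\<lambda>i. snd (f (\<phi> i))"]) blast
  obtain I where I: "coeff_system d I" "\<And>i. i < \<phi> n \<Longrightarrow> snd (f i) \<in> I (fst (f i))" "snd (f (\<phi> n)) \<notin> I (fst (f (\<phi> n)))"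
    using f[of "\<phi> n"] unfolding Q_def by blast
  have "snd (f (\<phi> i)) \<in> I (fst (f (\<phi> n)))" if "i < n" for i
    using I(1) I(2)[of "\<phi> i"] \<phi>(1) \<phi>(2)[OF that] mem that
    unfolding coeff_system_def by (blast dest: strict_monoD)
  then have "snd (f (\<phi> n)) \<in> I (fst (f (\<phi> n)))"
    using I(1) mem unfolding coeff_system_def by (intro n) auto
  with I(3) show False by contradiction
qed


section \<open>Free modules and their submodules\<close>

lemma cring_alg_ring: "cring (alg_ring (B S))"
proof -
  interpret cring "ring_of_type_algebra :: 'k pol ring" by (rule cring_from_type_algebra)
  show ?thesis
    unfolding alg_ring_def using subcringI'[OF subring_B] by (simp add: subcring_iff)
qed

lemma alg_ring_simps [simp]:
  "carrier (alg_ring R) = R" "p \<oplus>\<^bsub>alg_ring R\<^esub> q = p + q" "p \<otimes>\<^bsub>alg_ring R\<^esub> q = p * q"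
  "\<one>\<^bsub>alg_ring R\<^esub> = 1" "\<zero>\<^bsub>alg_ring R\<^esub> = 0"
  by (simp_all add: alg_ring_def ring_of_type_algebra_def)

lemma free_module_simps [simp]:
  "p \<oplus>\<^bsub>free_module B d S\<^esub> q = p + q" "\<zero>\<^bsub>free_module B d S\<^esub> = 0" "b \<odot>\<^bsub>free_module B d S\<^esub> q = free_smult b q"
  by (simp_all add: free_module_def)

lemma free_carrier_iff: "q \<in> carrier (free_module B d S) \<longleftrightarrow>
    Poly_Mapping.keys q \<subseteq> oi_hom (oi_interval d) S \<and> (\<forall>\<pi>. Poly_Mapping.lookup q \<pi> \<in> B S)"
  by (simp add: free_module_def)

lemma free_smult_closed:
  assumes "b \<in> B S" "q \<in> carrier (free_module B d S)"
  shows "free_smult b q \<in> carrier (free_module B d S)"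
  using assms keys_free_smult[of b q] by (auto simp: free_carrier_iff B_mult)

lemma free_map_closed:
  assumes \<epsilon>: "\<epsilon> \<in> oi_hom S T" and q: "q \<in> carrier (free_module B d S)"
  shows "free_map d S T \<epsilon> q \<in> carrier (free_module B d T)"
proof -
  have q': "Poly_Mapping.keys q \<subseteq> oi_hom (oi_interval d) S" "\<And>\<pi>. Poly_Mapping.lookup q \<pi> \<in> B S"
    using q by (auto simp: free_carrier_iff)
  have keys: "Poly_Mapping.keys (free_map d S T \<epsilon> q) \<subseteq> compose {1..d} \<epsilon> ` oi_hom (oi_interval d) S"
    using keys_free_map[of d S T \<epsilon> q] q'(1) by blast
  have "Poly_Mapping.lookup (free_map d S T \<epsilon> q) \<rho> \<in> B T" for \<rho>
  proof (cases "\<rho> \<in> Poly_Mapping.keys (free_map d S T \<epsilon> q)")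
    case True
    then obtain \<pi> where "\<pi> \<in> oi_hom (oi_interval d) S" "\<rho> = compose {1..d} \<epsilon> \<pi>" using keys by blast
    then show ?thesis using lookup_free_map[OF \<epsilon> q'(1)] B_pol_map[OF \<epsilon> q'(2)] by simp
  qed (simp add: in_keys_iff)
  moreover have "compose {1..d} \<epsilon> ` oi_hom (oi_interval d) S \<subseteq> oi_hom (oi_interval d) T"
    using compose_oi_hom[of _ "oi_interval d" S \<epsilon> T] \<epsilon> by auto
  ultimately show ?thesis using keys unfolding free_carrier_iff by blast
qed

lemma free_module_module: "module (alg_ring (B S)) (free_module B d S)"
proof (rule moduleI[OF cring_alg_ring])
  show "abelian_group (free_module B d S)"
  proof (rule abelian_groupI)
    fix p q assume p: "p \<in> carrier (free_module B d S)" and q: "q \<in> carrier (free_module B d S)"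
    show "p \<oplus>\<^bsub>free_module B d S\<^esub> q \<in> carrier (free_module B d S)"
      using p q keys_add[of p q] by (auto simp: free_carrier_iff lookup_add B_add)
    show "\<exists>y\<in>carrier (free_module B d S). y \<oplus>\<^bsub>free_module B d S\<^esub> p = \<zero>\<^bsub>free_module B d S\<^esub>"
      using p by (intro bexI[of _ "- p"]) (auto simp: free_carrier_iff B_uminus in_keys_iff)
  qed (auto simp: free_carrier_iff add.assoc add.commute)
next
  fix b q assume "b \<in> carrier (alg_ring (B S))" "q \<in> carrier (free_module B d S)"
  then show "b \<odot>\<^bsub>free_module B d S\<^esub> q \<in> carrier (free_module B d S)"
    by (simp add: free_smult_closed)
qed (auto simp: free_carrier_iff in_keys_iff B_mult lookup_add distrib_left distrib_right mult.assoc
      intro!: poly_mapping_eqI[of "free_smult _ _"])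

lemma free_submodule_iff:
  "submodule H (alg_ring (B S)) (free_module B d S) \<longleftrightarrow>
     H \<subseteq> carrier (free_module B d S) \<and> 0 \<in> H \<and> (\<forall>p\<in>H. \<forall>q\<in>H. p + q \<in> H) \<and>
     (\<forall>b\<in>B S. \<forall>q\<in>H. free_smult b q \<in> H)"
  by (simp add: submodule_iff[OF free_module_module])

lemma free_oi_submoduleD:
  assumes "oi_submodule B (free_module B d) (free_map d) N"
  shows sub_carrier: "\<And>S q. q \<in> N S \<Longrightarrow> q \<in> carrier (free_module B d S)"
    and sub_zero: "\<And>S. 0 \<in> N S"
    and sub_add: "\<And>S p q. p \<in> N S \<Longrightarrow> q \<in> N S \<Longrightarrow> p + q \<in> N S"
    and sub_smult: "\<And>S b q. b \<in> B S \<Longrightarrow> q \<in> N S \<Longrightarrow> free_smult b q \<in> N S"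
    and sub_map: "\<And>S T \<epsilon> q. \<epsilon> \<in> oi_hom S T \<Longrightarrow> q \<in> N S \<Longrightarrow> free_map d S T \<epsilon> q \<in> N T"
  using assms unfolding oi_submodule_def free_submodule_iff by blast+

lemma carrier_idx:
  assumes "q \<in> carrier (free_module B d (oi_interval m))" "coef q \<pi> a \<noteq> 0"
  shows "(m, \<pi>, a) \<in> idx d"
proof -
  have "\<pi> \<in> Poly_Mapping.keys q" "a \<in> Poly_Mapping.keys (Poly_Mapping.lookup q \<pi>)"
    using assms(2) by (auto simp: in_keys_iff)
  then show ?thesis
    using assms(1) B_monomials[of "Poly_Mapping.lookup q \<pi>" "oi_interval m" a] by (auto simp: free_carrier_iff idx_def)
qed

text \<open>
  The operation \<open>q \<mapsto> x\<^sup>\<kappa> F(\<epsilon>)(q)\<close>, which realises divisibility of monomials on elements. It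
  moves coefficients along an injection of monomials (\<open>coef_shift\<close>, \<open>coef_shift_nonzero\<close>).
\<close>

definition shift :: "nat \<Rightarrow> nat \<Rightarrow> nat \<Rightarrow> (nat \<Rightarrow> nat) \<Rightarrow> expo \<Rightarrow> 'k fvec \<Rightarrow> 'k fvec" where
  "shift d m n \<epsilon> \<kappa> q =
     free_smult (Poly_Mapping.single \<kappa> 1) (free_map d (oi_interval m) (oi_interval n) \<epsilon> q)"

lemma idx_shift:
  assumes "(m, \<pi>, a) \<in> idx d" "\<epsilon> \<in> oi_hom (oi_interval m) (oi_interval n)"
    "Poly_Mapping.single \<kappa> (1::'k) \<in> B (oi_interval n)"
  shows "(n, compose {1..d} \<epsilon> \<pi>, \<kappa> + expo_map \<epsilon> a) \<in> idx d"
proof -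
  have "Poly_Mapping.single \<kappa> 1 * pol_map \<epsilon> (Poly_Mapping.single a (1::'k)) \<in> B (oi_interval n)"
    using assms by (intro B_mult B_pol_map) (auto simp: idx_def)
  then show ?thesis
    using assms compose_oi_hom[of \<pi> "oi_interval d" "oi_interval m" \<epsilon> "oi_interval n"]
    by (simp add: idx_def mult_single)
qed

lemma coef_shift:
  assumes q: "q \<in> carrier (free_module B d (oi_interval m))" and idx: "(m, \<pi>, a) \<in> idx d"
    and \<epsilon>: "\<epsilon> \<in> oi_hom (oi_interval m) (oi_interval n)"
  shows "coef (shift d m n \<epsilon> \<kappa> q) (compose {1..d} \<epsilon> \<pi>) (\<kappa> + expo_map \<epsilon> a) = coef q \<pi> a"
proof -
  have "insert a (Poly_Mapping.keys (Poly_Mapping.lookup q \<pi>)) \<subseteq>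
      {a. Poly_Mapping.keys a \<subseteq> UNIV \<times> fset (oi_interval m)}"
  proof -
    have "Poly_Mapping.keys b \<subseteq> UNIV \<times> fset (oi_interval m)"
      if "Poly_Mapping.single b (1::'k) \<in> B (oi_interval m) \<or> b \<in> Poly_Mapping.keys (Poly_Mapping.lookup q \<pi>)" for b
      using that B_single_keys[of b "oi_interval m"] B_keys[of "Poly_Mapping.lookup q \<pi>" "oi_interval m" b] q
      by (auto simp: free_carrier_iff)
    then show ?thesis using idx by (auto simp: idx_def)
  qed
  then have "inj_on (expo_map \<epsilon>) (insert a (Poly_Mapping.keys (Poly_Mapping.lookup q \<pi>)))"
    by (rule inj_on_subset[OF expo_map_inj[OF \<epsilon>]])
  then show ?thesis
    using q idx lookup_free_map[OF \<epsilon>, of q d \<pi>]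
    by (simp add: shift_def lookup_single_mult lookup_pol_map free_carrier_iff idx_def)
qed

lemma coef_shift_nonzero:
  assumes q: "q \<in> carrier (free_module B d (oi_interval m))"
    and \<epsilon>: "\<epsilon> \<in> oi_hom (oi_interval m) (oi_interval n)"
    and nz: "coef (shift d m n \<epsilon> \<kappa> q) \<rho> b \<noteq> 0"
  obtains \<pi> a where "coef q \<pi> a \<noteq> 0" "\<rho> = compose {1..d} \<epsilon> \<pi>" "b = \<kappa> + expo_map \<epsilon> a"
proof -
  let ?f = "free_map d (oi_interval m) (oi_interval n) \<epsilon> q"
  have b: "b \<in> Poly_Mapping.keys (Poly_Mapping.single \<kappa> 1 * Poly_Mapping.lookup ?f \<rho>)"
    using nz by (simp add: shift_def in_keys_iff)
  then have "Poly_Mapping.lookup ?f \<rho> \<noteq> 0" by auto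
  then have "\<rho> \<in> Poly_Mapping.keys ?f" by (simp add: in_keys_iff)
  then obtain \<pi> where \<pi>: "\<pi> \<in> Poly_Mapping.keys q" "\<rho> = compose {1..d} \<epsilon> \<pi>"
    using keys_free_map[of d "oi_interval m" "oi_interval n" \<epsilon> q] by blast
  then have "Poly_Mapping.lookup ?f \<rho> = pol_map \<epsilon> (Poly_Mapping.lookup q \<pi>)"
    using q by (auto simp: free_carrier_iff intro!: lookup_free_map[OF \<epsilon>, simplified])
  with b obtain b' where "b' \<in> Poly_Mapping.keys (pol_map \<epsilon> (Poly_Mapping.lookup q \<pi>))" "b = \<kappa> + b'"
    using keys_single_mult by fastforce
  then obtain a where "a \<in> Poly_Mapping.keys (Poly_Mapping.lookup q \<pi>)" "b = \<kappa> + expo_map \<epsilon> a"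
    using keys_pol_map by blast
  then show thesis using that \<pi>(2) by (simp add: in_keys_iff)
qed

lemma shift_closed:
  assumes "oi_submodule B (free_module B d) (free_map d) N" "q \<in> N (oi_interval m)"
    "\<epsilon> \<in> oi_hom (oi_interval m) (oi_interval n)" "Poly_Mapping.single \<kappa> (1::'k) \<in> B (oi_interval n)"
  shows "shift d m n \<epsilon> \<kappa> q \<in> N (oi_interval n)"
  unfolding shift_def using assms by (intro sub_smult[OF assms(1)] sub_map[OF assms(1)])


section \<open>Coefficient systems of submodules\<close>

definition term_ideals :: "(nat fset \<Rightarrow> 'k fvec set) \<Rightarrow> nat \<times> (nat \<Rightarrow> nat) \<times> expo \<Rightarrow> 'k set" where
  "term_ideals N = (\<lambda>(m, \<pi>, a). {k. Poly_Mapping.single \<pi> (Poly_Mapping.single a k) \<in> N (oi_interval m)})"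

text \<open>
  The part of the definition of a monomial order that only compares monomials of equal width and
  says that \<open>shift\<close> is strictly monotone. It is shared by all monomial orders and the concrete order
  \<open>marked_order\<close> used for generation.
\<close>

definition term_order :: "nat \<Rightarrow> (nat \<Rightarrow> ((nat \<Rightarrow> nat) \<times> expo) rel) \<Rightarrow> bool" where
  "term_order d gt \<longleftrightarrow>
     (\<forall>m. strict_linear_order_on {x. (m, x) \<in> idx d} (gt m)) \<and>
     (\<forall>m n \<pi> a \<rho> b \<epsilon> \<kappa>. (m, \<pi>, a) \<in> idx d \<and> (m, \<rho>, b) \<in> idx d \<and> ((\<pi>, a), (\<rho>, b)) \<in> gt m \<and>
        \<epsilon> \<in> oi_hom (oi_interval m) (oi_interval n) \<and> Poly_Mapping.single \<kappa> (1::'k) \<in> B (oi_interval n) \<longrightarrow>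
        ((compose {1..d} \<epsilon> \<pi>, \<kappa> + expo_map \<epsilon> a), (compose {1..d} \<epsilon> \<rho>, \<kappa> + expo_map \<epsilon> b)) \<in> gt n)"

definition dominates :: "((nat \<Rightarrow> nat) \<times> expo) rel \<Rightarrow> (nat \<Rightarrow> nat) \<times> expo \<Rightarrow> 'k fvec \<Rightarrow> bool" where
  "dominates r x q \<longleftrightarrow> (\<forall>\<rho> b. coef q \<rho> b \<noteq> 0 \<and> (\<rho>, b) \<noteq> x \<longrightarrow> (x, (\<rho>, b)) \<in> r)"

text \<open>
  An element may have coefficient \<open>0\<close> at \<open>x\<close> as long as all its other monomials are smaller
  than \<open>x\<close>; so these sets are closed under addition, without exception for cancelling leading terms.
\<close>

definition lead_ideals ::
    "(nat \<Rightarrow> ((nat \<Rightarrow> nat) \<times> expo) rel) \<Rightarrow> (nat fset \<Rightarrow> 'k fvec set) \<Rightarrow> nat \<times> (nat \<Rightarrow> nat) \<times> expo \<Rightarrow> 'k set" where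
  "lead_ideals gt N = (\<lambda>(m, \<pi>, a). {coef q \<pi> a | q. q \<in> N (oi_interval m) \<and> dominates (gt m) (\<pi>, a) q})"

lemma coeff_system_term_ideals:
  assumes N: "oi_submodule B (free_module B d) (free_map d) N"
  shows "coeff_system d (term_ideals N)"
  unfolding coeff_system_def
proof (intro conjI ballI impI)
  fix x assume "x \<in> idx d"
  obtain m \<pi> a where x: "x = (m, \<pi>, a)" by (cases x)
  have "Poly_Mapping.single \<pi> (Poly_Mapping.single a (k + l)) \<in> N (oi_interval m)"
    if "Poly_Mapping.single \<pi> (Poly_Mapping.single a k) \<in> N (oi_interval m)"
      "Poly_Mapping.single \<pi> (Poly_Mapping.single a l) \<in> N (oi_interval m)" for k l
    using sub_add[OF N that] by (simp add: single_add)
  moreover have "Poly_Mapping.single \<pi> (Poly_Mapping.single a (r * k)) \<in> N (oi_interval m)"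
    if "Poly_Mapping.single \<pi> (Poly_Mapping.single a k) \<in> N (oi_interval m)" for r k
    using sub_smult[OF N B_const that, of r] by (simp add: pol_const_def mult_single)
  ultimately show "ideal (term_ideals N x) ring_of_type_algebra"
    using sub_zero[OF N] by (simp add: ideal_type_ring_iff term_ideals_def x)
next
  fix x y assume "mono_dvd d x y"
  then obtain m \<pi> a n \<epsilon> \<kappa> where x: "x = (m, \<pi>, a)" and y: "y = (n, compose {1..d} \<epsilon> \<pi>, \<kappa> + expo_map \<epsilon> a)"
    and \<epsilon>: "\<epsilon> \<in> oi_hom (oi_interval m) (oi_interval n)" and \<kappa>: "Poly_Mapping.single \<kappa> (1::'k) \<in> B (oi_interval n)"
    by (auto simp: mono_dvd_def)
  show "term_ideals N x \<subseteq> term_ideals N y"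
  proof
    fix k assume "k \<in> term_ideals N x"
    then show "k \<in> term_ideals N y"
      using shift_closed[OF N _ \<epsilon> \<kappa>, of "Poly_Mapping.single \<pi> (Poly_Mapping.single a k)"]
      by (simp add: term_ideals_def x y shift_def mult_single)
  qed
qed

lemma coeff_system_lead_ideals:
  assumes N: "oi_submodule B (free_module B d) (free_map d) N" and gt: "term_order d gt"
  shows "coeff_system d (lead_ideals gt N)"
  unfolding coeff_system_def
proof (intro conjI ballI impI)
  fix x assume "x \<in> idx d"
  obtain m \<pi> a where x: "x = (m, \<pi>, a)" by (cases x)
  show "ideal (lead_ideals gt N x) ring_of_type_algebra"
    unfolding ideal_type_ring_iff
  proof (intro conjI ballI allI)
    show "0 \<in> lead_ideals gt N x"
      using sub_zero[OF N] by (auto simp: lead_ideals_def x dominates_def intro!: exI[of _ 0])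
  next
    fix k l assume "k \<in> lead_ideals gt N x" "l \<in> lead_ideals gt N x"
    then obtain p q where pq: "p \<in> N (oi_interval m)" "dominates (gt m) (\<pi>, a) p" "k = coef p \<pi> a"
      "q \<in> N (oi_interval m)" "dominates (gt m) (\<pi>, a) q" "l = coef q \<pi> a"
      by (auto simp: lead_ideals_def x)
    moreover have "coef p \<rho> b \<noteq> 0 \<or> coef q \<rho> b \<noteq> 0" if "coef (p + q) \<rho> b \<noteq> 0" for \<rho> b
      using that by (auto simp: lookup_add)
    ultimately have "dominates (gt m) (\<pi>, a) (p + q)" unfolding dominates_def by blast
    then show "k + l \<in> lead_ideals gt N x"
      using pq sub_add[OF N, of p _ q] by (auto simp: lead_ideals_def x lookup_add intro!: exI[of _ "p + q"])
  next
    fix r k assume "k \<in> lead_ideals gt N x"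
    then obtain p where p: "p \<in> N (oi_interval m)" "dominates (gt m) (\<pi>, a) p" "k = coef p \<pi> a"
      by (auto simp: lead_ideals_def x)
    moreover have "coef p \<rho> b \<noteq> 0" if "coef (free_smult (pol_const r) p) \<rho> b \<noteq> 0" for \<rho> b
      using that by (intro notI) (simp add: lookup_const_mult)
    ultimately have "dominates (gt m) (\<pi>, a) (free_smult (pol_const r) p)"
      unfolding dominates_def by blast
    with p show "r * k \<in> lead_ideals gt N x"
      using p sub_smult[OF N B_const, of p _ r]
      by (auto simp: lead_ideals_def x lookup_const_mult intro!: exI[of _ "free_smult (pol_const r) p"])
  qed
next
  fix x y assume xidx: "x \<in> idx d" and "mono_dvd d x y"
  then obtain m \<pi> a n \<epsilon> \<kappa> where x: "x = (m, \<pi>, a)" and y: "y = (n, compose {1..d} \<epsilon> \<pi>, \<kappa> + expo_map \<epsilon> a)"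
    and \<epsilon>: "\<epsilon> \<in> oi_hom (oi_interval m) (oi_interval n)" and \<kappa>: "Poly_Mapping.single \<kappa> (1::'k) \<in> B (oi_interval n)"
    by (auto simp: mono_dvd_def)
  show "lead_ideals gt N x \<subseteq> lead_ideals gt N y"
  proof
    fix k assume "k \<in> lead_ideals gt N x"
    then obtain q where q: "q \<in> N (oi_interval m)" "dominates (gt m) (\<pi>, a) q" "k = coef q \<pi> a"
      by (auto simp: lead_ideals_def x)
    let ?q = "shift d m n \<epsilon> \<kappa> q"
    have carr: "q \<in> carrier (free_module B d (oi_interval m))" using sub_carrier[OF N q(1)] .
    have "coef ?q (compose {1..d} \<epsilon> \<pi>) (\<kappa> + expo_map \<epsilon> a) = k"
      using coef_shift[OF carr _ \<epsilon>] xidx by (simp add: x q(3))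
    moreover have "dominates (gt n) (compose {1..d} \<epsilon> \<pi>, \<kappa> + expo_map \<epsilon> a) ?q"
      unfolding dominates_def
    proof (intro allI impI, elim conjE)
      fix \<rho> b assume "coef ?q \<rho> b \<noteq> 0" and ne: "(\<rho>, b) \<noteq> (compose {1..d} \<epsilon> \<pi>, \<kappa> + expo_map \<epsilon> a)"
      then obtain \<rho>' b' where *: "coef q \<rho>' b' \<noteq> 0" "\<rho> = compose {1..d} \<epsilon> \<rho>'" "b = \<kappa> + expo_map \<epsilon> b'"
        using coef_shift_nonzero[OF carr \<epsilon>] by blast
      with ne have "((\<pi>, a), (\<rho>', b')) \<in> gt m" using q(2) by (auto simp: dominates_def)
      moreover have "(m, \<rho>', b') \<in> idx d" using carrier_idx[OF carr *(1)] .
      ultimately show "((compose {1..d} \<epsilon> \<pi>, \<kappa> + expo_map \<epsilon> a), (\<rho>, b)) \<in> gt n"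
        using gt xidx \<epsilon> \<kappa> * unfolding term_order_def x by blast
    qed
    ultimately show "k \<in> lead_ideals gt N y"
      using shift_closed[OF N q(1) \<epsilon> \<kappa>] by (force simp: lead_ideals_def y)
  qed
qed

lemma finite_support: "finite {(\<pi>, a). coef q \<pi> a \<noteq> 0}"
proof (rule finite_subset)
  show "{(\<pi>, a). coef q \<pi> a \<noteq> 0} \<subseteq> (SIGMA \<pi>:Poly_Mapping.keys q. Poly_Mapping.keys (Poly_Mapping.lookup q \<pi>))"
    by (auto simp: in_keys_iff)
qed auto

lemma leading_index:
  assumes gt: "term_order d gt" and q: "q \<in> carrier (free_module B d (oi_interval m))" and nz: "q \<noteq> 0"
  obtains \<pi> a where "(m, \<pi>, a) \<in> idx d" "coef q \<pi> a \<noteq> 0" "dominates (gt m) (\<pi>, a) q"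
proof -
  have "{(\<pi>, a). coef q \<pi> a \<noteq> 0} \<noteq> {}"
    using nz by (auto intro!: poly_mapping_eqI)
  then have "\<exists>x\<in>{(\<pi>, a). coef q \<pi> a \<noteq> 0}. \<forall>y\<in>{(\<pi>, a). coef q \<pi> a \<noteq> 0}. y \<noteq> x \<longrightarrow> (x, y) \<in> gt m"
    using gt carrier_idx[OF q] finite_support[of q]
    by (intro strict_linear_order_max[of "{x. (m, x) \<in> idx d}"]) (auto simp: term_order_def)
  then show thesis using that carrier_idx[OF q] by (fastforce simp: dominates_def)
qed

section \<open>Finite Groebner bases\<close>

definition free_mono :: "(nat \<Rightarrow> nat) \<Rightarrow> expo \<Rightarrow> 'k fvec" where
  "free_mono \<pi> a = Poly_Mapping.single \<pi> (Poly_Mapping.single a 1)"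

lemma free_monomials_iff: "\<mu> \<in> free_monomials B d m \<longleftrightarrow> (\<exists>\<pi> a. \<mu> = free_mono \<pi> a \<and> (m, \<pi>, a) \<in> idx d)"
  by (auto simp: free_monomials_def free_mono_def idx_def pol_monomials_def)

lemma free_coeff_mono [simp]: "free_coeff q (free_mono \<pi> a) = coef q \<pi> a"
  by (simp add: free_mono_def free_coeff_monomial)

lemma mono_eq_iff [simp]: "free_mono \<pi> a = free_mono \<rho> b \<longleftrightarrow> \<pi> = \<rho> \<and> a = b"
proof
  assume eq: "free_mono \<pi> a = free_mono \<rho> b"
  have "coef (free_mono \<pi> a) \<pi> a = 1" by (simp add: free_mono_def)
  then have "coef (free_mono \<rho> b) \<pi> a = 1" by (simp add: eq)
  then show "\<pi> = \<rho> \<and> a = b" by (auto simp: free_mono_def lookup_single when_def split: if_splits)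
qed simp

definition order_at :: "(nat \<times> 'k fvec) rel \<Rightarrow> nat \<Rightarrow> ((nat \<Rightarrow> nat) \<times> expo) rel" where
  "order_at gt m = {((\<pi>, a), (\<rho>, b)). ((m, free_mono \<pi> a), (m, free_mono \<rho> b)) \<in> gt}"

lemma order_at_iff: "((\<pi>, a), (\<rho>, b)) \<in> order_at gt m \<longleftrightarrow> ((m, free_mono \<pi> a), (m, free_mono \<rho> b)) \<in> gt"
  by (simp add: order_at_def)

text \<open>
  Multiplication by \<open>x\<^sup>\<kappa>\<close> is covered by the definition of a monomial order for \<open>\<kappa> \<noteq> 0\<close> only, hence the
  case distinction at the end.
\<close>

lemma term_order_order_at:
  assumes "monomial_order B d gt"
  shows "term_order d (order_at gt)"
  unfolding term_order_def
proof (intro conjI allI impI)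
  fix m
  have lin: "strict_linear_order_on (SIGMA m:UNIV. free_monomials B d m) gt"
    using assms by (simp add: monomial_order_def)
  then have trans: "trans gt" and irr: "irrefl gt" and tot: "total_on (SIGMA m:UNIV. free_monomials B d m) gt"
    by (auto simp: strict_linear_order_on_def)
  show "strict_linear_order_on {x. (m, x) \<in> idx d} (order_at gt m)"
    unfolding strict_linear_order_on_def
  proof (intro conjI)
    show "trans (order_at gt m)"
    proof (rule transI)
      fix x y z assume "(x, y) \<in> order_at gt m" "(y, z) \<in> order_at gt m"
      then show "(x, z) \<in> order_at gt m"
        by (cases x, cases y, cases z) (auto simp: order_at_iff intro: transD[OF trans])
    qed
    show "irrefl (order_at gt m)"
      using irr by (auto simp: irrefl_def order_at_def)
    show "total_on {x. (m, x) \<in> idx d} (order_at gt m)"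
    proof (rule total_onI)
      fix x y assume xy: "x \<in> {x. (m, x) \<in> idx d}" "y \<in> {x. (m, x) \<in> idx d}" "x \<noteq> y"
      obtain \<pi> a \<rho> b where x: "x = (\<pi>, a)" and y: "y = (\<rho>, b)" by (cases x, cases y)
      have "(m, free_mono \<pi> a) \<in> (SIGMA m:UNIV. free_monomials B d m)" "(m, free_mono \<rho> b) \<in> (SIGMA m:UNIV. free_monomials B d m)"
        using xy x y by (auto simp: free_monomials_iff)
      moreover have "(m, free_mono \<pi> a) \<noteq> (m, free_mono \<rho> b)" using xy x y by auto
      ultimately have "((m, free_mono \<pi> a), (m, free_mono \<rho> b)) \<in> gt \<or> ((m, free_mono \<rho> b), (m, free_mono \<pi> a)) \<in> gt"
        using tot unfolding total_on_def by (metis (no_types))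
      then show "(x, y) \<in> order_at gt m \<or> (y, x) \<in> order_at gt m" by (simp add: x y order_at_iff)
    qed
  qed
next
  fix m n \<pi> a \<rho> b \<epsilon> \<kappa>
  assume *: "(m, \<pi>, a) \<in> idx d \<and> (m, \<rho>, b) \<in> idx d \<and> ((\<pi>, a), (\<rho>, b)) \<in> order_at gt m \<and>
    \<epsilon> \<in> oi_hom (oi_interval m) (oi_interval n) \<and> Poly_Mapping.single \<kappa> (1::'k) \<in> B (oi_interval n)"
  let ?s = "\<lambda>\<pi> a. free_mono (compose {1..d} \<epsilon> \<pi>) (expo_map \<epsilon> a)"
  have map: "free_map d (oi_interval m) (oi_interval n) \<epsilon> (free_mono \<sigma> e) = ?s \<sigma> e" for \<sigma> e
    by (simp add: free_mono_def)
  have mul: "free_smult (Poly_Mapping.single \<kappa> 1) (free_mono \<sigma> e) = free_mono \<sigma> (\<kappa> + e)" for \<sigma> e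
    by (simp add: free_mono_def mult_single)
  have mem: "free_mono \<pi> a \<in> free_monomials B d m" "free_mono \<rho> b \<in> free_monomials B d m"
    using * by (auto simp: free_monomials_iff)
  have "(n, compose {1..d} \<epsilon> \<pi>, 0 + expo_map \<epsilon> a) \<in> idx d" "(n, compose {1..d} \<epsilon> \<rho>, 0 + expo_map \<epsilon> b) \<in> idx d"
    using * idx_shift[of m \<pi> a d \<epsilon> n 0] idx_shift[of m \<rho> b d \<epsilon> n 0] by simp_all
  then have mem': "?s \<pi> a \<in> free_monomials B d n" "?s \<rho> b \<in> free_monomials B d n"
    by (auto simp: free_monomials_iff)
  have "((n, ?s \<pi> a), (n, ?s \<rho> b)) \<in> gt"
    using assms mem * unfolding monomial_order_def order_at_iff map[symmetric] by blast
  moreover have "((n, free_mono (compose {1..d} \<epsilon> \<pi>) (\<kappa> + expo_map \<epsilon> a)), (n, free_mono (compose {1..d} \<epsilon> \<rho>) (\<kappa> + expo_map \<epsilon> b))) \<in> gt"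
    if gt: "((n, ?s \<pi> a), (n, ?s \<rho> b)) \<in> gt" "\<kappa> \<noteq> 0"
  proof -
    have "Poly_Mapping.single \<kappa> (1::'k) \<in> pol_monomials B n" using * by (auto simp: pol_monomials_def)
    moreover have "Poly_Mapping.single \<kappa> (1::'k) \<noteq> 1"
      using \<open>\<kappa> \<noteq> 0\<close> by (metis lookup_one lookup_single_eq when_def zero_neq_one)
    ultimately show ?thesis
      using assms mem' gt(1) unfolding monomial_order_def mul[symmetric] by blast
  qed
  ultimately show "((compose {1..d} \<epsilon> \<pi>, \<kappa> + expo_map \<epsilon> a), (compose {1..d} \<epsilon> \<rho>, \<kappa> + expo_map \<epsilon> b)) \<in> order_at gt n"
    unfolding order_at_iff by (cases "\<kappa> = 0") auto
qed

lemma lead_term_eq: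
  assumes gt: "monomial_order B d gt" and idx: "(m, \<pi>, a) \<in> idx d" and nz: "coef q \<pi> a \<noteq> 0"
    and dom: "dominates (order_at gt m) (\<pi>, a) q"
  shows "lead_term B d gt m q = Poly_Mapping.single \<pi> (Poly_Mapping.single a (coef q \<pi> a))"
proof -
  have lin: "trans gt" "irrefl gt"
    using gt by (auto simp: monomial_order_def strict_linear_order_on_def)
  have "lead_mon B d gt m q = free_mono \<pi> a"
    unfolding lead_mon_def
  proof (rule the_equality)
    show "free_mono \<pi> a \<in> free_monomials B d m \<and> free_coeff q (free_mono \<pi> a) \<noteq> 0 \<and>
      (\<forall>\<nu>\<in>free_monomials B d m. free_coeff q \<nu> \<noteq> 0 \<and> \<nu> \<noteq> free_mono \<pi> a \<longrightarrow> ((m, free_mono \<pi> a), (m, \<nu>)) \<in> gt)"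
      using idx nz dom by (auto simp: free_monomials_iff dominates_def order_at_iff)
  next
    fix \<mu> assume \<mu>: "\<mu> \<in> free_monomials B d m \<and> free_coeff q \<mu> \<noteq> 0 \<and>
      (\<forall>\<nu>\<in>free_monomials B d m. free_coeff q \<nu> \<noteq> 0 \<and> \<nu> \<noteq> \<mu> \<longrightarrow> ((m, \<mu>), (m, \<nu>)) \<in> gt)"
    then obtain \<rho> b where \<rho>: "\<mu> = free_mono \<rho> b" "coef q \<rho> b \<noteq> 0" by (auto simp: free_monomials_iff)
    show "\<mu> = free_mono \<pi> a"
    proof (rule ccontr)
      assume ne: "\<mu> \<noteq> free_mono \<pi> a"
      then have "((m, \<mu>), (m, free_mono \<pi> a)) \<in> gt"
        using \<mu> idx nz by (auto simp: free_monomials_iff)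
      moreover have "((m, free_mono \<pi> a), (m, \<mu>)) \<in> gt"
        using dom \<rho> ne by (auto simp: dominates_def order_at_iff)
      ultimately show False using lin by (meson irrefl_def transD)
    qed
  qed
  then show ?thesis
    by (simp add: lead_term_def free_mono_def free_coeff_monomial pol_const_def mult_single)
qed

text \<open>
  Every condition \<open>k \<in> lead_ideals gt N x\<close> is witnessed by an element \<open>q\<close> of \<open>N\<close>, so the finitely many
  conditions of \<open>coeff_system_finite\<close> may be replaced by finitely many elements.
\<close>

lemma lead_ideals_finite_generation:
  assumes N: "oi_submodule B (free_module B d) (free_map d) N" and gt: "term_order d gt"
  obtains E where "finite E" "\<And>m \<pi> a q. (m, \<pi>, a, q) \<in> E \<Longrightarrow>
      (m, \<pi>, a) \<in> idx d \<and> q \<in> N (oi_interval m) \<and> dominates (gt m) (\<pi>, a) q"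
    and "\<And>I m \<pi> a q. coeff_system d I \<Longrightarrow> (\<And>m \<pi> a q. (m, \<pi>, a, q) \<in> E \<Longrightarrow> coef q \<pi> a \<in> I (m, \<pi>, a)) \<Longrightarrow>
      (m, \<pi>, a) \<in> idx d \<Longrightarrow> q \<in> N (oi_interval m) \<Longrightarrow> dominates (gt m) (\<pi>, a) q \<Longrightarrow> coef q \<pi> a \<in> I (m, \<pi>, a)"
proof -
  let ?Q = "{(m, \<pi>, a, q). (m, \<pi>, a) \<in> idx d \<and> q \<in> N (oi_interval m) \<and> dominates (gt m) (\<pi>, a) q}"
  let ?f = "\<lambda>(m, \<pi>, a, q). ((m, \<pi>, a), coef q \<pi> a)"
  have "?f ` ?Q \<subseteq> idx d \<times> UNIV" by auto
  then obtain E0 where E0: "finite E0" "E0 \<subseteq> ?f ` ?Q"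
    "\<And>I x k. coeff_system d I \<Longrightarrow> (\<And>x k. (x, k) \<in> E0 \<Longrightarrow> k \<in> I x) \<Longrightarrow> (x, k) \<in> ?f ` ?Q \<Longrightarrow> k \<in> I x"
    by (rule coeff_system_finite) blast
  obtain E where E: "finite E" "E \<subseteq> ?Q" "E0 = ?f ` E"
    using finite_subset_image[OF E0(1,2)] by blast
  show thesis
  proof (rule that[of E])
    show "finite E" by fact
    show "(m, \<pi>, a) \<in> idx d \<and> q \<in> N (oi_interval m) \<and> dominates (gt m) (\<pi>, a) q" if "(m, \<pi>, a, q) \<in> E" for m \<pi> a q
      using E(2) that by blast
    show "coef q \<pi> a \<in> I (m, \<pi>, a)"
      if I: "coeff_system d I" "\<And>m \<pi> a q. (m, \<pi>, a, q) \<in> E \<Longrightarrow> coef q \<pi> a \<in> I (m, \<pi>, a)"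
        and q: "(m, \<pi>, a) \<in> idx d" "q \<in> N (oi_interval m)" "dominates (gt m) (\<pi>, a) q" for I m \<pi> a q
    proof (rule E0(3)[OF I(1)])
      show "k \<in> I x" if "(x, k) \<in> E0" for x k using that E(3) I(2) by auto
      show "((m, \<pi>, a), coef q \<pi> a) \<in> ?f ` ?Q" by (rule image_eqI[of _ _ "(m, \<pi>, a, q)"]) (use q in auto)
    qed
  qed
qed

text \<open>
  Equality of the two spans means that the same submodules contain the two sets of leading terms.
  For a submodule \<open>N'\<close> containing the leading terms of \<open>G\<close>, the system \<open>term_ideals N'\<close> satisfies
  the finitely many chosen conditions, hence contains every leading coefficient of \<open>N\<close>.
\<close>

theorem finite_groebner_basis:
  assumes N: "oi_submodule B (free_module B d) (free_map d) N" and gt: "monomial_order B d gt"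
  shows "\<exists>G. finite G \<and> groebner_basis B d gt N G"
proof -
  note ord = term_order_order_at[OF gt]
  obtain E where E: "finite E" "\<And>m \<pi> a q. (m, \<pi>, a, q) \<in> E \<Longrightarrow>
      (m, \<pi>, a) \<in> idx d \<and> q \<in> N (oi_interval m) \<and> dominates (order_at gt m) (\<pi>, a) q"
    "\<And>I m \<pi> a q. coeff_system d I \<Longrightarrow> (\<And>m \<pi> a q. (m, \<pi>, a, q) \<in> E \<Longrightarrow> coef q \<pi> a \<in> I (m, \<pi>, a)) \<Longrightarrow>
      (m, \<pi>, a) \<in> idx d \<Longrightarrow> q \<in> N (oi_interval m) \<Longrightarrow> dominates (order_at gt m) (\<pi>, a) q \<Longrightarrow> coef q \<pi> a \<in> I (m, \<pi>, a)"
    by (rule lead_ideals_finite_generation[OF N ord]) blast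
  define G where "G = (\<lambda>(m, \<pi>, a, q). (m, q)) ` E"
  have G: "G \<subseteq> oi_coprod N" using E(2) by (auto simp: G_def oi_coprod_def)
  have "lead_terms B d gt (oi_coprod N) \<subseteq> oi_coprod N'"
    if N': "oi_submodule B (free_module B d) (free_map d) N'" and sub: "lead_terms B d gt G \<subseteq> oi_coprod N'" for N'
  proof -
    have gen: "coef q \<pi> a \<in> term_ideals N' (m, \<pi>, a)" if q: "(m, \<pi>, a, q) \<in> E" for m \<pi> a q
    proof (cases "coef q \<pi> a = 0")
      case True
      then show ?thesis using sub_zero[OF N'] by (simp add: term_ideals_def)
    next
      case False
      then have "q \<noteq> 0" "(m, q) \<in> G" using q by (force simp: G_def)+
      then have "(m, lead_term B d gt m q) \<in> oi_coprod N'" using sub by (auto simp: lead_terms_def)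
      then show ?thesis
        using lead_term_eq[OF gt _ False, of m] E(2)[OF q] by (simp add: oi_coprod_def term_ideals_def)
    qed
    show ?thesis
    proof
      fix y assume "y \<in> lead_terms B d gt (oi_coprod N)"
      then obtain m q where y: "y = (m, lead_term B d gt m q)" and q: "q \<in> N (oi_interval m)" "q \<noteq> 0"
        by (auto simp: lead_terms_def oi_coprod_def)
      obtain \<pi> a where \<pi>: "(m, \<pi>, a) \<in> idx d" "coef q \<pi> a \<noteq> 0" "dominates (order_at gt m) (\<pi>, a) q"
        using leading_index[OF ord sub_carrier[OF N q(1)] q(2)] by blast
      have "coef q \<pi> a \<in> term_ideals N' (m, \<pi>, a)"
        using E(3)[OF coeff_system_term_ideals[OF N'] gen \<pi>(1) q(1) \<pi>(3)] by blast
      then show "y \<in> oi_coprod N'"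
        using lead_term_eq[OF gt \<pi>] by (simp add: y oi_coprod_def term_ideals_def)
    qed
  qed
  moreover have "lead_terms B d gt G \<subseteq> lead_terms B d gt (oi_coprod N)"
    using G by (auto simp: lead_terms_def)
  ultimately have "oi_submodule B (free_module B d) (free_map d) N' \<and> lead_terms B d gt G \<subseteq> oi_coprod N' \<longleftrightarrow>
      oi_submodule B (free_module B d) (free_map d) N' \<and> lead_terms B d gt (oi_coprod N) \<subseteq> oi_coprod N'" for N'
    by blast
  then have "groebner_basis B d gt N G"
    using G by (simp add: groebner_basis_def oi_span_def)
  then show ?thesis using E(1) by (auto simp: G_def)
qed


section \<open>Free modules are noetherian\<close>

text \<open>
  A concrete term order, well-founded in each width by \<open>wf_expo_less\<close>: monomials are compared through
  their marked exponents.
\<close>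

definition marked_order :: "nat \<Rightarrow> nat \<Rightarrow> ((nat \<Rightarrow> nat) \<times> expo) rel" where
  "marked_order d m = {(x, y). marked d y < marked d x}"

lemma marked_inj:
  assumes "(m, x) \<in> idx d" "(m, y) \<in> idx d" "marked d x = marked d y"
  shows "x = y"
proof -
  obtain \<pi> a \<rho> b where x: "x = (\<pi>, a)" and y: "y = (\<rho>, b)" by (cases x, cases y)
  have "Poly_Mapping.keys a \<subseteq> {1..c} \<times> UNIV"
    using assms(1) B_single_keys[of a] by (force simp: x idx_def)
  then have "\<rho> = \<pi>"
    using assms by (intro marks_agree_if_multiple[of \<pi> d "oi_interval m" \<rho> a c b]) (auto simp: x y idx_def marked_def)
  then show ?thesis using assms(3) by (simp add: x y marked_def)
qed

lemma term_order_marked_order: "term_order d (marked_order d)"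
  unfolding term_order_def
proof (intro conjI allI impI)
  fix m
  show "strict_linear_order_on {x. (m, x) \<in> idx d} (marked_order d m)"
    unfolding strict_linear_order_on_def
  proof (intro conjI)
    show "total_on {x. (m, x) \<in> idx d} (marked_order d m)"
      using marked_inj by (intro total_onI) (auto simp: marked_order_def neq_iff simp del: split_paired_All)
  qed (auto simp: marked_order_def trans_def irrefl_def)
next
  fix m n \<pi> a \<rho> b \<epsilon> \<kappa>
  assume *: "(m, \<pi>, a) \<in> idx d \<and> (m, \<rho>, b) \<in> idx d \<and> ((\<pi>, a), (\<rho>, b)) \<in> marked_order d m \<and>
    \<epsilon> \<in> oi_hom (oi_interval m) (oi_interval n) \<and> Poly_Mapping.single \<kappa> (1::'k) \<in> B (oi_interval n)"
  then have \<epsilon>: "\<epsilon> \<in> oi_hom (oi_interval m) (oi_interval n)" by blast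
  have shifted: "marked d (compose {1..d} \<epsilon> \<sigma>, \<kappa> + expo_map \<epsilon> e) = \<kappa> + expo_map \<epsilon> (marked d (\<sigma>, e))" for \<sigma> e
    by (simp add: marked_def expo_map_add expo_map_mark add.assoc)
  have "Poly_Mapping.keys (marked d (\<pi>, a)) \<subseteq> UNIV \<times> {1..m}" "Poly_Mapping.keys (marked d (\<rho>, b)) \<subseteq> UNIV \<times> {1..m}"
    using * keys_marked by blast+
  then have "expo_map \<epsilon> (marked d (\<rho>, b)) < expo_map \<epsilon> (marked d (\<pi>, a))"
    using * by (intro expo_map_strict_mono[OF \<epsilon>]) (auto simp: marked_order_def)
  then show "((compose {1..d} \<epsilon> \<pi>, \<kappa> + expo_map \<epsilon> a), (compose {1..d} \<epsilon> \<rho>, \<kappa> + expo_map \<epsilon> b)) \<in> marked_order d n"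
    unfolding marked_order_def by (simp only: mem_Collect_eq case_prod_conv shifted add_strict_left_mono)
qed

text \<open>
  Division with remainder: subtracting from \<open>q\<close> an element of \<open>N'\<close> with the same leading term
  leaves an element of \<open>N\<close> whose leading monomial is smaller.
\<close>

lemma free_submodule_mem_if_leads:
  assumes N: "oi_submodule B (free_module B d) (free_map d) N"
    and N': "oi_submodule B (free_module B d) (free_map d) N'" "\<And>S. N' S \<subseteq> N S"
    and lead: "\<And>m \<pi> a q. (m, \<pi>, a) \<in> idx d \<Longrightarrow> q \<in> N (oi_interval m) \<Longrightarrow> dominates (marked_order d m) (\<pi>, a) q \<Longrightarrow>
      \<exists>q'\<in>N' (oi_interval m). dominates (marked_order d m) (\<pi>, a) q' \<and> coef q' \<pi> a = coef q \<pi> a"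
    and q: "q \<in> N (oi_interval m)"
  shows "q \<in> N' (oi_interval m)"
proof -
  let ?K = "\<lambda>e :: expo. Poly_Mapping.keys e \<subseteq> {0..c} \<times> {1..m}"
  note ord = term_order_marked_order[of d]
  have main: "\<forall>\<pi> a q. (m, \<pi>, a) \<in> idx d \<and> e = marked d (\<pi>, a) \<and> q \<in> N (oi_interval m) \<and>
      dominates (marked_order d m) (\<pi>, a) q \<longrightarrow> q \<in> N' (oi_interval m)" for e
  proof (induction e rule: wf_induct_rule[OF wf_expo_less[of "{0..c}" m]])
    case (2 e)
    show ?case
    proof (intro allI impI, elim conjE)
      fix \<pi> a q assume idx: "(m, \<pi>, a) \<in> idx d" and e: "e = marked d (\<pi>, a)" and q: "q \<in> N (oi_interval m)"
        and dom: "dominates (marked_order d m) (\<pi>, a) q"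
      obtain q' where q': "q' \<in> N' (oi_interval m)" "dominates (marked_order d m) (\<pi>, a) q'" "coef q' \<pi> a = coef q \<pi> a"
        using lead[OF idx q dom] by blast
      \<comment> \<open>The remainder \<open>q - q'\<close>.\<close>
      let ?r = "q + free_smult (pol_const (- 1)) q'"
      have coef_r: "coef ?r \<rho> b = coef q \<rho> b - coef q' \<rho> b" for \<rho> b
        by (simp add: lookup_add lookup_const_mult)
      have r: "?r \<in> N (oi_interval m)"
        using q' N'(2) q by (intro sub_add[OF N] sub_smult[OF N] B_const) auto
      have "?r \<in> N' (oi_interval m)"
      proof (cases "?r = 0")
        case True
        then show ?thesis using sub_zero[OF N'(1)] by simp
      next
        case False
        then obtain \<rho> b where \<rho>: "(m, \<rho>, b) \<in> idx d" "coef ?r \<rho> b \<noteq> 0" "dominates (marked_order d m) (\<rho>, b) ?r"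
          using leading_index[OF ord sub_carrier[OF N r]] by blast
        have ne: "(\<rho>, b) \<noteq> (\<pi>, a)" using \<rho>(2) q'(3) by (auto simp: coef_r)
        have "coef q \<rho> b \<noteq> 0 \<or> coef q' \<rho> b \<noteq> 0" using \<rho>(2) by (auto simp: coef_r)
        then have "((\<pi>, a), (\<rho>, b)) \<in> marked_order d m" using dom q'(2) ne unfolding dominates_def by blast
        then have "(marked d (\<rho>, b), e) \<in> {(a, b). a < b \<and> ?K a \<and> ?K b}"
          using keys_marked[OF idx] keys_marked[OF \<rho>(1)] by (simp add: marked_order_def e)
        then show ?thesis using 2 \<rho> r by blast
      qed
      then have "?r + q' \<in> N' (oi_interval m)" using q'(1) by (rule sub_add[OF N'(1)])
      moreover have "?r + q' = q" by (intro poly_mapping_eqI) (simp add: lookup_add lookup_const_mult)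
      ultimately show "q \<in> N' (oi_interval m)" by simp
    qed
  qed auto
  show ?thesis
  proof (cases "q = 0")
    case True
    then show ?thesis using sub_zero[OF N'(1)] by simp
  next
    case False
    then show ?thesis using main leading_index[OF ord sub_carrier[OF N q]] q by metis
  qed
qed

lemma inter_free_submodule:
  assumes N: "oi_submodule B (free_module B d) (free_map d) N" and N': "oi_submodule B (free_module B d) (free_map d) N'"
  shows "oi_submodule B (free_module B d) (free_map d) (\<lambda>S. N S \<inter> N' S)"
  using assms unfolding oi_submodule_def free_submodule_iff by (simp add: image_subset_iff) blast

text \<open>
  The conditions chosen for \<open>lead_ideals\<close> of \<open>N\<close> are applied to \<open>N \<inter> N'\<close> rather than to \<open>N'\<close>, so
  that differences formed during division stay in \<open>N\<close>. The inclusion is stated at the objects \<open>[m]\<close>,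
  where the generators live.
\<close>

theorem free_submodule_finitely_generated:
  assumes N: "oi_submodule B (free_module B d) (free_map d) N"
  obtains G where "finite G" "G \<subseteq> oi_coprod N"
    "\<And>N' m. oi_submodule B (free_module B d) (free_map d) N' \<Longrightarrow> G \<subseteq> oi_coprod N' \<Longrightarrow> N (oi_interval m) \<subseteq> N' (oi_interval m)"
proof -
  note ord = term_order_marked_order[of d]
  obtain E where E: "finite E" "\<And>m \<pi> a q. (m, \<pi>, a, q) \<in> E \<Longrightarrow>
      (m, \<pi>, a) \<in> idx d \<and> q \<in> N (oi_interval m) \<and> dominates (marked_order d m) (\<pi>, a) q"
    "\<And>I m \<pi> a q. coeff_system d I \<Longrightarrow> (\<And>m \<pi> a q. (m, \<pi>, a, q) \<in> E \<Longrightarrow> coef q \<pi> a \<in> I (m, \<pi>, a)) \<Longrightarrow>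
      (m, \<pi>, a) \<in> idx d \<Longrightarrow> q \<in> N (oi_interval m) \<Longrightarrow> dominates (marked_order d m) (\<pi>, a) q \<Longrightarrow> coef q \<pi> a \<in> I (m, \<pi>, a)"
    by (rule lead_ideals_finite_generation[OF N ord]) blast
  let ?G = "(\<lambda>(m, \<pi>, a, q). (m, q)) ` E"
  show thesis
  proof (rule that[of ?G])
    show "finite ?G" using E(1) by simp
    show "?G \<subseteq> oi_coprod N" using E(2) by (auto simp: oi_coprod_def)
    fix N' m assume N': "oi_submodule B (free_module B d) (free_map d) N'" and G: "?G \<subseteq> oi_coprod N'"
    let ?N = "\<lambda>S. N S \<inter> N' S"
    have sub: "oi_submodule B (free_module B d) (free_map d) ?N" using N N' by (rule inter_free_submodule)
    have gen: "coef q \<pi> a \<in> lead_ideals (marked_order d) ?N (m, \<pi>, a)" if "(m, \<pi>, a, q) \<in> E" for m \<pi> a q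
      using E(2)[OF that] G that by (force simp: lead_ideals_def oi_coprod_def)
    show "N (oi_interval m) \<subseteq> N' (oi_interval m)"
    proof
      fix q assume "q \<in> N (oi_interval m)"
      then have "q \<in> ?N (oi_interval m)"
      proof (rule free_submodule_mem_if_leads[OF N sub, rotated 2])
        fix m \<pi> a q assume *: "(m, \<pi>, a) \<in> idx d" "q \<in> N (oi_interval m)" "dominates (marked_order d m) (\<pi>, a) q"
        have "coef q \<pi> a \<in> lead_ideals (marked_order d) ?N (m, \<pi>, a)"
          using E(3)[OF coeff_system_lead_ideals[OF sub ord] gen *] by blast
        then show "\<exists>q'\<in>?N (oi_interval m). dominates (marked_order d m) (\<pi>, a) q' \<and> coef q' \<pi> a = coef q \<pi> a"
          by (auto simp: lead_ideals_def)
      qed auto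
      then show "q \<in> N' (oi_interval m)" by simp
    qed
  qed
qed

end

section \<open>Modules over the algebra\<close>

text \<open>
  Every object is isomorphic to an interval: that the two morphisms are mutually inverse
  follows from \<open>oi_endo_eq_id\<close>.
\<close>

lemma oi_iso_interval:
  obtains n \<delta> \<epsilon> where "\<delta> \<in> oi_hom S (oi_interval n)" "\<epsilon> \<in> oi_hom (oi_interval n) S"
proof -
  let ?n = "card (fset S)"
  obtain h where h: "bij_betw h {..<?n} (fset S)" "strict_mono_on {..<?n} h"
    using ex_bij_betw_strict_mono_card[of "fset S"] by auto
  have "(\<lambda>j\<in>{1..?n}. h (j - 1)) \<in> oi_hom (oi_interval ?n) S"
    using strict_mono_onD[OF h(2)] bij_betwE[OF h(1)]
    by (auto simp: oi_hom_def strict_mono_on_def diff_less_mono)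
  \<comment> \<open>An element of \<open>S\<close> is sent to its rank.\<close>
  moreover have "(\<lambda>s\<in>fset S. card {t \<in> fset S. t \<le> s}) \<in> oi_hom S (oi_interval ?n)"
  proof -
    have "0 < card {t \<in> fset S. t \<le> s}" if "s \<in> fset S" for s
      using that by (subst card_gt_0_iff) auto
    moreover have "card {t \<in> fset S. t \<le> s} \<le> ?n" for s by (intro card_mono) auto
    moreover have "card {t \<in> fset S. t \<le> r} < card {t \<in> fset S. t \<le> s}" if "r < s" "s \<in> fset S" for r s
    proof (rule psubset_card_mono)
      have "s \<in> {t \<in> fset S. t \<le> s}" "s \<notin> {t \<in> fset S. t \<le> r}" using that by auto
      then show "{t \<in> fset S. t \<le> r} \<subset> {t \<in> fset S. t \<le> s}" using that(1) by fastforce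
    qed simp
    ultimately show ?thesis by (auto simp: oi_hom_def strict_mono_on_def Suc_le_eq)
  qed
  ultimately show thesis using that by blast
qed

lemma finite_oi_hom: "finite (oi_hom S T)"
  by (rule finite_subset[of _ "fset S \<rightarrow>\<^sub>E fset T"]) (auto simp: oi_hom_def intro: finite_PiE)

locale saturated_oi_module = saturated_monomial_algebra B c + oi_module B M \<Phi>
  for B :: "nat fset \<Rightarrow> 'k::comm_ring_1 pol set" and c :: nat
    and M :: "nat fset \<Rightarrow> ('k pol, 'm) module" and \<Phi> :: "nat fset \<Rightarrow> nat fset \<Rightarrow> (nat \<Rightarrow> nat) \<Rightarrow> 'm \<Rightarrow> 'm"
begin

lemma map_mem: "\<epsilon> \<in> oi_hom S T \<Longrightarrow> q \<in> carrier (M S) \<Longrightarrow> \<Phi> S T \<epsilon> q \<in> carrier (M T)"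
  using map_closed by blast

lemma map_zero:
  assumes "\<epsilon> \<in> oi_hom S T"
  shows "\<Phi> S T \<epsilon> \<zero>\<^bsub>M S\<^esub> = \<zero>\<^bsub>M T\<^esub>"
proof -
  interpret S: module "alg_ring (B S)" "M S" by (rule module_obj)
  interpret T: module "alg_ring (B T)" "M T" by (rule module_obj)
  have "\<Phi> S T \<epsilon> (pol_const 0 \<odot>\<^bsub>M S\<^esub> \<zero>\<^bsub>M S\<^esub>) = pol_const 0 \<odot>\<^bsub>M T\<^esub> \<Phi> S T \<epsilon> \<zero>\<^bsub>M S\<^esub>"
    by (rule map_scalar[OF assms]) simp
  then show ?thesis
    using S.smult_l_null[of "\<zero>\<^bsub>M S\<^esub>"] T.smult_l_null[OF map_mem[OF assms, of "\<zero>\<^bsub>M S\<^esub>"]] by (simp add: pol_const_def)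
qed

lemma map_smult_self:
  assumes \<epsilon>: "\<epsilon> \<in> oi_hom S T" and "a \<in> B S" "q \<in> carrier (M S)"
  shows "\<Phi> S T \<epsilon> (a \<odot>\<^bsub>M S\<^esub> q) = pol_map \<epsilon> a \<odot>\<^bsub>M T\<^esub> \<Phi> S T \<epsilon> q"
proof -
  have "compose (fset S) \<epsilon> (oi_id S) = \<epsilon>"
    using oi_hom_ext[OF \<epsilon>] by (auto simp: compose_def oi_id_def extensional_def fun_eq_iff)
  then show ?thesis
    using map_smult[OF oi_id_hom \<epsilon> assms(2,3)] pol_map_id[OF B_sub_P[OF assms(2)]] by simp
qed

lemma map_finsum:
  assumes \<epsilon>: "\<epsilon> \<in> oi_hom S T" and "finite A" "f \<in> A \<rightarrow> carrier (M S)"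
  shows "\<Phi> S T \<epsilon> (finsum (M S) f A) = finsum (M T) (\<lambda>x. \<Phi> S T \<epsilon> (f x)) A"
proof -
  interpret S: module "alg_ring (B S)" "M S" by (rule module_obj)
  interpret T: module "alg_ring (B T)" "M T" by (rule module_obj)
  show ?thesis
    using assms(2,3)
  proof (induction rule: finite_induct)
    case empty
    show ?case using map_zero[OF \<epsilon>] by simp
  next
    case (insert x A)
    then have "f \<in> A \<rightarrow> carrier (M S)" "f x \<in> carrier (M S)" "(\<lambda>x. \<Phi> S T \<epsilon> (f x)) \<in> A \<rightarrow> carrier (M T)"
      using map_mem[OF \<epsilon>] by (auto simp: Pi_iff)
    then show ?case
      using insert.hyps insert.IH map_mem[OF \<epsilon>] map_add[OF \<epsilon>] by simp
  qed
qed

lemma oi_submodule_iff: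
  "oi_submodule B M \<Phi> N \<longleftrightarrow>
     (\<forall>S. N S \<subseteq> carrier (M S) \<and> \<zero>\<^bsub>M S\<^esub> \<in> N S \<and> (\<forall>x\<in>N S. \<forall>y\<in>N S. x \<oplus>\<^bsub>M S\<^esub> y \<in> N S) \<and>
        (\<forall>a\<in>B S. \<forall>x\<in>N S. a \<odot>\<^bsub>M S\<^esub> x \<in> N S)) \<and>
     (\<forall>S T. \<forall>\<epsilon>\<in>oi_hom S T. \<forall>x\<in>N S. \<Phi> S T \<epsilon> x \<in> N T)"
  by (simp add: oi_submodule_def submodule_iff[OF module_obj] image_subset_iff)

lemma oi_submoduleD:
  assumes "oi_submodule B M \<Phi> N"
  shows msub_carrier: "\<And>S x. x \<in> N S \<Longrightarrow> x \<in> carrier (M S)"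
    and msub_zero: "\<And>S. \<zero>\<^bsub>M S\<^esub> \<in> N S"
    and msub_add: "\<And>S x y. x \<in> N S \<Longrightarrow> y \<in> N S \<Longrightarrow> x \<oplus>\<^bsub>M S\<^esub> y \<in> N S"
    and msub_smult: "\<And>S a x. a \<in> B S \<Longrightarrow> x \<in> N S \<Longrightarrow> a \<odot>\<^bsub>M S\<^esub> x \<in> N S"
    and msub_map: "\<And>S T \<epsilon> x. \<epsilon> \<in> oi_hom S T \<Longrightarrow> x \<in> N S \<Longrightarrow> \<Phi> S T \<epsilon> x \<in> N T"
  using assms unfolding oi_submodule_iff by blast+

lemma msub_minus:
  assumes "oi_submodule B M \<Phi> N" "x \<in> N S"
  shows "\<ominus>\<^bsub>M S\<^esub> x \<in> N S"
  using module.submoduleE(3)[OF module_obj, of "N S" S] assms by (auto simp: oi_submodule_def)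

lemma oi_submodule_carrier: "oi_submodule B M \<Phi> (\<lambda>S. carrier (M S))"
  unfolding oi_submodule_def using module.carrier_is_submodule[OF module_obj] map_mem by blast

lemma oi_submodule_inter:
  assumes "oi_submodule B M \<Phi> N" "oi_submodule B M \<Phi> N'"
  shows "oi_submodule B M \<Phi> (\<lambda>S. N S \<inter> N' S)"
  using assms unfolding oi_submodule_iff by blast

text \<open>
  An element at \<open>S\<close> is carried to an interval and back by an isomorphism.
\<close>

lemma oi_submodule_subset_of_intervals:
  assumes N: "oi_submodule B M \<Phi> N" and N': "oi_submodule B M \<Phi> N'"
    and sub: "\<And>m. N (oi_interval m) \<subseteq> N' (oi_interval m)"
  shows "N S \<subseteq> N' S"
proof
  fix x assume x: "x \<in> N S"
  obtain n \<delta> \<epsilon> where \<delta>: "\<delta> \<in> oi_hom S (oi_interval n)" and \<epsilon>: "\<epsilon> \<in> oi_hom (oi_interval n) S"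
    by (rule oi_iso_interval)
  have "\<Phi> (oi_interval n) S \<epsilon> (\<Phi> S (oi_interval n) \<delta> x) \<in> N' S"
    using msub_map[OF N \<delta> x] sub by (intro msub_map[OF N' \<epsilon>]) blast
  moreover have "compose (fset S) \<epsilon> \<delta> = oi_id S" by (rule oi_endo_eq_id[OF compose_oi_hom[OF \<delta> \<epsilon>]])
  ultimately show "x \<in> N' S"
    using map_comp[OF \<delta> \<epsilon> msub_carrier[OF N x]] map_id[OF msub_carrier[OF N x]] by simp
qed

lemma oi_span_least:
  assumes "oi_submodule B M \<Phi> N" "G \<subseteq> oi_coprod N"
  shows "oi_span B M \<Phi> G S \<subseteq> N S"
  using assms by (auto simp: oi_span_def)

lemma oi_span_generators: "G \<subseteq> oi_coprod (oi_span B M \<Phi> G)"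
  by (fastforce simp: oi_span_def oi_coprod_def)

lemma oi_submodule_span:
  assumes "G \<subseteq> oi_coprod (\<lambda>S. carrier (M S))"
  shows "oi_submodule B M \<Phi> (oi_span B M \<Phi> G)"
proof -
  have sub: "oi_span B M \<Phi> G S \<subseteq> carrier (M S)" for S
    by (rule oi_span_least[OF oi_submodule_carrier assms])
  have mem: "x \<in> oi_span B M \<Phi> G S \<longleftrightarrow> (\<forall>N. oi_submodule B M \<Phi> N \<and> G \<subseteq> oi_coprod N \<longrightarrow> x \<in> N S)" for x S
    by (auto simp: oi_span_def)
  show ?thesis
    unfolding oi_submodule_iff
  proof (intro conjI allI ballI)
    fix S show "oi_span B M \<Phi> G S \<subseteq> carrier (M S)" by (rule sub)
  qed (auto simp: mem intro: msub_zero msub_add msub_smult msub_map)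
qed


text \<open>
  The morphism of OI-modules from the free module on one generator of width \<open>d\<close> to \<open>M\<close> that sends \<open>e\<^sub>\<pi>\<close> to
  \<open>M(\<pi>)(g)\<close>. The sum runs over all morphisms \<open>\<pi>\<close>, not only over the support of \<open>q\<close>, so that sums for
  different \<open>q\<close> have the same index set.
\<close>

definition eval_at :: "nat \<Rightarrow> 'm \<Rightarrow> nat fset \<Rightarrow> 'k fvec \<Rightarrow> 'm" where
  "eval_at d g S q = (\<Oplus>\<^bsub>M S\<^esub>\<pi>\<in>oi_hom (oi_interval d) S. Poly_Mapping.lookup q \<pi> \<odot>\<^bsub>M S\<^esub> \<Phi> (oi_interval d) S \<pi> g)"

context
  fixes d g
  assumes g: "g \<in> carrier (M (oi_interval d))"
begin

lemma eval_summand: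
  assumes "q \<in> carrier (free_module B d S)" "\<pi> \<in> oi_hom (oi_interval d) S"
  shows "Poly_Mapping.lookup q \<pi> \<odot>\<^bsub>M S\<^esub> \<Phi> (oi_interval d) S \<pi> g \<in> carrier (M S)"
proof -
  interpret S: module "alg_ring (B S)" "M S" by (rule module_obj)
  show ?thesis using assms map_mem[OF assms(2) g] by (auto simp: free_carrier_iff)
qed

lemma eval_closed: "q \<in> carrier (free_module B d S) \<Longrightarrow> eval_at d g S q \<in> carrier (M S)"
proof -
  interpret S: module "alg_ring (B S)" "M S" by (rule module_obj)
  show "q \<in> carrier (free_module B d S) \<Longrightarrow> eval_at d g S q \<in> carrier (M S)"
    unfolding eval_at_def using eval_summand by (intro S.M.finsum_closed) auto
qed

lemma eval_zero: "eval_at d g S 0 = \<zero>\<^bsub>M S\<^esub>"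
proof -
  interpret S: module "alg_ring (B S)" "M S" by (rule module_obj)
  have "0 \<odot>\<^bsub>M S\<^esub> \<Phi> (oi_interval d) S \<pi> g = \<zero>\<^bsub>M S\<^esub>" if "\<pi> \<in> oi_hom (oi_interval d) S" for \<pi>
    using S.smult_l_null[OF map_mem[OF that g]] by simp
  then have "eval_at d g S 0 = (\<Oplus>\<^bsub>M S\<^esub>\<pi>\<in>oi_hom (oi_interval d) S. \<zero>\<^bsub>M S\<^esub>)"
    unfolding eval_at_def by (intro S.M.finsum_cong') auto
  then show ?thesis by simp
qed

lemma eval_add:
  assumes p: "p \<in> carrier (free_module B d S)" and q: "q \<in> carrier (free_module B d S)"
  shows "eval_at d g S (p + q) = eval_at d g S p \<oplus>\<^bsub>M S\<^esub> eval_at d g S q"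
proof -
  interpret S: module "alg_ring (B S)" "M S" by (rule module_obj)
  let ?e = "\<lambda>\<pi>. \<Phi> (oi_interval d) S \<pi> g"
  have "eval_at d g S (p + q) = (\<Oplus>\<^bsub>M S\<^esub>\<pi>\<in>oi_hom (oi_interval d) S.
      Poly_Mapping.lookup p \<pi> \<odot>\<^bsub>M S\<^esub> ?e \<pi> \<oplus>\<^bsub>M S\<^esub> Poly_Mapping.lookup q \<pi> \<odot>\<^bsub>M S\<^esub> ?e \<pi>)"
    unfolding eval_at_def
  proof (rule S.M.finsum_cong'[OF refl])
    fix \<pi> assume \<pi>: "\<pi> \<in> oi_hom (oi_interval d) S"
    show "Poly_Mapping.lookup (p + q) \<pi> \<odot>\<^bsub>M S\<^esub> ?e \<pi> =
        Poly_Mapping.lookup p \<pi> \<odot>\<^bsub>M S\<^esub> ?e \<pi> \<oplus>\<^bsub>M S\<^esub> Poly_Mapping.lookup q \<pi> \<odot>\<^bsub>M S\<^esub> ?e \<pi>"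
      using S.smult_l_distr[of "Poly_Mapping.lookup p \<pi>" "Poly_Mapping.lookup q \<pi>", OF _ _ map_mem[OF \<pi> g]] p q
      by (simp add: lookup_add free_carrier_iff)
  qed (use eval_summand[OF p] eval_summand[OF q] in auto)
  also have "\<dots> = eval_at d g S p \<oplus>\<^bsub>M S\<^esub> eval_at d g S q"
    unfolding eval_at_def using eval_summand[OF p] eval_summand[OF q] by (intro S.M.finsum_addf) auto
  finally show ?thesis .
qed

lemma eval_smult:
  assumes b: "b \<in> B S" and q: "q \<in> carrier (free_module B d S)"
  shows "eval_at d g S (free_smult b q) = b \<odot>\<^bsub>M S\<^esub> eval_at d g S q"
proof -
  interpret S: module "alg_ring (B S)" "M S" by (rule module_obj)
  let ?e = "\<lambda>\<pi>. \<Phi> (oi_interval d) S \<pi> g"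
  have "b \<odot>\<^bsub>M S\<^esub> eval_at d g S q = (\<Oplus>\<^bsub>M S\<^esub>\<pi>\<in>oi_hom (oi_interval d) S. b \<odot>\<^bsub>M S\<^esub> (Poly_Mapping.lookup q \<pi> \<odot>\<^bsub>M S\<^esub> ?e \<pi>))"
    unfolding eval_at_def using b eval_summand[OF q] by (intro S.finsum_smult_ldistr finite_oi_hom) auto
  also have "\<dots> = eval_at d g S (free_smult b q)"
    unfolding eval_at_def
  proof (rule S.M.finsum_cong'[OF refl])
    fix \<pi> assume \<pi>: "\<pi> \<in> oi_hom (oi_interval d) S"
    show "b \<odot>\<^bsub>M S\<^esub> (Poly_Mapping.lookup q \<pi> \<odot>\<^bsub>M S\<^esub> ?e \<pi>) = Poly_Mapping.lookup (free_smult b q) \<pi> \<odot>\<^bsub>M S\<^esub> ?e \<pi>"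
      using S.smult_assoc1[of b "Poly_Mapping.lookup q \<pi>", OF _ _ map_mem[OF \<pi> g]] b q
      by (simp add: free_carrier_iff)
  qed (use eval_summand[OF free_smult_closed[OF b q]] in auto)
  finally show ?thesis by simp
qed

text \<open>
  Postcomposition with \<open>\<epsilon>\<close> is injective on morphisms, and \<open>F(\<epsilon>)(q)\<close> has coefficient \<open>0\<close> at every
  morphism that does not factor through \<open>\<epsilon>\<close>; so the sum for \<open>F(\<epsilon>)(q)\<close> is a reindexing of the one for \<open>q\<close>.
\<close>

lemma eval_map:
  assumes \<epsilon>: "\<epsilon> \<in> oi_hom S T" and q: "q \<in> carrier (free_module B d S)"
  shows "\<Phi> S T \<epsilon> (eval_at d g S q) = eval_at d g T (free_map d S T \<epsilon> q)"
proof -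
  interpret S: module "alg_ring (B S)" "M S" by (rule module_obj)
  interpret T: module "alg_ring (B T)" "M T" by (rule module_obj)
  let ?h = "\<lambda>\<rho>. Poly_Mapping.lookup (free_map d S T \<epsilon> q) \<rho> \<odot>\<^bsub>M T\<^esub> \<Phi> (oi_interval d) T \<rho> g"
  let ?A = "oi_hom (oi_interval d) S"
  have h: "?h \<in> oi_hom (oi_interval d) T \<rightarrow> carrier (M T)"
    using eval_summand[OF free_map_closed[OF \<epsilon> q]] by auto
  have img: "compose {1..d} \<epsilon> ` ?A \<subseteq> oi_hom (oi_interval d) T"
    using compose_oi_hom[of _ "oi_interval d" S \<epsilon> T] \<epsilon> by auto
  have "\<Phi> S T \<epsilon> (eval_at d g S q) =
      (\<Oplus>\<^bsub>M T\<^esub>\<pi>\<in>?A. \<Phi> S T \<epsilon> (Poly_Mapping.lookup q \<pi> \<odot>\<^bsub>M S\<^esub> \<Phi> (oi_interval d) S \<pi> g))"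
    unfolding eval_at_def using eval_summand[OF q] by (intro map_finsum[OF \<epsilon> finite_oi_hom]) auto
  also have "\<dots> = (\<Oplus>\<^bsub>M T\<^esub>\<pi>\<in>?A. ?h (compose {1..d} \<epsilon> \<pi>))"
  proof (rule T.M.finsum_cong'[OF refl])
    fix \<pi> assume \<pi>: "\<pi> \<in> ?A"
    have "\<Phi> S T \<epsilon> (Poly_Mapping.lookup q \<pi> \<odot>\<^bsub>M S\<^esub> \<Phi> (oi_interval d) S \<pi> g) =
        pol_map \<epsilon> (Poly_Mapping.lookup q \<pi>) \<odot>\<^bsub>M T\<^esub> \<Phi> S T \<epsilon> (\<Phi> (oi_interval d) S \<pi> g)"
      using q map_mem[OF \<pi> g] by (intro map_smult_self[OF \<epsilon>]) (auto simp: free_carrier_iff)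
    also have "\<Phi> S T \<epsilon> (\<Phi> (oi_interval d) S \<pi> g) = \<Phi> (oi_interval d) T (compose {1..d} \<epsilon> \<pi>) g"
      using map_comp[OF \<pi> \<epsilon> g] by simp
    also have "pol_map \<epsilon> (Poly_Mapping.lookup q \<pi>) = Poly_Mapping.lookup (free_map d S T \<epsilon> q) (compose {1..d} \<epsilon> \<pi>)"
      using q by (intro lookup_free_map[OF \<epsilon> _ \<pi>, symmetric]) (simp add: free_carrier_iff)
    finally show "\<Phi> S T \<epsilon> (Poly_Mapping.lookup q \<pi> \<odot>\<^bsub>M S\<^esub> \<Phi> (oi_interval d) S \<pi> g) = ?h (compose {1..d} \<epsilon> \<pi>)" .
  qed (use h img in blast)
  also have "\<dots> = finsum (M T) ?h (compose {1..d} \<epsilon> ` ?A)"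
    using h img compose_inj_on_hom[OF \<epsilon>, of "oi_interval d"] by (intro T.M.finsum_reindex[symmetric]) auto
  also have "\<dots> = eval_at d g T (free_map d S T \<epsilon> q)"
    unfolding eval_at_def
  proof (rule T.M.add.finprod_mono_neutral_cong_left[OF finite_oi_hom img _ refl h])
    fix \<rho> assume \<rho>: "\<rho> \<in> oi_hom (oi_interval d) T - compose {1..d} \<epsilon> ` ?A"
    then have "\<rho> \<notin> Poly_Mapping.keys (free_map d S T \<epsilon> q)"
      using keys_free_map[of d S T \<epsilon> q] q unfolding free_carrier_iff by blast
    then show "?h \<rho> = \<zero>\<^bsub>M T\<^esub>"
      using T.smult_l_null[OF map_mem[OF _ g]] \<rho> by (simp add: in_keys_iff)
  qed
  finally show ?thesis .
qed

lemma eval_generator: "eval_at d g (oi_interval d) (Poly_Mapping.single (oi_id (oi_interval d)) 1) = g"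
proof -
  interpret S: module "alg_ring (B (oi_interval d))" "M (oi_interval d)" by (rule module_obj)
  have "oi_hom (oi_interval d) (oi_interval d) = {oi_id (oi_interval d)}"
    using oi_endo_eq_id oi_id_hom by blast
  then show ?thesis using g map_id[OF g] S.smult_one[OF g] by (simp add: eval_at_def)
qed

text \<open>
  The preimage of the submodule \<open>N + P\<close>.
\<close>

lemma oi_submodule_eval_preimage:
  assumes N: "oi_submodule B M \<Phi> N" and P: "oi_submodule B M \<Phi> P"
  shows "oi_submodule B (free_module B d) (free_map d)
    (\<lambda>S. {q \<in> carrier (free_module B d S). \<exists>n\<in>N S. \<exists>p\<in>P S. eval_at d g S q = n \<oplus>\<^bsub>M S\<^esub> p})"
    (is "oi_submodule B _ _ ?J")
  unfolding oi_submodule_def free_submodule_iff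
proof (intro conjI allI ballI)
  fix S
  interpret S: module "alg_ring (B S)" "M S" by (rule module_obj)
  interpret F: module "alg_ring (B S)" "free_module B d S" by (rule free_module_module)
  show "?J S \<subseteq> carrier (free_module B d S)" by blast
  have "eval_at d g S 0 = \<zero>\<^bsub>M S\<^esub> \<oplus>\<^bsub>M S\<^esub> \<zero>\<^bsub>M S\<^esub>" by (simp add: eval_zero)
  then show "0 \<in> ?J S" using msub_zero[OF N] msub_zero[OF P] F.M.zero_closed unfolding free_module_simps by blast
  show "q + r \<in> ?J S" if qr: "q \<in> ?J S" "r \<in> ?J S" for q r
  proof -
    obtain n p n' p' where *: "n \<in> N S" "p \<in> P S" "eval_at d g S q = n \<oplus>\<^bsub>M S\<^esub> p"
      "n' \<in> N S" "p' \<in> P S" "eval_at d g S r = n' \<oplus>\<^bsub>M S\<^esub> p'" using qr by blast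
    have "eval_at d g S (q + r) = (n \<oplus>\<^bsub>M S\<^esub> p) \<oplus>\<^bsub>M S\<^esub> (n' \<oplus>\<^bsub>M S\<^esub> p')"
      using qr eval_add[of q S r] * by simp
    also have "\<dots> = (n \<oplus>\<^bsub>M S\<^esub> n') \<oplus>\<^bsub>M S\<^esub> (p \<oplus>\<^bsub>M S\<^esub> p')"
      using *(1,2,4,5) msub_carrier[OF N] msub_carrier[OF P] by (simp add: S.M.a_ac)
    finally show ?thesis
      using qr * msub_add[OF N *(1,4)] msub_add[OF P *(2,5)] F.M.a_closed[of q r] by auto
  qed
  show "free_smult b q \<in> ?J S" if b: "b \<in> B S" and q: "q \<in> ?J S" for b q
  proof -
    obtain n p where *: "n \<in> N S" "p \<in> P S" "eval_at d g S q = n \<oplus>\<^bsub>M S\<^esub> p" using q by blast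
    have "eval_at d g S (free_smult b q) = b \<odot>\<^bsub>M S\<^esub> n \<oplus>\<^bsub>M S\<^esub> b \<odot>\<^bsub>M S\<^esub> p"
      using q b eval_smult[OF b, of q] S.smult_r_distr[of b n p] * msub_carrier[OF N] msub_carrier[OF P] by simp
    then show ?thesis
      using msub_smult[OF N b *(1)] msub_smult[OF P b *(2)] free_smult_closed[OF b] q by blast
  qed
next
  fix S T \<epsilon> assume \<epsilon>: "\<epsilon> \<in> oi_hom S T"
  show "free_map d S T \<epsilon> ` ?J S \<subseteq> ?J T"
  proof
    fix r assume "r \<in> free_map d S T \<epsilon> ` ?J S"
    then obtain q n p where *: "r = free_map d S T \<epsilon> q" "q \<in> carrier (free_module B d S)"
      "n \<in> N S" "p \<in> P S" "eval_at d g S q = n \<oplus>\<^bsub>M S\<^esub> p" by blast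
    have "eval_at d g T r = \<Phi> S T \<epsilon> n \<oplus>\<^bsub>M T\<^esub> \<Phi> S T \<epsilon> p"
      using eval_map[OF \<epsilon> *(2)] map_add[OF \<epsilon>] * msub_carrier[OF N] msub_carrier[OF P] by simp
    then show "r \<in> ?J T"
      using * msub_map[OF N \<epsilon>] msub_map[OF P \<epsilon>] free_map_closed[OF \<epsilon>] by blast
  qed
qed

end


text \<open>
  Comparing submodules at intervals is enough by \<open>oi_submodule_subset_of_intervals\<close>.
\<close>

definition fg_submodule :: "(nat fset \<Rightarrow> 'm set) \<Rightarrow> bool" where
  "fg_submodule N \<longleftrightarrow> (\<exists>G. finite G \<and> G \<subseteq> oi_coprod N \<and>
     (\<forall>N'. oi_submodule B M \<Phi> N' \<and> G \<subseteq> oi_coprod N' \<longrightarrow> (\<forall>m. N (oi_interval m) \<subseteq> N' (oi_interval m))))"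

lemma fg_submoduleE:
  assumes "fg_submodule N"
  obtains G where "finite G" "G \<subseteq> oi_coprod N"
    "\<And>N' m. oi_submodule B M \<Phi> N' \<Longrightarrow> G \<subseteq> oi_coprod N' \<Longrightarrow> N (oi_interval m) \<subseteq> N' (oi_interval m)"
proof -
  obtain G where G: "finite G" "G \<subseteq> oi_coprod N"
    "\<forall>N'. oi_submodule B M \<Phi> N' \<and> G \<subseteq> oi_coprod N' \<longrightarrow> (\<forall>m. N (oi_interval m) \<subseteq> N' (oi_interval m))"
    using assms unfolding fg_submodule_def by (elim exE conjE)
  show thesis by (rule that[OF G(1,2)]) (use G(3) in simp)
qed

text \<open>
  The elements \<open>eval_at d g S q \<oplus> p\<close> with \<open>p\<close> in the span of \<open>G\<close> form a submodule that contains all generators.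
\<close>

lemma oi_span_insert:
  assumes g: "g \<in> carrier (M (oi_interval d))" and G: "G \<subseteq> oi_coprod (\<lambda>S. carrier (M S))"
    and x: "x \<in> oi_span B M \<Phi> (insert (d, g) G) S"
  obtains q p where "q \<in> carrier (free_module B d S)" "p \<in> oi_span B M \<Phi> G S" "x = eval_at d g S q \<oplus>\<^bsub>M S\<^esub> p"
proof -
  let ?P = "oi_span B M \<Phi> G"
  have P: "oi_submodule B M \<Phi> ?P" by (rule oi_submodule_span[OF G])
  define N where "N S = {eval_at d g S q \<oplus>\<^bsub>M S\<^esub> p | q p. q \<in> carrier (free_module B d S) \<and> p \<in> ?P S}" for S
  have "oi_submodule B M \<Phi> N"
    unfolding oi_submodule_iff
  proof (intro conjI allI ballI)
    fix S
    interpret S: module "alg_ring (B S)" "M S" by (rule module_obj)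
    interpret F: module "alg_ring (B S)" "free_module B d S" by (rule free_module_module)
    note ev = eval_closed[OF g, of _ S]
    show "N S \<subseteq> carrier (M S)" using ev msub_carrier[OF P] by (auto simp: N_def)
    have "\<zero>\<^bsub>M S\<^esub> = eval_at d g S 0 \<oplus>\<^bsub>M S\<^esub> \<zero>\<^bsub>M S\<^esub>" by (simp add: eval_zero[OF g])
    then show "\<zero>\<^bsub>M S\<^esub> \<in> N S"
      using F.M.zero_closed msub_zero[OF P] unfolding N_def free_module_simps by blast
    show "y \<oplus>\<^bsub>M S\<^esub> z \<in> N S" if yz: "y \<in> N S" "z \<in> N S" for y z
    proof -
      obtain q p q' p' where *: "q \<in> carrier (free_module B d S)" "p \<in> ?P S" "y = eval_at d g S q \<oplus>\<^bsub>M S\<^esub> p"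
        "q' \<in> carrier (free_module B d S)" "p' \<in> ?P S" "z = eval_at d g S q' \<oplus>\<^bsub>M S\<^esub> p'"
        using yz unfolding N_def by blast
      have "y \<oplus>\<^bsub>M S\<^esub> z = eval_at d g S (q + q') \<oplus>\<^bsub>M S\<^esub> (p \<oplus>\<^bsub>M S\<^esub> p')"
        using * ev msub_carrier[OF P] by (simp add: eval_add[OF g] S.M.a_ac)
      then show ?thesis
        using F.M.a_closed[OF *(1,4)] msub_add[OF P *(2,5)] unfolding N_def free_module_simps by blast
    qed
    show "a \<odot>\<^bsub>M S\<^esub> y \<in> N S" if a: "a \<in> B S" and y: "y \<in> N S" for a y
    proof -
      obtain q p where *: "q \<in> carrier (free_module B d S)" "p \<in> ?P S" "y = eval_at d g S q \<oplus>\<^bsub>M S\<^esub> p"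
        using y unfolding N_def by blast
      have "a \<odot>\<^bsub>M S\<^esub> y = eval_at d g S (free_smult a q) \<oplus>\<^bsub>M S\<^esub> a \<odot>\<^bsub>M S\<^esub> p"
        using a * ev msub_carrier[OF P] by (simp add: eval_smult[OF g] S.smult_r_distr)
      then show ?thesis
        using free_smult_closed[OF a *(1)] msub_smult[OF P a *(2)] unfolding N_def by blast
    qed
  next
    fix S T \<epsilon> y assume \<epsilon>: "\<epsilon> \<in> oi_hom S T" and "y \<in> N S"
    then obtain q p where *: "q \<in> carrier (free_module B d S)" "p \<in> ?P S" "y = eval_at d g S q \<oplus>\<^bsub>M S\<^esub> p"
      unfolding N_def by blast
    have "\<Phi> S T \<epsilon> y = eval_at d g T (free_map d S T \<epsilon> q) \<oplus>\<^bsub>M T\<^esub> \<Phi> S T \<epsilon> p"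
      using * eval_closed[OF g *(1)] msub_carrier[OF P] by (simp add: map_add[OF \<epsilon>] eval_map[OF g \<epsilon>])
    then show "\<Phi> S T \<epsilon> y \<in> N T"
      using free_map_closed[OF \<epsilon> *(1)] msub_map[OF P \<epsilon> *(2)] unfolding N_def by blast
  qed
  moreover have "insert (d, g) G \<subseteq> oi_coprod N"
  proof -
    have "g \<in> N (oi_interval d)"
    proof -
      interpret S: module "alg_ring (B (oi_interval d))" "M (oi_interval d)" by (rule module_obj)
      have "g = eval_at d g (oi_interval d) (Poly_Mapping.single (oi_id (oi_interval d)) 1) \<oplus>\<^bsub>M (oi_interval d)\<^esub> \<zero>\<^bsub>M (oi_interval d)\<^esub>"
        using g by (simp add: eval_generator[OF g])
      moreover have "Poly_Mapping.single (oi_id (oi_interval d)) 1 \<in> carrier (free_module B d (oi_interval d))"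
        by (auto simp: free_carrier_iff lookup_single when_def)
      ultimately show ?thesis using msub_zero[OF P] unfolding N_def by blast
    qed
    moreover have "h \<in> N (oi_interval m)" if "(m, h) \<in> G" for m h
    proof -
      interpret S: module "alg_ring (B (oi_interval m))" "M (oi_interval m)" by (rule module_obj)
      interpret F: module "alg_ring (B (oi_interval m))" "free_module B d (oi_interval m)" by (rule free_module_module)
      have h: "h \<in> ?P (oi_interval m)" using oi_span_generators[of G] that by (auto simp: oi_coprod_def)
      then have "h = eval_at d g (oi_interval m) 0 \<oplus>\<^bsub>M (oi_interval m)\<^esub> h"
        using msub_carrier[OF P h] by (simp add: eval_zero[OF g])
      then show ?thesis using F.M.zero_closed h unfolding N_def free_module_simps by blast
    qed
    ultimately show ?thesis by (auto simp: oi_coprod_def)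
  qed
  ultimately have "x \<in> N S" using oi_span_least x by blast
  then show thesis using that unfolding N_def by blast
qed

text \<open>
  The extension argument. Let \<open>H\<close> generate the preimage of \<open>N + P\<close> in the free module, and lift the image of
  each \<open>h \<in> H\<close> to \<open>f h \<in> N\<close>, modulo \<open>P\<close>. Together with generators of \<open>N \<inter> P\<close> these lifts generate \<open>N\<close>: if they
  lie in \<open>N'\<close>, then \<open>H\<close> lies in the preimage of \<open>(N \<inter> N') + P\<close>, so every element of \<open>N\<close> differs from
  one of \<open>N \<inter> N'\<close> by an element of \<open>N \<inter> P\<close>.
\<close>

lemma fg_submodule_step:
  assumes g: "g \<in> carrier (M (oi_interval d))" and P: "oi_submodule B M \<Phi> P" and N: "oi_submodule B M \<Phi> N"
    and NP: "\<And>m x. x \<in> N (oi_interval m) \<Longrightarrow> \<exists>q\<in>carrier (free_module B d (oi_interval m)).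
        \<exists>p\<in>P (oi_interval m). x = eval_at d g (oi_interval m) q \<oplus>\<^bsub>M (oi_interval m)\<^esub> p"
    and fg: "fg_submodule (\<lambda>S. N S \<inter> P S)"
  shows "fg_submodule N"
proof -
  let ?J = "\<lambda>N S. {q \<in> carrier (free_module B d S). \<exists>n\<in>N S. \<exists>p\<in>P S. eval_at d g S q = n \<oplus>\<^bsub>M S\<^esub> p}"
  have J: "oi_submodule B (free_module B d) (free_map d) (?J N')" if "oi_submodule B M \<Phi> N'" for N'
    by (rule oi_submodule_eval_preimage[OF g that P])
  obtain H where H: "finite H" "H \<subseteq> oi_coprod (?J N)"
    "\<And>J' m. oi_submodule B (free_module B d) (free_map d) J' \<Longrightarrow> H \<subseteq> oi_coprod J' \<Longrightarrow> ?J N (oi_interval m) \<subseteq> J' (oi_interval m)"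
    by (rule free_submodule_finitely_generated[OF J[OF N]]) blast
  obtain K where K: "finite K" "K \<subseteq> oi_coprod (\<lambda>S. N S \<inter> P S)"
    "\<And>N' m. oi_submodule B M \<Phi> N' \<Longrightarrow> K \<subseteq> oi_coprod N' \<Longrightarrow> N (oi_interval m) \<inter> P (oi_interval m) \<subseteq> N' (oi_interval m)"
    by (rule fg_submoduleE[OF fg]) simp
  have "\<exists>n. n \<in> N (oi_interval (fst h)) \<and>
      (\<exists>p\<in>P (oi_interval (fst h)). eval_at d g (oi_interval (fst h)) (snd h) = n \<oplus>\<^bsub>M (oi_interval (fst h))\<^esub> p)"
    if "h \<in> H" for h
  proof -
    have "snd h \<in> ?J N (oi_interval (fst h))" using that H(2) by (cases h) (auto simp: oi_coprod_def)
    then show ?thesis by blast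
  qed
  then obtain f where f: "\<And>h. h \<in> H \<Longrightarrow> f h \<in> N (oi_interval (fst h)) \<and>
      (\<exists>p\<in>P (oi_interval (fst h)). eval_at d g (oi_interval (fst h)) (snd h) = f h \<oplus>\<^bsub>M (oi_interval (fst h))\<^esub> p)"
    by metis
  let ?G = "K \<union> (\<lambda>h. (fst h, f h)) ` H"
  have "finite ?G" using H(1) K(1) by simp
  moreover have "?G \<subseteq> oi_coprod N" using K(2) f by (auto simp: oi_coprod_def)
  moreover have "N (oi_interval m) \<subseteq> N' (oi_interval m)"
    if N': "oi_submodule B M \<Phi> N'" and G: "?G \<subseteq> oi_coprod N'" for N' m
  proof
    \<comment> \<open>For \<open>x \<in> N\<close> with \<open>x = eval q + p\<close>, replace \<open>eval q\<close> by some \<open>n + p'\<close> with \<open>n \<in> N \<inter> N'\<close>; the rest \<open>p' + p\<close> lies in \<open>N \<inter> P\<close>.\<close>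
    let ?m = "oi_interval m"
    interpret S: module "alg_ring (B ?m)" "M ?m" by (rule module_obj)
    have NN': "oi_submodule B M \<Phi> (\<lambda>S. N S \<inter> N' S)" using N N' by (rule oi_submodule_inter)
    have "H \<subseteq> oi_coprod (?J (\<lambda>S. N S \<inter> N' S))"
    proof
      fix h assume h: "h \<in> H"
      then have "snd h \<in> carrier (free_module B d (oi_interval (fst h)))" "f h \<in> N' (oi_interval (fst h))"
        using H(2) G by (auto simp: oi_coprod_def)
      then have "snd h \<in> ?J (\<lambda>S. N S \<inter> N' S) (oi_interval (fst h))" using f[OF h] by blast
      then show "h \<in> oi_coprod (?J (\<lambda>S. N S \<inter> N' S))" by (cases h) (simp add: oi_coprod_def)
    qed
    then have J_sub: "?J N ?m \<subseteq> ?J (\<lambda>S. N S \<inter> N' S) ?m" by (rule H(3)[OF J[OF NN']])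
    have K_sub: "N ?m \<inter> P ?m \<subseteq> N' ?m" using G by (intro K(3)[OF N']) blast
    fix x assume x: "x \<in> N ?m"
    then obtain q p where q: "q \<in> carrier (free_module B d ?m)" "p \<in> P ?m" "x = eval_at d g ?m q \<oplus>\<^bsub>M ?m\<^esub> p"
      using NP by blast
    note xc = msub_carrier[OF N x] and pc = msub_carrier[OF P q(2)] and ec = eval_closed[OF g q(1)]
    have "eval_at d g ?m q = x \<oplus>\<^bsub>M ?m\<^esub> \<ominus>\<^bsub>M ?m\<^esub> p"
      using q(3) xc pc ec by (simp add: S.M.a_assoc S.M.r_neg)
    then have "q \<in> ?J N ?m" using q(1) x msub_minus[OF P q(2)] by blast
    then obtain n p' where n: "n \<in> N ?m" "n \<in> N' ?m" "p' \<in> P ?m" "eval_at d g ?m q = n \<oplus>\<^bsub>M ?m\<^esub> p'"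
      using J_sub by blast
    note nc = msub_carrier[OF N n(1)] and p'c = msub_carrier[OF P n(3)]
    have x_eq: "x = n \<oplus>\<^bsub>M ?m\<^esub> (p' \<oplus>\<^bsub>M ?m\<^esub> p)" using q(3) n(4) nc pc p'c by (simp add: S.M.a_assoc)
    have "p' \<oplus>\<^bsub>M ?m\<^esub> p = \<ominus>\<^bsub>M ?m\<^esub> n \<oplus>\<^bsub>M ?m\<^esub> x"
      using x_eq nc pc p'c by (simp add: S.M.r_neg1)
    then have "p' \<oplus>\<^bsub>M ?m\<^esub> p \<in> N ?m" using msub_add[OF N msub_minus[OF N n(1)] x] by simp
    then have "p' \<oplus>\<^bsub>M ?m\<^esub> p \<in> N' ?m" using msub_add[OF P n(3) q(2)] K_sub by blast
    then show "x \<in> N' ?m" using msub_add[OF N' n(2)] x_eq by simp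
  qed
  ultimately show ?thesis unfolding fg_submodule_def by (intro exI[of _ ?G]) simp
qed

lemma fg_submodule_if_in_span:
  assumes "finite G" "G \<subseteq> oi_coprod (\<lambda>S. carrier (M S))"
    and "oi_submodule B M \<Phi> N" "\<And>m. N (oi_interval m) \<subseteq> oi_span B M \<Phi> G (oi_interval m)"
  shows "fg_submodule N"
  using assms
proof (induction G arbitrary: N rule: finite_induct)
  case empty
  have "oi_submodule B M \<Phi> (\<lambda>S. {\<zero>\<^bsub>M S\<^esub>})"
    unfolding oi_submodule_iff
  proof (intro conjI allI ballI)
    fix S
    interpret S: module "alg_ring (B S)" "M S" by (rule module_obj)
    show "{\<zero>\<^bsub>M S\<^esub>} \<subseteq> carrier (M S)" "\<zero>\<^bsub>M S\<^esub> \<in> {\<zero>\<^bsub>M S\<^esub>}" by auto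
    show "x \<oplus>\<^bsub>M S\<^esub> y \<in> {\<zero>\<^bsub>M S\<^esub>}" if "x \<in> {\<zero>\<^bsub>M S\<^esub>}" "y \<in> {\<zero>\<^bsub>M S\<^esub>}" for x y using that by simp
    show "a \<odot>\<^bsub>M S\<^esub> x \<in> {\<zero>\<^bsub>M S\<^esub>}" if "x \<in> {\<zero>\<^bsub>M S\<^esub>}" "a \<in> B S" for a x using that S.smult_r_null[of a] by simp
  qed (use map_zero in auto)
  then have "N (oi_interval m) \<subseteq> {\<zero>\<^bsub>M (oi_interval m)\<^esub>}" for m
    using oi_span_least[of "\<lambda>S. {\<zero>\<^bsub>M S\<^esub>}" "{}" "oi_interval m"] empty.prems(3)[of m] by simp
  then have "N (oi_interval m) \<subseteq> N' (oi_interval m)" if "oi_submodule B M \<Phi> N'" for N' m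
    using msub_zero[OF that] by blast
  then show ?case unfolding fg_submodule_def by (intro exI[of _ "{}"]) auto
next
  case (insert e G)
  obtain d g where e: "e = (d, g)" by (cases e)
  have g: "g \<in> carrier (M (oi_interval d))" and G: "G \<subseteq> oi_coprod (\<lambda>S. carrier (M S))"
    using insert.prems(1) by (auto simp: e oi_coprod_def)
  note P = oi_submodule_span[OF G]
  show ?case
  proof (rule fg_submodule_step[OF g P insert.prems(2)])
    show "\<exists>q\<in>carrier (free_module B d (oi_interval m)). \<exists>p\<in>oi_span B M \<Phi> G (oi_interval m).
        x = eval_at d g (oi_interval m) q \<oplus>\<^bsub>M (oi_interval m)\<^esub> p" if "x \<in> N (oi_interval m)" for m x
      using oi_span_insert[OF g G, of x "oi_interval m"] insert.prems(3)[of m] that e by blast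
    show "fg_submodule (\<lambda>S. N S \<inter> oi_span B M \<Phi> G S)"
      by (rule insert.IH[OF G oi_submodule_inter[OF insert.prems(2) P]]) blast
  qed
qed

text \<open>
  A submodule of \<open>N\<close>, with \<open>N\<close> regarded as a module of its own, is the same as a submodule of \<open>M\<close>
  contained in \<open>N\<close>.
\<close>

theorem finitely_generated_imp_noetherian:
  assumes "oi_finitely_generated B M \<Phi>"
  shows "oi_noetherian B M \<Phi>"
  unfolding oi_noetherian_def
proof (intro allI impI)
  fix N assume N: "oi_submodule B M \<Phi> N"
  obtain G where G: "finite G" "G \<subseteq> oi_coprod (\<lambda>S. carrier (M S))"
    "\<And>N'. oi_submodule B M \<Phi> N' \<Longrightarrow> G \<subseteq> oi_coprod N' \<Longrightarrow> N' = (\<lambda>S. carrier (M S))"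
    using assms unfolding oi_finitely_generated_def by blast
  have "oi_span B M \<Phi> G = (\<lambda>S. carrier (M S))"
    by (rule G(3)[OF oi_submodule_span[OF G(2)] oi_span_generators])
  then have fg: "fg_submodule N"
    using msub_carrier[OF N] by (intro fg_submodule_if_in_span[OF G(1,2) N]) auto
  obtain H where H: "finite H" "H \<subseteq> oi_coprod N"
    "\<And>N' m. oi_submodule B M \<Phi> N' \<Longrightarrow> H \<subseteq> oi_coprod N' \<Longrightarrow> N (oi_interval m) \<subseteq> N' (oi_interval m)"
    by (rule fg_submoduleE[OF fg]) simp
  have "N' = N" if N': "oi_submodule B (\<lambda>S. M S\<lparr>carrier := N S\<rparr>) \<Phi> N'" and HN': "H \<subseteq> oi_coprod N'" for N'
  proof -
    have "module (alg_ring (B S)) (M S\<lparr>carrier := N S\<rparr>)" for S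
      using submodule.submodule_is_module[OF _ module_obj] N by (auto simp: oi_submodule_def)
    note iff = submodule_iff[OF this]
    have sub: "N' S \<subseteq> N S" for S using N' by (simp add: oi_submodule_def iff)
    have "N' S \<subseteq> carrier (M S)" for S using sub msub_carrier[OF N] by blast
    then have "submodule (N' S) (alg_ring (B S)) (M S)" for S
      using N' by (simp add: oi_submodule_def iff submodule_iff[OF module_obj])
    then have *: "oi_submodule B M \<Phi> N'" using N' by (simp add: oi_submodule_def)
    have "N S \<subseteq> N' S" for S by (rule oi_submodule_subset_of_intervals[OF N *]) (rule H(3)[OF * HN'])
    with sub have "N' S = N S" for S by (intro equalityI)
    then show ?thesis by (rule ext)
  qed
  then show "oi_finitely_generated B (\<lambda>S. M S\<lparr>carrier := N S\<rparr>) \<Phi>"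
    unfolding oi_finitely_generated_def using H(1,2) by (intro exI[of _ H]) auto
qed

end

theorem proposition6p17:
  fixes B :: "nat fset \<Rightarrow> 'k::comm_ring_1 pol set"
    and c :: nat
  assumes "noetherian_ring (ring_of_type_algebra :: 'k ring)"
    and "c \<ge> 1"
    and "oi_subalgebra (oi_P c) B"
    and "oi_alg_monomially_generated B"
    and "\<And>m n \<nu> \<mu> \<epsilon> \<kappa>.
      \<lbrakk>\<nu> \<in> pol_monomials B m; \<mu> \<in> pol_monomials B n;
       \<epsilon> \<in> oi_hom (oi_interval m) (oi_interval n); \<kappa> \<in> oi_P c (oi_interval n);
       \<mu> = pol_map \<epsilon> \<nu> * \<kappa>\<rbrakk> \<Longrightarrow> \<kappa> \<in> B (oi_interval n)"
  shows "(\<forall>(d::nat) gt N.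
            oi_submodule B (free_module B d) (free_map d) N \<and> monomial_order B d gt \<longrightarrow>
            (\<exists>G. finite G \<and> groebner_basis B d gt N G)) \<and>
         (\<forall>(M :: nat fset \<Rightarrow> ('k pol, 'm) module) \<Phi>.
            oi_module B M \<Phi> \<and> oi_finitely_generated B M \<Phi> \<longrightarrow> oi_noetherian B M \<Phi>)"
proof -
  have alg: "saturated_monomial_algebra B c"
    using assms(1,3,4,5) by (rule saturated_monomial_algebra.intro)
  have "oi_noetherian B M \<Phi>" if "oi_module B M \<Phi>" "oi_finitely_generated B M \<Phi>"
    for M :: "nat fset \<Rightarrow> ('k pol, 'm) module" and \<Phi>
    using alg that saturated_oi_module.finitely_generated_imp_noetherian[of B c M \<Phi>]
    by (simp add: saturated_oi_module_def)
  then show ?thesis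
    using saturated_monomial_algebra.finite_groebner_basis[OF alg] by blast
qed

end
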